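(* Let $U\subset\hat{\mathbb{C}}$ be a simply connected domain such that $K:=\hat{\mathbb{C}}\setminus U$ contains more than one point, and let $z_0\in\partial U$. Then $K$ is locally connected at $z_0$ if and only if $z_0$ is strongly minimal in every prime end of $U$ whose impression contains $z_0$.
   Context: $\hat{\mathbb{C}}$ is the Riemann sphere; diameters are taken in the spherical metric and closures in $\hat{\mathbb{C}}$. Local connectivity at a point: $K$ is locally connected at $z_0\in K$ if $z_0$ has arbitrarily small connected (not necessarily open) neighborhoods in $K$; that is, for every neighborhood $N$ of $z_0$ in $K$ there is a connected set $N'\subset N$ containing $z_0$ in its interior relative to $K$. Prime ends: A crosscut $C$ of $U$ is a closed Jordan arc which intersects $\hat{\mathbb{C}}\setminus U$ exactly in its two endpoints; a crosscut separates $U$ into exactly two components. Fix a base point $b\in U$ (its choice is immaterial). If $C$ is a crosscut of $U$ with $b\notin C$, let $U_C$ be the component of $U\setminus C$ not containing $b$. A prime end of $U$ is represented by a sequence of pairwise disjoint crosscuts $(C_n)$, none containing $b$, such that $\operatorname{diam} C_n\to 0$ and $C_{n+1}\subset\overline{U_{C_n}}$ for all $n$. Two such sequences $(C_n)$ and $(\tilde C_n)$ represent the same prime end if, for every $n$, $\tilde C_j\cap U\subset U_{C_n}$ for all sufficiently large $j$, and vice versa with the roles of the two sequences exchanged. Let $p$ be a prime end represented by $(C_n)$. Its impression is $I(p):=\bigcap_n\overline{U_{C_n}}\subset\partial U$. A sequence $w_j\in U$ converges to $p$ if, for every $n$, $w_j\in U_{C_n}$ for all sufficiently large $j$. A curve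 $\Gamma:[0,\infty)\to U$ converges to $p$ if, for every $n$, $\Gamma(t)\in U_{C_n}$ for all sufficiently large $t$. Strong minimality: Let $p$ be a prime end and let $z_0\in I(p)$. The point $z_0$ is strongly minimal in $p$ if, for every sequence $w_j\in U$ converging to $p$ which does not accumulate on $z_0$ (no subsequence converges to $z_0$), there is a curve $\Gamma:[0,\infty)\to U$ that converges to $p$ and passes through all $w_j$ but does not accumulate on $z_0$ as $t\to\infty$ (there is no sequence $t_k\to\infty$ with $\Gamma(t_k)\to z_0$). *)

theory Defs
  imports "HOL-Analysis.Analysis"
begin

text \<open>
  The Riemann sphere is modelled as the unit sphere of the Euclidean space
  \<open>complex \<times> real\<close>; stereographic projection identifies it with the extended complex
  plane. As it is closed in the ambient space, the closure of a subset in the sphere is the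
  same as the ambient closure.
\<close>

definition riemann_sphere :: "(complex \<times> real) set" where
  "riemann_sphere = sphere 0 1"

text \<open>
  The spherical (geodesic) distance of two unit vectors is the angle between them; the ambient
  \<open>dist\<close> would be the chordal distance instead.
\<close>

definition spherical_dist :: "complex \<times> real \<Rightarrow> complex \<times> real \<Rightarrow> real" where
  "spherical_dist x y = arccos (x \<bullet> y)"

definition spherical_diam :: "(complex \<times> real) set \<Rightarrow> real" where
  "spherical_diam S = (if S = {} then 0 else SUP (x, y) \<in> S \<times> S. spherical_dist x y)"

definition crosscut :: "(complex \<times> real) set \<Rightarrow> (complex \<times> real) set \<Rightarrow> bool" where
  "crosscut U C \<longleftrightarrow>
     (\<exists>g. arc g \<and> path_image g = C \<and> C \<subseteq> riemann_sphere \<and>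
          C \<inter> (riemann_sphere - U) = {pathstart g, pathfinish g})"

text \<open>
  The set \<open>U\<^sub>C\<close>. The description is proper when \<open>U\<close> is a simply connected domain of the sphere
  whose complement has more than one point, \<open>C\<close> is a crosscut of \<open>U\<close>, and \<open>b \<in> U - C\<close>,
  since \<open>U - C\<close> then has exactly two components.
\<close>

definition crosscut_side ::
    "(complex \<times> real) set \<Rightarrow> complex \<times> real \<Rightarrow> (complex \<times> real) set \<Rightarrow> (complex \<times> real) set" where
  "crosscut_side U b C = (THE V. V \<in> components (U - C) \<and> b \<notin> V)"

type_synonym cut_sequence = "nat \<Rightarrow> (complex \<times> real) set"

definition prime_end_sequence ::
    "(complex \<times> real) set \<Rightarrow> complex \<times> real \<Rightarrow> cut_sequence \<Rightarrow> bool" where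
  "prime_end_sequence U b C \<longleftrightarrow>
     (\<forall>n. crosscut U (C n) \<and> b \<notin> C n) \<and>
     disjoint_family C \<and>
     (\<lambda>n. spherical_diam (C n)) \<longlonglongrightarrow> 0 \<and>
     (\<forall>n. C (Suc n) \<subseteq> closure (crosscut_side U b (C n)))"

definition prime_end_rel ::
    "(complex \<times> real) set \<Rightarrow> complex \<times> real \<Rightarrow> cut_sequence rel" where
  "prime_end_rel U b =
     {(C, D). prime_end_sequence U b C \<and> prime_end_sequence U b D \<and>
        (\<forall>n. \<forall>\<^sub>F j in sequentially. D j \<inter> U \<subseteq> crosscut_side U b (C n)) \<and>
        (\<forall>n. \<forall>\<^sub>F j in sequentially. C j \<inter> U \<subseteq> crosscut_side U b (D n))}"

definition prime_ends ::
    "(complex \<times> real) set \<Rightarrow> complex \<times> real \<Rightarrow> cut_sequence set set" where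
  "prime_ends U b = Collect (prime_end_sequence U b) // prime_end_rel U b"

text \<open>
  The impression of a prime end and convergence to it are defined through a representing
  sequence of crosscuts; they do not depend on which one is selected.
\<close>

definition representative :: "cut_sequence set \<Rightarrow> cut_sequence" where
  "representative p = (SOME C. C \<in> p)"

definition impression ::
    "(complex \<times> real) set \<Rightarrow> complex \<times> real \<Rightarrow> cut_sequence set \<Rightarrow> (complex \<times> real) set" where
  "impression U b p = (\<Inter>n. closure (crosscut_side U b (representative p n)))"

definition seq_converges_to_prime_end ::
    "(complex \<times> real) set \<Rightarrow> complex \<times> real \<Rightarrow> (nat \<Rightarrow> complex \<times> real) \<Rightarrow> cut_sequence set \<Rightarrow> bool" where
  "seq_converges_to_prime_end U b w p \<longleftrightarrow>
     (\<forall>n. \<forall>\<^sub>F j in sequentially. w j \<in> crosscut_side U b (representative p n))"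

definition curve_converges_to_prime_end ::
    "(complex \<times> real) set \<Rightarrow> complex \<times> real \<Rightarrow> (real \<Rightarrow> complex \<times> real) \<Rightarrow> cut_sequence set \<Rightarrow> bool" where
  "curve_converges_to_prime_end U b \<Gamma> p \<longleftrightarrow>
     (\<forall>n. \<forall>\<^sub>F t in at_top. \<Gamma> t \<in> crosscut_side U b (representative p n))"

definition seq_accumulates_on :: "(nat \<Rightarrow> complex \<times> real) \<Rightarrow> complex \<times> real \<Rightarrow> bool" where
  "seq_accumulates_on w z \<longleftrightarrow> (\<exists>r. strict_mono r \<and> (w \<circ> r) \<longlonglongrightarrow> z)"

definition curve_accumulates_on :: "(real \<Rightarrow> complex \<times> real) \<Rightarrow> complex \<times> real \<Rightarrow> bool" where
  "curve_accumulates_on \<Gamma> z \<longleftrightarrow>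
     (\<exists>t :: nat \<Rightarrow> real. (\<forall>k. 0 \<le> t k) \<and> filterlim t at_top sequentially \<and>
        (\<lambda>k. \<Gamma> (t k)) \<longlonglongrightarrow> z)"

text \<open>Only meaningful for \<open>z \<in> impression U b p\<close>.\<close>

definition strongly_minimal ::
    "(complex \<times> real) set \<Rightarrow> complex \<times> real \<Rightarrow> cut_sequence set \<Rightarrow> complex \<times> real \<Rightarrow> bool" where
  "strongly_minimal U b p z \<longleftrightarrow>
     (\<forall>w. range w \<subseteq> U \<and> seq_converges_to_prime_end U b w p \<and> \<not> seq_accumulates_on w z \<longrightarrow>
        (\<exists>\<Gamma>. continuous_on {0..} \<Gamma> \<and> \<Gamma> ` {0..} \<subseteq> U \<and>
             curve_converges_to_prime_end U b \<Gamma> p \<and>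
             range w \<subseteq> \<Gamma> ` {0..} \<and>
             \<not> curve_accumulates_on \<Gamma> z))"

end

theory Submission
  imports Defs "HOL-Complex_Analysis.Riemann_Mapping" "HOL-Library.Diagonal_Subsequence"
begin

text \<open>
  Project the sphere from the base point \<open>b\<close> onto the plane, so that \<open>b\<close> becomes infinity. The complement
  of \<open>U\<close> becomes a continuum \<open>K\<close> with connected complement, and the side \<open>U\<^sub>C\<close> of a crosscut \<open>C\<close> becomes
  \<open>inside (K \<union> C)\<close>.

  If \<open>K\<close> is locally connected at \<open>z\<close>, with a small connected neighbourhood \<open>N\<close>, and \<open>C\<close> is a small crosscut,
  then Janiszewski's theorem for \<open>K \<union> C\<close> and the union of \<open>N\<close> with a tiny disc around \<open>z\<close> shows that
  points of \<open>U\<^sub>C\<close> away from \<open>z\<close> can be joined in \<open>U\<^sub>C\<close> off that disc. Concatenating such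
  paths yields the curve required by strong minimality.

  If \<open>K\<close> is not locally connected at \<open>z\<close>, there is a circle around \<open>z\<close> such that, however small a disc
  around \<open>z\<close>, infinitely many points of the circle lie in pairwise different components of the complement of
  \<open>K\<close> and the disc. Infinitely many of these are cut off from infinity by a single arbitrarily small separator
  \<open>E\<close>. Letting the disc and \<open>E\<close> shrink gives pairs \<open>w k\<close>, \<open>w' k\<close> that, after passing to a subsequence,
  converge to one and the same prime end, and a curve in \<open>U\<close> from \<open>w k\<close> to \<open>w' k\<close> that stays away from \<open>b\<close>
  must come closer and closer to \<open>z\<close>.

  The small separators come from gluing logarithms: if \<open>K\<close> and finitely many connected sets \<open>D i\<close> meeting \<open>K\<close>
  together cut off \<open>w\<close> from infinity, then \<open>K \<union> D i \<union> D j\<close> already does so for some \<open>i\<close> and \<open>j\<close>.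
\<close>

section \<open>Separation of the plane and logarithms\<close>

text \<open>Janiszewski's theorem (two compact sets with connected intersection cut off only what
  one of them cuts off) carries most separation arguments. Logarithms are used where the
  intersections are not under control, as for a level set covered by many discs.

  The obstacle in the second direction is to make both members of each pair converge to the same
  prime end, since points in different components might belong to different prime ends. So each pair
  is chosen behind one common small separator, and a separator too small to meet two consecutive
  crosscuts of a chain keeps its two points together. The separators need not be crosscuts and may
  overlap; they serve only as witnesses. They accumulate at a point \<open>a\<close> of
  \<open>K\<close>, and the chain is built from circles around \<open>a\<close>. Interleaving
  \<open>w\<close> and \<open>w'\<close> then makes a curve through all the points run between
  \<open>w k\<close> and \<open>w' k\<close> at arbitrarily late times.\<close>

lemma outside_iff_log:
  fixes X :: "complex set"
  assumes "compact X" "w \<notin> X"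
  shows "w \<in> outside X \<longleftrightarrow> (\<exists>g. continuous_on X g \<and> (\<forall>x\<in>X. x - w = exp (g x)))"
proof -
  \<comment> \<open>By Borsuk's theorem, \<open>w\<close> is in the unbounded component iff the
    direction of \<open>x - w\<close> has a continuous argument. Adding
    \<open>ln (norm (x - w))\<close> as real part turns an argument into a logarithm; the imaginary
    part of a logarithm is an argument.\<close>
  have "w \<in> outside X \<longleftrightarrow> (\<exists>c. homotopic_with_canon (\<lambda>x. True) X (sphere 0 1)
              (\<lambda>x. inverse (norm (x - w)) *\<^sub>R (x - w)) (\<lambda>x. c))"
    using Borsuk_map_essential_bounded_component[OF assms] by (simp add: outside)
  also have "\<dots> \<longleftrightarrow> (\<exists>g. continuous_on X g \<and>
      (\<forall>x\<in>X. inverse (norm (x - w)) *\<^sub>R (x - w) = exp (\<i> * complex_of_real (g x))))"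
    by (rule inessential_eq_continuous_logarithm_circle)
  also have "\<dots> \<longleftrightarrow> (\<exists>g. continuous_on X g \<and> (\<forall>x\<in>X. x - w = exp (g x)))"
  proof
    assume "\<exists>g. continuous_on X g \<and>
      (\<forall>x\<in>X. inverse (norm (x - w)) *\<^sub>R (x - w) = exp (\<i> * complex_of_real (g x)))"
    then obtain g where g: "continuous_on X g"
      "\<And>x. x \<in> X \<Longrightarrow> inverse (norm (x - w)) *\<^sub>R (x - w) = exp (\<i> * complex_of_real (g x))"
      by blast
    have "x - w = exp (of_real (ln (norm (x - w))) + \<i> * of_real (g x))" if "x \<in> X" for x
    proof -
      have n: "norm (x - w) > 0" using that assms by auto
      have "exp (of_real (ln (norm (x - w))) + \<i> * of_real (g x))
          = of_real (norm (x - w)) * (inverse (norm (x - w)) *\<^sub>R (x - w))"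
        using n g(2)[OF that] by (simp add: exp_add exp_of_real)
      also have "\<dots> = x - w" using n by (simp add: scaleR_conv_of_real)
      finally show ?thesis by simp
    qed
    moreover have "continuous_on X (\<lambda>x. of_real (ln (norm (x - w))) + \<i> * of_real (g x))"
      using assms(2) by (intro continuous_intros g) auto
    ultimately show "\<exists>g. continuous_on X g \<and> (\<forall>x\<in>X. x - w = exp (g x))" by blast
  next
    assume "\<exists>g. continuous_on X g \<and> (\<forall>x\<in>X. x - w = exp (g x))"
    then obtain g where g: "continuous_on X g" "\<And>x. x \<in> X \<Longrightarrow> x - w = exp (g x)" by blast
    have "inverse (norm (x - w)) *\<^sub>R (x - w) = exp (\<i> * of_real (Im (g x)))" if "x \<in> X" for x
    proof -
      have "exp (g x) = of_real (norm (exp (g x))) * exp (\<i> * of_real (Im (g x)))"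
        unfolding norm_exp_eq_Re by (metis exp_eq_polar cis_conv_exp)
      moreover have "norm (exp (g x)) \<noteq> 0" by simp
      ultimately have "inverse (norm (exp (g x))) *\<^sub>R exp (g x) = exp (\<i> * of_real (Im (g x)))"
        by (metis (no_types, lifting) divideR_right divide_inverse_commute scaleR_conv_of_real)
      then show ?thesis using g(2)[OF that] by simp
    qed
    moreover have "continuous_on X (\<lambda>x. Im (g x))" by (intro continuous_intros g)
    ultimately show "\<exists>g. continuous_on X g \<and>
      (\<forall>x\<in>X. inverse (norm (x - w)) *\<^sub>R (x - w) = exp (\<i> * complex_of_real (g x)))" by blast
  qed
  finally show ?thesis .
qed

text \<open>Two logarithms of one function differ by integer multiples of
  \<open>2 * pi * \<i>\<close>; a continuous function with values in this discrete set is constant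
  on a connected set.\<close>

lemma log_unique_on_connected:
  fixes g h :: "complex \<Rightarrow> complex"
  assumes "connected S" "continuous_on S g" "continuous_on S h"
    and eq: "\<And>x. x \<in> S \<Longrightarrow> exp (g x) = exp (h x)"
    and "p \<in> S" "g p = h p" "x \<in> S"
  shows "g x = h x"
proof -
  have "(\<lambda>x. g x - h x) constant_on S"
  proof (rule continuous_discrete_range_constant[OF assms(1)])
    show "continuous_on S (\<lambda>x. g x - h x)" by (intro continuous_intros assms)
    fix x assume x: "x \<in> S"
    have "2 * pi \<le> norm ((g y - h y) - (g x - h x))"
      if "y \<in> S" "g y - h y \<noteq> g x - h x" for y
    proof -
      have "\<exists>n::int. g x = h x + (of_int (2 * n) * pi) * \<i>" "\<exists>n::int. g y = h y + (of_int (2 * n) * pi) * \<i>"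
        using eq[OF x] eq[OF that(1)] by (simp_all only: exp_eq)
      then have "\<exists>n::int. g x - h x = of_int (2 * n) * pi * \<i>" "\<exists>n::int. g y - h y = of_int (2 * n) * pi * \<i>"
        by (metis add_diff_cancel_left')+
      then obtain m n :: int where mn: "g x - h x = of_int (2 * m) * pi * \<i>" "g y - h y = of_int (2 * n) * pi * \<i>"
        by blast
      then have "m \<noteq> n" using that by auto
      have "(g y - h y) - (g x - h x) = of_real (2 * pi * of_int (n - m)) * \<i>"
        unfolding mn by (simp add: algebra_simps)
      then have "norm ((g y - h y) - (g x - h x)) = 2 * pi * \<bar>of_int (n - m)\<bar>"
        by (simp only: norm_mult norm_of_real norm_ii abs_mult) simp
      moreover have "\<bar>of_int (n - m)\<bar> \<ge> (1::real)" using \<open>m \<noteq> n\<close> by linarith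
      ultimately show ?thesis using pi_gt_zero by simp
    qed
    then show "\<exists>e>0. \<forall>y. y \<in> S \<and> g y - h y \<noteq> g x - h x \<longrightarrow> e \<le> norm ((g y - h y) - (g x - h x))"
      by (intro exI[of _ "2 * pi"]) auto
  qed
  then show ?thesis using assms unfolding constant_on_def by (metis eq_iff_diff_eq_0)
qed

text \<open>
  Fix a logarithm of \<open>x - w\<close> on the connected set \<open>K\<close>. It extends uniquely to every \<open>D i\<close>, and the
  hypothesis on pairs says that these extensions agree on overlaps, so they can be glued.
\<close>

lemma outside_Un_family:
  fixes K :: "complex set" and D :: "'i \<Rightarrow> complex set"
  assumes K: "compact K" "connected K" and "finite I"
    and D: "\<And>i. i \<in> I \<Longrightarrow> compact (D i)" "\<And>i. i \<in> I \<Longrightarrow> connected (D i)"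
      "\<And>i. i \<in> I \<Longrightarrow> D i \<inter> K \<noteq> {}"
    and pairs: "\<And>i j. \<lbrakk>i \<in> I; j \<in> I; D i \<inter> D j - K \<noteq> {}\<rbrakk> \<Longrightarrow> w \<in> outside (K \<union> D i \<union> D j)"
    and wK: "w \<in> outside K" and wD: "\<And>i. i \<in> I \<Longrightarrow> w \<notin> D i"
  shows "w \<in> outside (K \<union> (\<Union>i\<in>I. D i))"
proof -
  have wK': "w \<notin> K" using wK by (simp add: outside_def)
  obtain g where g: "continuous_on K g" "\<And>x. x \<in> K \<Longrightarrow> x - w = exp (g x)"
    using wK outside_iff_log[OF K(1) wK'] by blast
  \<comment> \<open>A logarithm on \<open>X\<close> may be shifted by a constant to agree with
    \<open>g\<close> at one point of \<open>K\<close>, hence on the whole connected set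
    \<open>K\<close>.\<close>
  have *: "\<exists>h. continuous_on X h \<and> (\<forall>x\<in>X. x - w = exp (h x)) \<and> (\<forall>x\<in>K. h x = g x)"
    if X: "compact X" "K \<subseteq> X" "w \<in> outside X" for X
  proof -
    have "w \<notin> X" using X by (simp add: outside_def)
    then obtain h where h: "continuous_on X h" "\<And>x. x \<in> X \<Longrightarrow> x - w = exp (h x)"
      using X outside_iff_log[OF X(1)] by blast
    show ?thesis
    proof (cases "K = {}")
      case False
      then obtain p where p: "p \<in> K" by blast
      define h' where "h' x = h x + (g p - h p)" for x
      have e: "exp (g p - h p) = 1"
        using p X g(2)[of p] h(2)[of p] wK' by (auto simp: exp_diff)
      have h': "continuous_on X h'" "\<And>x. x \<in> X \<Longrightarrow> x - w = exp (h' x)"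
        unfolding h'_def using h e by (auto intro!: continuous_intros simp: exp_add)
      have "h' x = g x" if "x \<in> K" for x
      proof (rule log_unique_on_connected[OF K(2) _ g(1) _ p _ that])
        show "continuous_on K h'" using h'(1) X(2) continuous_on_subset by blast
        show "exp (h' x) = exp (g x)" if "x \<in> K" for x using h'(2)[of x] g(2)[of x] that X by auto
        show "h' p = g p" by (simp add: h'_def)
      qed
      then show ?thesis using h' by blast
    qed (use h in auto)
  qed
  \<comment> \<open>The hypothesis on pairs with \<open>j = i\<close> covers a single
    \<open>D i\<close>.\<close>
  have single: "w \<in> outside (K \<union> D i)" if "i \<in> I" for i
  proof (cases "D i \<subseteq> K")
    case True then show ?thesis using wK by (simp add: Un_absorb2)
  next
    case False
    then have "w \<in> outside (K \<union> D i \<union> D i)" using that by (intro pairs) auto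
    then show ?thesis by (simp add: Un_assoc)
  qed
  have "\<exists>h. continuous_on (K \<union> D i) h \<and> (\<forall>x\<in>K \<union> D i. x - w = exp (h x)) \<and> (\<forall>x\<in>K. h x = g x)"
    if "i \<in> I" for i
    using that by (intro * single) (auto simp: K D)
  then obtain h where h: "\<And>i. i \<in> I \<Longrightarrow> continuous_on (K \<union> D i) (h i)"
      "\<And>i x. i \<in> I \<Longrightarrow> x \<in> K \<union> D i \<Longrightarrow> x - w = exp (h i x)"
      "\<And>i x. i \<in> I \<Longrightarrow> x \<in> K \<Longrightarrow> h i x = g x"
    by metis
  \<comment> \<open>Off \<open>K\<close>, both values are those of one logarithm \<open>f\<close> on
    \<open>K \<union> D i \<union> D j\<close>: it agrees with each extension at a point of
    \<open>K\<close>, hence on the connected set \<open>D l\<close>.\<close>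
  have agree: "h i x = h j x" if ij: "i \<in> I" "j \<in> I" "x \<in> D i" "x \<in> D j" for i j x
  proof (cases "x \<in> K")
    case True then show ?thesis using h(3) ij by metis
  next
    case False
    then have "w \<in> outside (K \<union> D i \<union> D j)" using ij by (intro pairs) auto
    then obtain f where f: "continuous_on (K \<union> D i \<union> D j) f"
      "\<And>x. x \<in> K \<union> D i \<union> D j \<Longrightarrow> x - w = exp (f x)" "\<And>x. x \<in> K \<Longrightarrow> f x = g x"
      using *[of "K \<union> D i \<union> D j"] K D ij by (metis (no_types, lifting) Un_assoc Un_upper1 compact_Un)
    have "f x = h l x" if l: "l \<in> {i, j}" for l
    proof -
      have lI: "l \<in> I" "x \<in> D l" "D l \<subseteq> K \<union> D i \<union> D j" using l ij by auto
      obtain p where p: "p \<in> D l" "p \<in> K" using D(3)[OF lI(1)] by blast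
      show ?thesis
      proof (rule log_unique_on_connected[OF D(2)[OF lI(1)] _ _ _ p(1) _ lI(2)])
        show "continuous_on (D l) f" using f(1) lI(3) continuous_on_subset by blast
        show "continuous_on (D l) (h l)" using h(1)[OF lI(1)] by (rule continuous_on_subset) auto
        show "exp (f y) = exp (h l y)" if "y \<in> D l" for y
          using f(2)[of y] h(2)[OF lI(1), of y] that lI(3) by auto
        show "f p = h l p" using f(3) h(3) p lI(1) by metis
      qed
    qed
    from this[of i] this[of j] show ?thesis by simp
  qed
  define sel where "sel x = (SOME i. i \<in> I \<and> x \<in> D i)" for x
  define G where "G x = (if x \<in> K then g x else h (sel x) x)" for x
  have GD: "G x = h i x" if "i \<in> I" "x \<in> D i" for i x
  proof -
    have "sel x \<in> I \<and> x \<in> D (sel x)" unfolding sel_def by (rule someI[of _ i]) (use that in simp)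
    then show ?thesis unfolding G_def using agree[of "sel x" i x] that h(3)[of i x] by simp
  qed
  have "continuous_on (K \<union> (\<Union>i\<in>I. D i)) G"
  proof (rule continuous_on_closed_Un)
    show "closed K" using K(1) by (rule compact_imp_closed)
    show "closed (\<Union>i\<in>I. D i)" using \<open>finite I\<close> D(1) by (intro closed_UN) (auto simp: compact_imp_closed)
    show "continuous_on K G" using g(1) by (rule continuous_on_eq) (simp add: G_def)
    show "continuous_on (\<Union>i\<in>I. D i) G"
    proof (rule continuous_on_closed_Union[OF \<open>finite I\<close>])
      fix i assume i: "i \<in> I"
      show "closed (D i)" using D(1) i by (simp add: compact_imp_closed)
      have "continuous_on (D i) (h i)" using h(1)[OF i] by (rule continuous_on_subset) auto
      then show "continuous_on (D i) G" by (rule continuous_on_eq) (simp add: GD[OF i])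
    qed
  qed
  moreover have "x - w = exp (G x)" if x: "x \<in> K \<union> (\<Union>i\<in>I. D i)" for x
  proof (cases "x \<in> K")
    case True then show ?thesis using g(2) by (simp add: G_def)
  next
    case False
    then obtain i where i: "i \<in> I" "x \<in> D i" using x by blast
    then show ?thesis using GD[OF i] h(2)[OF i(1)] by simp
  qed
  moreover have "compact (K \<union> (\<Union>i\<in>I. D i))" using K D(1) \<open>finite I\<close> by (simp add: compact_Un compact_UN)
  moreover have "w \<notin> K \<union> (\<Union>i\<in>I. D i)" using wK' wD by auto
  ultimately show ?thesis
    using iffD2[OF outside_iff_log[of "K \<union> (\<Union>i\<in>I. D i)" w]] by (metis (no_types, lifting))
qed

section \<open>The unbounded part of a complement\<close>

lemma outside_unbounded_connected:
  assumes "connected T" "\<not> bounded T" "T \<inter> X = {}"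
  shows "T \<subseteq> outside X"
proof
  fix x assume "x \<in> T"
  then have "T \<subseteq> connected_component_set (- X) x"
    using assms by (intro connected_component_maximal) auto
  then show "x \<in> outside X" using assms(2) bounded_subset by (auto simp: outside)
qed

lemma outside_connected_meets:
  assumes "connected T" "T \<inter> outside X \<noteq> {}" "T \<inter> X = {}"
  shows "T \<subseteq> outside X"
proof
  fix y assume "y \<in> T"
  obtain x where x: "x \<in> T" "x \<in> outside X" using assms by blast
  have "connected_component (- X) x y"
    unfolding connected_component_def using assms x \<open>y \<in> T\<close> by blast
  then show "y \<in> outside X" using x outside_same_component by blast
qed

lemma outside_subset_outside:
  fixes X Y :: "'a::euclidean_space set"
  assumes "bounded X" "2 \<le> DIM('a)" "outside X \<inter> Y = {}"
  shows "outside X \<subseteq> outside Y"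
  using assms by (intro outside_unbounded_connected connected_outside unbounded_outside)

text \<open>Janiszewski's theorem with one of the two points taken far away: \<open>w\<close> is
  joined to \<open>v\<close> off \<open>S\<close> and off \<open>T\<close>, hence off their
  union.\<close>

lemma outside_Un_compact:
  fixes S T :: "complex set"
  assumes "compact S" "compact T" "connected (S \<inter> T)" "w \<in> outside S" "w \<in> outside T"
  shows "w \<in> outside (S \<union> T)"
proof -
  obtain r where "r > 0" and r: "S \<union> T \<subseteq> ball 0 r"
    using bounded_subset_ballD[of "S \<union> T" 0] assms by (meson compact_Un compact_imp_bounded)
  define v :: complex where "v = of_real (r + 1)"
  have v: "v \<in> outside (S \<union> T)"
    using r \<open>r > 0\<close> outside_subset_convex[of "ball 0 r" "S \<union> T"] by (force simp: v_def)
  then have "v \<in> outside S" "v \<in> outside T" using outside_mono by blast+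
  then have "connected_component (- S) w v" "connected_component (- T) w v"
    using connected_outside[of S] connected_outside[of T] assms
    unfolding connected_component_def
    by (metis DIM_complex compact_imp_bounded disjoint_eq_subset_Compl inf_commute order_refl outside_no_overlap)+
  then have "connected_component (- (S \<union> T)) w v"
    using Janiszewski assms compact_imp_closed by blast
  then show ?thesis using v outside_same_component connected_component_sym by blast
qed

lemma choice2:
  assumes "\<forall>x. \<exists>y z. P x y z"
  shows "\<exists>f g. \<forall>x. P x (f x) (g x)"
  using assms by metis

lemma connected_outside_compact:
  fixes X :: "complex set"
  assumes "compact X"
  shows "connected (outside X)"
  using assms by (intro connected_outside) (auto simp: compact_imp_bounded)

lemma outside_compact_nonempty:
  fixes X :: "complex set"
  assumes "compact X"
  shows "outside X \<noteq> {}"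
  using assms by (intro outside_bounded_nonempty) (auto simp: compact_imp_bounded)

section \<open>Crosscuts of a plane continuum\<close>

locale plane_continuum =
  fixes K :: "complex set"
  assumes compact_K: "compact K" and connected_K: "connected K"
    and connected_Compl: "connected (- K)" and nontrivial: "\<exists>x\<in>K. \<exists>y\<in>K. x \<noteq> y"
begin

abbreviation "near_side X \<equiv> inside (K \<union> X)"
abbreviation "far_side X \<equiv> outside (K \<union> X)"
abbreviation "joined X \<equiv> connected_component (- (K \<union> X))"

lemma closed_K: "closed K"
  using compact_K by (rule compact_imp_closed)

lemma outside_K: "outside K = - K"
proof -
  have "\<not> bounded (- K)"
    using compact_K cobounded_imp_unbounded[of "- K"] by (simp add: compact_imp_bounded)
  then have "inside K = {}"
    using connected_Compl by (rule inside_complement_unbounded_connected_empty[rotated])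
  then show ?thesis using inside_Un_outside by blast
qed

text \<open>As \<open>arc\<close> is injective, the two ends are different points, so
  \<open>C \<inter> K\<close> is disconnected; this is what makes \<open>C\<close> separate.\<close>

definition cut :: "complex set \<Rightarrow> bool" where
  "cut C \<longleftrightarrow> (\<exists>g. arc g \<and> path_image g = C \<and> C \<inter> K = {pathstart g, pathfinish g})"

lemma cutE:
  assumes "cut C"
  obtains g where "arc g" "path_image g = C" "C = g ` {0..1}" "inj_on g {0..1}" "continuous_on {0..1} g"
    "C \<inter> K = {g 0, g 1}" "g 0 \<noteq> g 1" "C - K = g ` {0<..<1}"
proof -
  obtain g where g: "arc g" "path_image g = C" "C \<inter> K = {pathstart g, pathfinish g}"
    using assms unfolding cut_def by blast
  have inj: "inj_on g {0..1}" and cont: "continuous_on {0..1} g"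
    using g(1) by (auto simp: arc_def path_def)
  have C: "C = g ` {0..1}" using g(2) by (simp add: path_image_def)
  have e: "g 0 \<noteq> g 1" using inj by (auto dest: inj_onD)
  have K: "C \<inter> K = {g 0, g 1}" using g(3) by (simp add: pathstart_def pathfinish_def)
  have 01: "{0..1::real} = insert 0 (insert 1 {0<..<1})" by auto
  have "g s \<noteq> g 0 \<and> g s \<noteq> g 1" if "s \<in> {0<..<1}" for s
    using inj_onD[OF inj, of s 0] inj_onD[OF inj, of s 1] that by auto
  then have "g s \<notin> K" if "s \<in> {0<..<1}" for s
    using K C that by (metis (no_types, lifting) 01 IntI empty_iff image_eqI insertCI insertE)
  then have "C - K = g ` {0<..<1}"
    using K unfolding C 01 by auto
  then show ?thesis using that g K e C inj cont by blast
qed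

lemma compact_cut: "cut C \<Longrightarrow> compact C"
  by (auto simp: cut_def compact_arc_image)

lemma connected_cut: "cut C \<Longrightarrow> connected C"
  by (auto simp: cut_def connected_arc_image)

lemma connected_cut_minus: "cut C \<Longrightarrow> connected (C - K)"
  by (elim cutE) (auto intro!: connected_continuous_image intro: continuous_on_subset)

lemma cut_minus_nonempty: "cut C \<Longrightarrow> C - K \<noteq> {}"
  by (elim cutE) auto

lemma cut_meets: "cut C \<Longrightarrow> C \<inter> K \<noteq> {}"
  by (elim cutE) auto

text \<open>Each tail meets \<open>K\<close> in one point only, so by Janiszewski's theorem adding
  the tails one after the other does not separate the plane. Opening up an arbitrarily short middle
  piece of a crosscut thus undoes the separation.\<close>

lemma connected_Compl_tails:
  assumes "arc g" "path_image g \<inter> K = {g 0, g 1}" "0 < s" "s < t" "t < 1"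
  shows "connected (- (K \<union> g ` {0..s} \<union> g ` {t..1}))"
proof -
  have inj: "inj_on g {0..1}" using assms(1) by (simp add: arc_def)
  have img: "path_image g = g ` {0..1}" by (simp add: path_image_def)
  have s: "arc (subpath 0 s g)" "path_image (subpath 0 s g) = g ` {0..s}"
    using assms by (auto intro!: arc_subpath_arc simp: path_image_subpath)
  have t: "arc (subpath t 1 g)" "path_image (subpath t 1 g) = g ` {t..1}"
    using assms by (auto intro!: arc_subpath_arc simp: path_image_subpath)
  have cs: "connected (- g ` {0..s})" "compact (g ` {0..s})" and ct: "connected (- g ` {t..1})" "compact (g ` {t..1})"
    using connected_arc_complement[OF s(1)] connected_arc_complement[OF t(1)]
      compact_arc_image[OF s(1)] compact_arc_image[OF t(1)] s(2) t(2) by auto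
  have sK: "K \<inter> g ` {0..s} = {g 0}"
  proof -
    have "g u = g 0" if "u \<in> {0..s}" "g u \<in> K" for u
    proof -
      have "g u \<in> {g 0, g 1}" using that assms img by (metis IntI atLeastAtMost_iff imageI less_eq_real_def order_trans)
      moreover have "g u \<noteq> g 1" using inj_onD[OF inj, of u 1] that assms by auto
      ultimately show ?thesis by simp
    qed
    then show ?thesis using assms by fastforce
  qed
  have tK: "K \<inter> g ` {t..1} = {g 1}"
  proof -
    have "g u = g 1" if "u \<in> {t..1}" "g u \<in> K" for u
    proof -
      have "g u \<in> {g 0, g 1}" using that assms img by (metis IntI atLeastAtMost_iff imageI less_eq_real_def order_trans)
      moreover have "g u \<noteq> g 0" using inj_onD[OF inj, of u 0] that assms by auto
      ultimately show ?thesis by simp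
    qed
    then show ?thesis using assms by fastforce
  qed
  have 1: "connected (- (K \<union> g ` {0..s}))"
    using sK cs compact_K connected_Compl by (intro Janiszewski_connected) (auto simp: compact_imp_closed)
  have "g ` {0..s} \<inter> g ` {t..1} = {}"
    using inj_onD[OF inj] assms by fastforce
  then have "connected ((K \<union> g ` {0..s}) \<inter> g ` {t..1})" using tK by (simp add: Int_Un_distrib2)
  then show ?thesis
    using Janiszewski_connected[of "K \<union> g ` {0..s}" "g ` {t..1}"] 1 ct cs compact_K
    by (auto simp: compact_imp_closed)
qed

text \<open>If a short subarc around \<open>c\<close> missed \<open>closure V\<close>, then
  \<open>V\<close> would have a frontier point in the connected set \<open>W\<close> left by the two
  tails. Such a point lies on the subarc.\<close>

lemma cut_point_in_closure:
  assumes "cut C" "V \<in> components (- (K \<union> C))" "c \<in> C - K"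
  shows "c \<in> closure V"
proof (rule ccontr)
  assume nc: "c \<notin> closure V"
  obtain g where g: "arc g" "path_image g = C" "C = g ` {0..1}" "inj_on g {0..1}" "continuous_on {0..1} g"
    "C \<inter> K = {g 0, g 1}" "C - K = g ` {0<..<1}"
    using cutE[OF assms(1)] by metis
  obtain t where t: "0 < t" "t < 1" "c = g t" using assms(3) g(7) by auto
  have "isCont g t"
    using continuous_on_interior[OF g(5), of t] t by (simp add: interior_atLeastAtMost_real)
  moreover have "open (- closure V)" "g t \<in> - closure V" using nc t by auto
  ultimately obtain d where d: "d > 0" "\<And>s. dist s t < d \<Longrightarrow> g s \<in> - closure V"
    using continuous_at_open[of t g] by (metis (no_types, lifting) dist_commute mem_ball open_contains_ball subsetD)
  \<comment> \<open>The first bounds keep the subarc off the ends of \<open>C\<close>, the second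
    ones keep it where \<open>g\<close> avoids \<open>closure V\<close>.\<close>
  define s1 where "s1 = max (t / 2) (t - d / 2)"
  define s2 where "s2 = min ((t + 1) / 2) (t + d / 2)"
  have s: "0 < s1" "s1 < t" "t < s2" "s2 < 1" "t - s1 < d" "s2 - t < d"
    using t d by (auto simp: s1_def s2_def min_less_iff_disj)
  define W where "W = - (K \<union> g ` {0..s1} \<union> g ` {s2..1})"
  have W: "connected W" unfolding W_def using g s by (intro connected_Compl_tails) auto
  have VW: "V \<subseteq> W" "V \<noteq> {}" "V \<inter> (K \<union> C) = {}"
    using in_components_subset[OF assms(2)] in_components_nonempty[OF assms(2)] g(3) s
    unfolding W_def by (fastforce)+
  have "c \<in> W"
    using assms(3) t s inj_onD[OF g(4), of t] by (fastforce simp: W_def)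
  then have "W \<inter> frontier V \<noteq> {}"
    using VW assms(3) by (intro connected_Int_frontier[OF W]) auto
  then obtain f where f: "f \<in> W" "f \<in> frontier V" by blast
  have "closed (K \<union> C)" using compact_K compact_cut[OF assms(1)] by (intro closed_Un compact_imp_closed)
  then have "f \<in> K \<union> C"
    using frontier_of_components_closed_complement assms(2) f(2) by blast
  then obtain u where u: "u \<in> {0..1}" "f = g u" using f g(3) by (auto simp: W_def)
  then have "s1 < u" "u < s2" using f(1) by (force simp: W_def)+
  then have "dist u t < d" using s by (auto simp: dist_real_def)
  then show False using d(2) u f(2) by (auto simp: frontier_def)
qed

lemma compact_Un_cut: "cut C \<Longrightarrow> compact (K \<union> C)"
  using compact_K compact_cut by (rule compact_Un)

lemma outside_cut_component: "cut C \<Longrightarrow> far_side C \<in> components (- (K \<union> C))"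
  using connected_outside_compact outside_compact_nonempty compact_Un_cut
  unfolding outside_in_components by blast

text \<open>\<open>c'\<close> is the point of \<open>C\<close> nearest to a point \<open>u\<close>
  of the far side close to \<open>c\<close>; a segment to a nearest point meets \<open>C\<close>
  only at its end.\<close>

lemma cut_accessible:
  assumes "cut C" "c \<in> C - K" "e > 0"
  obtains c' u where "c' \<in> C" "dist c c' < e" "u \<notin> C" "closed_segment u c' \<inter> C = {c'}"
proof -
  have "c \<in> closure (far_side C)"
    using cut_point_in_closure[OF assms(1) outside_cut_component[OF assms(1)] assms(2)] .
  then obtain u where u: "u \<in> far_side C" "dist u c < e / 2"
    using closure_approachable assms(3) by (metis half_gt_zero)
  have uC: "u \<notin> C" using u by (auto simp: outside_def)
  obtain c' where c': "c' \<in> C" "\<And>y. y \<in> C \<Longrightarrow> dist u c' \<le> dist u y"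
    using distance_attains_inf[of C u] compact_cut[OF assms(1)] assms(2) compact_imp_closed by auto
  have "dist c c' \<le> dist c u + dist u c'" by (rule dist_triangle)
  also have "\<dots> < e" using c'(2)[of c] assms(2) u(2) by (simp add: dist_commute)
  finally have 1: "dist c c' < e" .
  have "y = c'" if "y \<in> closed_segment u c'" "y \<in> C" for y
  proof (rule ccontr)
    assume "y \<noteq> c'"
    then have "dist u y < dist u c'"
      using that(1) by (metis closed_segment_commute dist_commute dist_decreases_open_segment
          dist_in_open_segment ends_in_segment(1) insert_iff open_segment_commute segment_open_subset_closed
          open_closed_segment closed_segment_eq_open uC that(2) Un_iff empty_iff dist_in_closed_segment dist_pos_lt dist_self order_le_less)
    then show False using c'(2)[OF that(2)] by simp
  qed
  then have "closed_segment u c' \<inter> C = {c'}" using c'(1) by auto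
  then show ?thesis using that c'(1) 1 uC by blast
qed

text \<open>Otherwise \<open>K \<union> C\<close> would not separate the plane, and the dual form of
  Janiszewski's theorem would make the two-point set \<open>K \<inter> C\<close> connected.\<close>

lemma cut_inside_nonempty:
  assumes "cut C"
  shows "near_side C \<noteq> {}"
proof
  assume "near_side C = {}"
  then have "connected (- (K \<union> C))"
    using connected_outside_compact[OF compact_Un_cut[OF assms]] inside_Un_outside[of "K \<union> C"]
    by (metis sup_bot_left)
  then have "connected (K \<inter> C)"
    using compact_K compact_cut connected_cut connected_K assms by (intro Janiszewski_dual) auto
  moreover obtain g where "C \<inter> K = {g 0, g 1}" "g 0 \<noteq> g (1::real)"
    using cutE[OF assms] by metis
  ultimately show False
    by (metis Int_commute connected_finite_iff_sing doubleton_eq_iff finite.emptyI finite_insert insert_absorb2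
        insert_not_empty singleton_insert_inj_eq')
qed

text \<open>An arc does not separate the plane, so two accessible points of \<open>C\<close> can be
  joined off \<open>C\<close>. The result is one Jordan curve consisting of a subarc of
  \<open>C\<close> and an arc \<open>h\<close> that touches \<open>C\<close> only at its
  ends.\<close>

lemma cut_subarc_closes_up:
  assumes "cut C"
  obtains g h and a b :: real where "arc g" "path_image g = C" "C \<inter> K = {g 0, g 1}" "0 \<le> a" "a < b" "b \<le> 1"
    "arc h" "pathstart h = g a" "pathfinish h = g b" "path_image h \<inter> C = {g a, g b}"
proof -
  obtain g where g: "arc g" "path_image g = C" "C = g ` {0..1}" "inj_on g {0..1}" "C - K = g ` {0<..<1}"
    "C \<inter> K = {g 0, g 1}"
    using cutE[OF assms] by metis
  \<comment> \<open>Half the distance, so that the accessible points found near the two places are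
    different.\<close>
  define e where "e = dist (g (1/3)) (g (2/3)) / 2"
  have "g (1/3) \<noteq> g (2/3)" using inj_onD[OF g(4), of "1/3" "2/3"] by auto
  then have e: "e > 0" by (simp add: e_def)
  have "g (1/3) \<in> C - K" "g (2/3) \<in> C - K" unfolding g(5) by auto
  then obtain c1 u1 c2 u2 where
    c1: "c1 \<in> C" "dist (g (1/3)) c1 < e" "u1 \<notin> C" "closed_segment u1 c1 \<inter> C = {c1}" and
    c2: "c2 \<in> C" "dist (g (2/3)) c2 < e" "u2 \<notin> C" "closed_segment u2 c2 \<inter> C = {c2}"
    using cut_accessible[OF assms _ e] by metis
  have "c1 \<noteq> c2"
  proof
    assume "c1 = c2"
    then have "dist (g (1/3)) (g (2/3)) < e + e"
      using c1(2) c2(2) dist_triangle_less_add[of "g (1/3)" c1 e "g (2/3)" e] by (simp add: dist_commute)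
    then show False by (simp add: e_def)
  qed
  obtain p where p: "path p" "path_image p \<subseteq> - C" "pathstart p = u1" "pathfinish p = u2"
    using path_connected_arc_complement[OF g(1)] c1(3) c2(3) unfolding path_connected_def g(2)
    by (metis ComplI DIM_complex order_refl)
  define q where "q = linepath c1 u1 +++ p +++ linepath u2 c2"
  have q: "path q" "pathstart q = c1" "pathfinish q = c2" using p by (auto simp: q_def)
  have "path_image q = closed_segment c1 u1 \<union> path_image p \<union> closed_segment u2 c2"
    using p by (auto simp: q_def path_image_join)
  then have qC: "path_image q \<inter> C = {c1, c2}"
    using p(2) c1(4) c2(4) by (auto simp: closed_segment_commute)
  obtain h where h: "arc h" "path_image h \<subseteq> path_image q" "pathstart h = c1" "pathfinish h = c2"
    using path_contains_arc[OF q \<open>c1 \<noteq> c2\<close>] by blast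
  have hC: "path_image h \<inter> C = {c1, c2}"
    using h qC c1(1) c2(1) pathstart_in_path_image[of h] pathfinish_in_path_image[of h] by auto
  obtain s1 s2 where s: "s1 \<in> {0..1}" "c1 = g s1" "s2 \<in> {0..1}" "c2 = g s2"
    using c1(1) c2(1) g(3) by blast
  show ?thesis
  proof (cases "s1 < s2")
    case True
    then show ?thesis using that[of g s1 s2 h] g h hC s by auto
  next
    case False
    then have "s2 < s1" using s \<open>c1 \<noteq> c2\<close> by (metis linorder_neqE_linordered_idom)
    then show ?thesis using that[of g s2 s1 "reversepath h"] g h hC s by (auto simp: arc_reversepath insert_commute)
  qed
qed

text \<open>
  Close up a subarc of \<open>C\<close> to a Jordan curve \<open>J\<close>. Near an interior point of the subarc, any two points
  on the same side of \<open>J\<close> lie in the same component of \<open>- (K \<union> C)\<close> by Janiszewski's theorem; as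
  every component comes near that point, there are at most two.
\<close>

lemma connected_inside_cut:
  assumes "cut C"
  shows "connected (near_side C)"
proof -
  obtain g h and a b :: real where gh: "arc g" "path_image g = C" "C \<inter> K = {g 0, g 1}" "0 \<le> a" "a < b" "b \<le> 1"
    "arc h" "pathstart h = g a" "pathfinish h = g b" "path_image h \<inter> C = {g a, g b}"
    by (rule cut_subarc_closes_up[OF assms])
  have inj: "inj_on g {0..1}" and img: "C = g ` {0..1}" using gh by (auto simp: path_image_def arc_def)
  have cont: "continuous_on {0..1} g" using gh(1) by (simp add: arc_def path_def)
  have ends: "g s = g a \<or> g s = g b" if "g s \<in> K \<union> g ` {0..a} \<union> g ` {b..1}" "s \<in> {a..b}" for s
  proof -
    have s: "s \<in> {0..1}" using that gh by auto
    have eq: "s = u" if "g s = g u" "u \<in> {0..1}" for u using inj_onD[OF inj that(1) s that(2)] .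
    consider "g s \<in> K" | u where "u \<in> {0..a}" "g s = g u" | u where "u \<in> {b..1}" "g s = g u"
      using \<open>g s \<in> K \<union> g ` {0..a} \<union> g ` {b..1}\<close> by auto
    then show ?thesis
    proof cases
      case 1
      then have "g s \<in> {g 0, g 1}" using gh(3) s img by blast
      then have "s = 0 \<or> s = 1" using eq[of 0] eq[of 1] by auto
      then show ?thesis using \<open>s \<in> {a..b}\<close> gh by force
    next
      case 2
      then have "s = u" using eq gh by auto
      then have "s = a" using 2 \<open>s \<in> {a..b}\<close> by auto
      then show ?thesis by simp
    next
      case 3
      then have "s = u" using eq gh by auto
      then have "s = b" using 3 \<open>s \<in> {a..b}\<close> by auto
      then show ?thesis by simp
    qed
  qed
  define j where "j = subpath a b g +++ reversepath h"
  have sub: "arc (subpath a b g)" "path_image (subpath a b g) = g ` {a..b}"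
    using gh by (auto intro!: arc_subpath_arc simp: path_image_subpath)
  have subC: "g ` {a..b} \<subseteq> C" using img gh by auto
  have "simple_path j" unfolding j_def
    using gh sub subC by (intro simple_path_join_loop) (auto simp: arc_reversepath)
  moreover have "pathfinish j = pathstart j" using gh by (simp add: j_def)
  ultimately have J: "connected (inside (path_image j))" "connected (outside (path_image j))"
    "inside (path_image j) \<union> outside (path_image j) = - path_image j"
    using Jordan_inside_outside[of j] by auto
  have jimg: "path_image j = g ` {a..b} \<union> path_image h"
    unfolding j_def using gh sub by (subst path_image_join) auto
  \<comment> \<open>All of \<open>K \<union> C\<close> except the open subarc, enlarged by
    \<open>h\<close>. The enlargement makes the intersection with the Jordan curve equal to
    \<open>h\<close>, hence connected.\<close>
  define T where "T = K \<union> g ` {0..a} \<union> g ` {b..1} \<union> path_image h"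
  have "compact (g ` {0..a})" "compact (g ` {b..1})"
    using cont gh by (auto intro!: compact_continuous_image intro: continuous_on_subset)
  then have T: "compact T"
    unfolding T_def using compact_K compact_arc_image[OF gh(7)] by (intro compact_Un)
  have hab: "g a \<in> path_image h" "g b \<in> path_image h"
    using gh pathstart_in_path_image[of h] pathfinish_in_path_image[of h] by auto
  have "path_image j \<inter> T = path_image h"
  proof
    show "path_image j \<inter> T \<subseteq> path_image h"
    proof
      fix y assume y: "y \<in> path_image j \<inter> T"
      show "y \<in> path_image h"
      proof (cases "y \<in> path_image h")
        case False
        then obtain s where s: "s \<in> {a..b}" "y = g s" using y unfolding jimg by blast
        have "y \<in> K \<union> g ` {0..a} \<union> g ` {b..1}" using y False unfolding T_def by (metis IntD2 UnE)
        then have "y = g a \<or> y = g b" using ends[OF _ s(1)] by (simp only: s(2))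
        then show ?thesis using hab by (elim disjE) simp_all
      qed
    qed
  qed (auto simp: jimg T_def)
  then have JT: "connected (path_image j \<inter> T)" using connected_arc_image[OF gh(7)] by simp
  have KC: "K \<union> C \<subseteq> path_image j \<union> T"
  proof -
    have "{0..1} \<subseteq> {0..a} \<union> {a..b} \<union> {b..1}" by auto
    then show ?thesis unfolding jimg T_def img by (auto simp: image_iff)
  qed
  define x where "x = g ((a + b) / 2)"
  have abh: "(a + b) / 2 \<in> {a..b}" "(a + b) / 2 \<in> {0..1}" using gh by auto
  have xne: "x \<noteq> g a" "x \<noteq> g b"
    unfolding x_def using inj_onD[OF inj _ abh(2), of a] inj_onD[OF inj _ abh(2), of b] gh by auto
  have xC: "x \<in> C" using subC abh unfolding x_def by blast
  have xT: "x \<notin> T"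
    using ends[OF _ abh(1)] xne gh(10) xC unfolding T_def x_def by auto
  then obtain e where e: "e > 0" "ball x e \<subseteq> - T"
    using T open_contains_ball[of "- T"] by (metis ComplI compact_imp_closed open_Compl)
  have same: "joined C p q"
    if p: "p \<in> ball x e" "p \<notin> K \<union> C" and q: "q \<in> ball x e" "q \<notin> K \<union> C"
      and side: "p \<in> inside (path_image j) \<longleftrightarrow> q \<in> inside (path_image j)" for p q
  proof -
    have "p \<notin> path_image j" "q \<notin> path_image j" using p q e subC by (auto simp: jimg T_def)
    then have "connected_component (- path_image j) p q"
      using side J unfolding connected_component_def
      by (metis Compl_iff Un_iff sup_ge1 sup_ge2)
    moreover have "connected_component (- T) p q"
      using e p q unfolding connected_component_def by (meson connected_ball)
    ultimately have "connected_component (- (path_image j \<union> T)) p q"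
      using JT T \<open>simple_path j\<close> by (intro Janiszewski) (auto simp: compact_imp_closed compact_simple_path_image)
    then show ?thesis using KC connected_component_of_subset by (metis Compl_anti_mono)
  qed
  have near: "\<exists>p\<in>V. p \<in> ball x e \<and> p \<notin> K \<union> C" if "V \<in> components (- (K \<union> C))" for V
  proof -
    have "x \<in> closure V" using cut_point_in_closure[OF assms that] xC xT by (auto simp: T_def)
    then obtain p where "p \<in> V" "dist p x < e" using e(1) closure_approachable by blast
    then show ?thesis using in_components_subset[OF that] by (auto simp: dist_commute)
  qed
  show ?thesis unfolding connected_iff_connected_component_eq
  proof (intro ballI, rule ccontr)
    fix p q assume pq: "p \<in> near_side C" "q \<in> near_side C"
      "connected_component_set (near_side C) p \<noteq> connected_component_set (near_side C) q"
    let ?cc = "connected_component_set (- (K \<union> C))"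
    have pqn: "p \<notin> K \<union> C" "q \<notin> K \<union> C" using pq by (auto simp: inside_def)
    have "?cc p \<subseteq> near_side C"
      using pq(1) inside_same_component by blast
    have "?cc p \<noteq> ?cc q"
    proof
      assume "?cc p = ?cc q"
      then have "joined C p q" using pqn by (metis ComplI connected_component_refl_eq mem_Collect_eq)
      then obtain S where S: "connected S" "S \<subseteq> - (K \<union> C)" "p \<in> S" "q \<in> S"
        by (auto simp: connected_component_def)
      then have "S \<subseteq> ?cc p" by (intro connected_component_maximal)
      then have "S \<subseteq> near_side C" using \<open>?cc p \<subseteq> near_side C\<close> by blast
      then have "connected_component (near_side C) p q"
        using S by (auto simp: connected_component_def)
      then show False using pq(3) connected_component_eq by blast
    qed
    obtain z where z: "z \<in> far_side C" using outside_compact_nonempty[OF compact_Un_cut[OF assms]] by blast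
    have comp: "?cc p \<in> components (- (K \<union> C))" "?cc q \<in> components (- (K \<union> C))"
      using pqn by (auto intro: componentsI)
    note out = outside_cut_component[OF assms]
    obtain p' q' o' where
      p': "p' \<in> ?cc p" "p' \<in> ball x e" "p' \<notin> K \<union> C" and
      q': "q' \<in> ?cc q" "q' \<in> ball x e" "q' \<notin> K \<union> C" and
      o': "o' \<in> far_side C" "o' \<in> ball x e" "o' \<notin> K \<union> C"
      using near[OF comp(1)] near[OF comp(2)] near[OF out] by blast
    have ins: "p' \<in> near_side C" "q' \<in> near_side C"
      using p' q' pq inside_same_component by blast+
    have "\<not> joined C p' q'"
      using p'(1) q'(1) \<open>?cc p \<noteq> ?cc q\<close> by (metis connected_component_eq mem_Collect_eq)
    moreover have "\<not> joined C p' o'" "\<not> joined C q' o'"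
      using ins o'(1) inside_same_component inside_Int_outside by blast+
    ultimately show False using same p'(2,3) q'(2,3) o'(2,3) by metis
  qed
qed

text \<open>The complement of \<open>K\<close> is connected and is not exhausted by
  \<open>O'\<close>, so \<open>O'\<close> has a frontier point off \<open>K\<close>, which can only
  lie on \<open>X\<close>.\<close>

lemma component_closure_meets:
  assumes "compact X" "O' \<in> components (- (K \<union> X))" "X - K \<noteq> {}"
  obtains f where "f \<in> X - K" "f \<in> closure O'"
proof -
  have O': "O' \<subseteq> - (K \<union> X)" "O' \<noteq> {}"
    using in_components_subset[OF assms(2)] in_components_nonempty[OF assms(2)] by auto
  have "(- K) \<inter> frontier O' \<noteq> {}"
    using O' assms(3) by (intro connected_Int_frontier[OF connected_Compl]) auto
  then obtain f where f: "f \<notin> K" "f \<in> frontier O'" by blast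
  have "closed (K \<union> X)" using compact_K assms(1) by (intro closed_Un compact_imp_closed)
  then have "f \<in> K \<union> X" using frontier_of_components_closed_complement[OF _ assms(2)] f(2) by blast
  then show ?thesis using that[of f] f by (auto simp: frontier_def)
qed

lemma connected_component_closure:
  assumes "connected T" "T \<inter> Z = {}" "x \<in> T" "f \<in> closure T" "f \<notin> Z"
  shows "connected_component (- Z) x f"
proof -
  have "connected (insert f T)"
    using assms by (intro connected_intermediate_closure[OF assms(1)]) (auto intro: closure_subset[THEN subsetD])
  then show ?thesis using assms unfolding connected_component_def
    by (intro exI[of _ "insert f T"]) auto
qed

section \<open>Sets that cut points off from infinity\<close>

text \<open>
  A point \<open>w \<notin> K\<close> is captured by \<open>X\<close> if \<open>w \<notin> far_side X\<close>. This includes the points of \<open>X\<close> itself, which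
  spares all arguments that \<open>w\<close> may be chosen off \<open>X\<close>.
\<close>

lemma captured_nested_cases:
  assumes X: "compact X" "connected (X - K)" and Y: "compact Y" "connected (Y - K)"
    and XY: "X \<inter> Y \<subseteq> K" and w: "w \<notin> K" "w \<notin> far_side X" "w \<notin> far_side Y"
  shows "(X - K) \<inter> far_side Y = {} \<or> (Y - K) \<inter> far_side X = {}"
proof (rule ccontr)
  assume "\<not> ?thesis"
  then have XO: "X - K \<subseteq> far_side Y" and YO: "Y - K \<subseteq> far_side X" and ne: "X - K \<noteq> {}" "Y - K \<noteq> {}"
    using outside_connected_meets[OF X(2), of "K \<union> Y"] outside_connected_meets[OF Y(2), of "K \<union> X"] XY by blast+
  have wXY: "w \<notin> X" "w \<notin> Y" using XO YO w by auto
  define O' where "O' = connected_component_set (- (K \<union> (X \<union> Y))) w"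
  have w': "w \<in> O'" using wXY w(1) by (simp add: O'_def connected_component_refl_eq)
  have comp: "O' \<in> components (- (K \<union> (X \<union> Y)))" unfolding O'_def using wXY w(1) by (auto intro: componentsI)
  \<comment> \<open>The component of \<open>w\<close> touches \<open>X\<close> or \<open>Y\<close>
    off \<open>K\<close>. If it touches \<open>X\<close>, then \<open>w\<close> is joined off
    \<open>K \<union> Y\<close> to a point of \<open>far_side Y\<close>, contrary to
    \<open>w\<close> being captured by \<open>Y\<close>; likewise with the roles exchanged.\<close>
  obtain f where f: "f \<in> X \<union> Y - K" "f \<in> closure O'"
    using component_closure_meets[OF _ comp] X(1) Y(1) ne by (metis Un_Diff Un_empty compact_Un)
  have O': "connected O'" "O' \<inter> (K \<union> X) = {}" "O' \<inter> (K \<union> Y) = {}"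
    using in_components_connected[OF comp] in_components_subset[OF comp] by auto
  show False
  proof (cases "f \<in> X")
    case True
    then have "f \<notin> K \<union> Y" using f XY by auto
    then have "joined Y w f"
      using connected_component_closure[OF O'(1,3) w' f(2)] by blast
    moreover have "f \<in> far_side Y" using True f XO by auto
    ultimately show False using w(3) outside_same_component connected_component_sym by blast
  next
    case False
    then have "f \<notin> K \<union> X" using f by auto
    then have "joined X w f"
      using connected_component_closure[OF O'(1,2) w' f(2)] by blast
    moreover have "f \<in> far_side X" using False f YO by auto
    ultimately show False using w(2) outside_same_component connected_component_sym by blast
  qed
qed

text \<open>The unbounded component for \<open>X \<union> Y\<close> touches one of the two sets off
  \<open>K\<close>, and the touched point is not captured by the other set.\<close>

lemma not_mutually_captured:
  assumes "compact X" "compact Y" "X \<inter> Y \<subseteq> K" "X - K \<noteq> {}"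
  shows "(X - K) \<inter> far_side Y \<noteq> {} \<or> (Y - K) \<inter> far_side X \<noteq> {}"
proof -
  let ?O = "far_side (X \<union> Y)"
  have cp: "compact (K \<union> (X \<union> Y))" using assms compact_K by (intro compact_Un)
  then have comp: "?O \<in> components (- (K \<union> (X \<union> Y)))"
    unfolding outside_in_components using connected_outside_compact outside_compact_nonempty by blast
  obtain f where f: "f \<in> X \<union> Y - K" "f \<in> closure ?O"
    using component_closure_meets[OF _ comp] assms by (metis Un_Diff Un_empty compact_Un)
  obtain x where x: "x \<in> ?O" using outside_compact_nonempty[OF cp] by blast
  have O': "connected ?O" "?O \<inter> (K \<union> X) = {}" "?O \<inter> (K \<union> Y) = {}"
    using in_components_connected[OF comp] in_components_subset[OF comp] by auto
  have xx: "x \<in> far_side X" "x \<in> far_side Y"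
    using x outside_mono[of "K \<union> X" "K \<union> (X \<union> Y)"] outside_mono[of "K \<union> Y" "K \<union> (X \<union> Y)"] by auto
  show ?thesis
  proof (cases "f \<in> X")
    case True
    then have "f \<notin> K \<union> Y" using f assms by auto
    then have "joined Y x f"
      using connected_component_closure[OF O'(1,3) x f(2)] by blast
    then have "f \<in> far_side Y" using xx outside_same_component by blast
    then show ?thesis using f True by auto
  next
    case False
    then have "f \<notin> K \<union> X" using f by auto
    then have "joined X x f"
      using connected_component_closure[OF O'(1,2) x f(2)] by blast
    then have "f \<in> far_side X" using xx outside_same_component by blast
    then show ?thesis using f False by auto
  qed
qed

text \<open>If \<open>C\<close> captures \<open>E - K\<close>, it captures all that \<open>E\<close>
  captures: \<open>far_side C\<close> is connected, unbounded and disjoint from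
  \<open>K \<union> E\<close>.\<close>

lemma captured_trans:
  assumes "compact C" "(E - K) \<inter> far_side C = {}"
  shows "far_side C \<subseteq> far_side E"
proof -
  have "bounded (K \<union> C)" using compact_K assms(1) compact_imp_bounded by blast
  moreover have "far_side C \<inter> (K \<union> E) = {}" using assms(2) by (auto simp: outside_def)
  ultimately show ?thesis by (intro outside_subset_outside) auto
qed

text \<open>As \<open>C\<close> captures \<open>C'\<close>, it cannot be captured by
  \<open>C'\<close> in turn; being connected, \<open>C - K\<close> then lies wholly on the far side
  of \<open>C'\<close>.\<close>

lemma inside_cut_mono:
  assumes "cut C" "cut C'" "C \<inter> C' \<subseteq> K" "C' - K \<subseteq> near_side C"
  shows "near_side C' \<subseteq> near_side C"
proof -
  have 0: "(C' - K) \<inter> far_side C = {}" using assms(4) inside_Int_outside by blast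
  then have 1: "far_side C \<subseteq> far_side C'" using captured_trans compact_cut assms by blast
  have "(C - K) \<inter> far_side C' \<noteq> {}"
    using not_mutually_captured[of C C'] compact_cut cut_minus_nonempty assms 0 by blast
  then have "C - K \<subseteq> far_side C'"
    using assms by (intro outside_connected_meets connected_cut_minus) auto
  then show ?thesis using 1 unfolding inside_outside by blast
qed

section \<open>Closed neighbourhoods of the continuum and small separators\<close>

lemma compact_infdist_le: "compact {x. infdist x K \<le> d}"
proof -
  have Kne: "K \<noteq> {}" using nontrivial by auto
  obtain B where B: "\<And>y. y \<in> K \<Longrightarrow> norm y \<le> B"
    using compact_K compact_imp_bounded bounded_iff by metis
  have "norm x \<le> B + d" if "infdist x K \<le> d" for x
  proof -
    obtain y where y: "y \<in> K" "infdist x K = dist x y" using infdist_attains_inf[OF closed_K Kne] by metis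
    have "norm x \<le> norm y + dist x y" by (metis add.commute dist_norm norm_triangle_sub)
    then show ?thesis using B[OF y(1)] y(2) that by simp
  qed
  then have "bounded {x. infdist x K \<le> d}" by (auto simp: bounded_iff)
  moreover have "closed {x. infdist x K \<le> d}" by (intro closed_Collect_le continuous_intros)
  ultimately show ?thesis by (simp add: compact_eq_bounded_closed)
qed

text \<open>A path from \<open>y\<close> to a point \<open>v\<close> far away keeps a positive
  distance from the compact set \<open>K\<close>. Hence sets of points very close to
  \<open>K\<close> cannot capture a given \<open>y\<close>.\<close>

lemma escapes_neighbourhood:
  assumes "y \<notin> K"
  obtains \<eta> where "\<eta> > 0" "y \<in> outside {x. infdist x K \<le> \<eta>}"
proof -
  obtain v where v: "v \<in> outside {x. infdist x K \<le> 1}"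
    using outside_compact_nonempty[OF compact_infdist_le] by blast
  have Kne: "K \<noteq> {}" using nontrivial by auto
  have pos: "infdist x K > 0" if "x \<notin> K" for x
    using infdist_pos_not_in_closed[OF closed_K Kne that] .
  have vK: "v \<notin> K" using v by (auto simp: outside_def)
  have "path_connected (- K)"
    using connected_Compl closed_K by (simp add: connected_open_path_connected open_Compl)
  then obtain p where p: "path p" "path_image p \<subseteq> - K" "pathstart p = y" "pathfinish p = v"
    using assms(1) vK unfolding path_connected_def by blast
  have "continuous_on (path_image p) (\<lambda>x. infdist x K)" by (intro continuous_intros)
  then obtain z where z: "z \<in> path_image p" "\<And>x. x \<in> path_image p \<Longrightarrow> infdist z K \<le> infdist x K"
    using continuous_attains_inf[OF compact_path_image[OF p(1)] path_image_nonempty, of "\<lambda>x. infdist x K"]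
    by blast
  define \<eta> where "\<eta> = min 1 (infdist z K / 2)"
  have \<eta>: "\<eta> > 0" "\<eta> \<le> 1" "\<eta> < infdist z K"
    using pos[of z] p(2) z(1) by (auto simp: \<eta>_def min_less_iff_disj)
  have "\<not> infdist x K \<le> \<eta>" if "x \<in> path_image p" for x using z(2)[OF that] \<eta>(3) by simp
  then have "connected_component (- {x. infdist x K \<le> \<eta>}) y v"
    unfolding connected_component_def
    using p pathstart_in_path_image[of p] pathfinish_in_path_image[of p]
    by (intro exI[of _ "path_image p"]) (auto simp: connected_path_image)
  moreover have "{x. infdist x K \<le> \<eta>} \<subseteq> {x. infdist x K \<le> 1}" using \<eta>(2) by auto
  then have "v \<in> outside {x. infdist x K \<le> \<eta>}"
    using v outside_mono by blast
  ultimately show ?thesis using that \<eta>(1) outside_same_component connected_component_sym by blast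
qed

lemma escapes_small_cball:
  assumes "y \<notin> K" "a \<in> K"
  obtains \<eta> where "\<eta> > 0" "y \<in> far_side (cball a \<eta>)"
proof -
  obtain \<eta> where \<eta>: "\<eta> > 0" "y \<in> outside {x. infdist x K \<le> \<eta>}" using escapes_neighbourhood[OF assms(1)] .
  have "infdist x K \<le> \<eta>" if "x \<in> K \<union> cball a \<eta>" for x
    using that infdist_le[OF assms(2), of x] \<eta>(1) by (auto simp: dist_commute)
  then have "K \<union> cball a \<eta> \<subseteq> {x. infdist x K \<le> \<eta>}" by blast
  then show ?thesis using that \<eta> outside_mono by blast
qed

text \<open>
  Every point close to \<open>K\<close> is cut off from infinity by the level set \<open>infdist x K = d\<close>. Finitely many discs around
  points \<open>v\<close> of that set cover it; tied to \<open>K\<close> by segments to nearest points they become the sets \<open>D v\<close>, and two of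
  them suffice by \<open>outside_Un_family\<close>.
\<close>

lemma small_separator:
  fixes w :: "nat \<Rightarrow> complex"
  assumes wK: "\<And>k. w k \<notin> K" and lim: "(\<lambda>k. infdist (w k) K) \<longlonglongrightarrow> 0" and "\<delta> > 0"
  obtains E \<kappa> where "compact E" "connected (E - K)" "E - K \<noteq> {}" "\<kappa> \<in> K" "E \<subseteq> cball \<kappa> \<delta>"
    "infinite {k. w k \<notin> far_side E}"
proof -
  \<comment> \<open>Two overlapping sets \<open>D u\<close> and \<open>D v\<close> of radius
    \<open>d\<close> lie within \<open>d + 3 * d\<close> of the nearest point
    \<open>\<kappa> u\<close>.\<close>
  define d where "d = \<delta> / 4"
  have d: "d > 0" "4 * d = \<delta>" using \<open>\<delta> > 0\<close> by (auto simp: d_def)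
  have Kne: "K \<noteq> {}" using nontrivial by auto
  define L where "L = {x. infdist x K = d}"
  have bd: "bounded {x. infdist x K \<le> d}" using compact_infdist_le by (rule compact_imp_bounded)
  have "closed L" unfolding L_def by (intro closed_Collect_eq continuous_intros)
  moreover have "bounded L" using bd by (rule bounded_subset) (auto simp: L_def)
  ultimately have "compact L" by (simp add: compact_eq_bounded_closed)
  moreover have "L \<subseteq> (\<Union>v\<in>L. ball v (d / 2))" using d by force
  ultimately obtain I where I: "I \<subseteq> L" "finite I" "L \<subseteq> (\<Union>v\<in>I. ball v (d / 2))"
    using compactE_image[of L L "\<lambda>v. ball v (d / 2)"] by (metis open_ball)
  have "\<forall>v. \<exists>y. y \<in> K \<and> infdist v K = dist v y"
    using infdist_attains_inf[OF closed_K Kne] by metis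
  then obtain \<kappa> where \<kappa>: "\<And>v. \<kappa> v \<in> K" "\<And>v. infdist v K = dist v (\<kappa> v)"
    by metis
  define D where "D v = cball v (d / 2) \<union> closed_segment v (\<kappa> v)" for v
  have dv: "dist v (\<kappa> v) = d" "v \<noteq> \<kappa> v" if "v \<in> I" for v
    using that I(1) \<kappa>(2)[of v] d by (auto simp: L_def)
  have Dball: "D v \<subseteq> cball v d" if "v \<in> I" for v
  proof -
    have "closed_segment v (\<kappa> v) \<subseteq> cball v d"
      using d dv[OF that] by (intro closed_segment_subset convex_cball) auto
    moreover have "cball v (d / 2) \<subseteq> cball v d" using d by (intro subset_cball) simp
    ultimately show ?thesis by (simp add: D_def)
  qed
  have far: "x \<notin> K" if "v \<in> I" "dist v x < d" for v x
    using infdist_le[of x K v] that I(1) by (auto simp: L_def)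
  \<comment> \<open>A point of the segment before its end is closer to \<open>v\<close> than
    \<open>d\<close>, the distance from \<open>v\<close> to \<open>K\<close>; the same holds for the
    disc of radius \<open>d / 2\<close>.\<close>
  have DK: "D v - K = cball v (d / 2) \<union> (closed_segment v (\<kappa> v) - {\<kappa> v})" if "v \<in> I" for v
  proof -
    have "x \<notin> K" if "x \<in> closed_segment v (\<kappa> v)" "x \<noteq> \<kappa> v" for x
    proof (cases "x = v")
      case True then show ?thesis using far[OF \<open>v \<in> I\<close>, of v] d by simp
    next
      case False
      then have "x \<in> open_segment v (\<kappa> v)" using that by (simp add: open_segment_def)
      then have "dist v x < dist v (\<kappa> v)" using dist_in_open_segment by (metis dist_commute)
      then show ?thesis using far \<open>v \<in> I\<close> dv by auto
    qed
    moreover have "x \<notin> K" if "x \<in> cball v (d / 2)" for x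
      using far[OF \<open>v \<in> I\<close>, of x] that d by auto
    ultimately show ?thesis using \<kappa>(1)[of v] unfolding D_def by blast
  qed
  have Dcon: "connected (D v - K)" if "v \<in> I" for v
  proof -
    have "connected (closed_segment v (\<kappa> v) - {\<kappa> v})"
    proof (rule connected_intermediate_closure)
      show "connected (open_segment v (\<kappa> v))" by (simp add: convex_connected)
      show "open_segment v (\<kappa> v) \<subseteq> closed_segment v (\<kappa> v) - {\<kappa> v}" by (auto simp: open_segment_def)
      show "closed_segment v (\<kappa> v) - {\<kappa> v} \<subseteq> closure (open_segment v (\<kappa> v))"
        using dv(2)[OF that] by (simp add: closure_open_segment Diff_subset)
    qed
    moreover have "v \<in> cball v (d / 2)" "v \<in> closed_segment v (\<kappa> v) - {\<kappa> v}"
      using d dv(2)[OF that] by auto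
    ultimately show ?thesis unfolding DK[OF that]
      by (intro connected_Un convex_connected[OF convex_cball]) blast+
  qed
  have vD: "v \<in> D v - K" if "v \<in> I" for v using DK[OF that] d by auto
  have key: "\<exists>p\<in>I \<times> I. D (fst p) \<inter> D (snd p) - K \<noteq> {} \<and> w k \<notin> outside (K \<union> D (fst p) \<union> D (snd p))"
    if k: "infdist (w k) K < d" for k
  proof (rule ccontr)
    assume neg: "\<not> ?thesis"
    have no: "w k \<in> outside (K \<union> D u \<union> D v)" if "u \<in> I" "v \<in> I" "D u \<inter> D v - K \<noteq> {}" for u v
      using neg that by (metis SigmaI fst_conv snd_conv)
    have wDv: "w k \<notin> D v" if "v \<in> I" for v
      using no[OF that that] vD[OF that] by (auto simp: outside_def)
    moreover have "w k \<in> outside K" using wK outside_K by auto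
    ultimately have "w k \<in> far_side (\<Union>v\<in>I. D v)"
    proof (intro outside_Un_family)
      fix v assume "v \<in> I"
      show "compact (D v)" by (auto simp: D_def)
      show "connected (D v)" unfolding D_def using d
        by (intro connected_Un) (auto simp: disjoint_iff intro!: exI[of _ v])
      show "D v \<inter> K \<noteq> {}" using \<kappa>(1)[of v] by (auto simp: D_def)
    qed (use no wDv compact_K connected_K I(2) in auto)
    define T where "T = far_side (\<Union>v\<in>I. D v)"
    have cp: "compact (K \<union> (\<Union>v\<in>I. D v))"
      using I(2) compact_K by (intro compact_Un compact_UN) (auto simp: D_def)
    have T: "connected T" "\<not> bounded T" "w k \<in> T"
      unfolding T_def using connected_outside_compact[OF cp] unbounded_outside cp compact_imp_bounded
        \<open>w k \<in> far_side (\<Union>v\<in>I. D v)\<close> by blast+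
    \<comment> \<open>The connected far side contains \<open>w k\<close>, closer to \<open>K\<close>
      than \<open>d\<close>, and points farther away, so it crosses the level set \<open>L\<close>,
      which the discs cover.\<close>
    have "\<not> T \<subseteq> {x. infdist x K \<le> d}" using bd T(2) bounded_subset by blast
    then obtain y where y: "y \<in> T" "infdist y K > d" by force
    have "connected ((\<lambda>x. infdist x K) ` T)"
      by (intro connected_continuous_image T continuous_intros)
    then have "d \<in> (\<lambda>x. infdist x K) ` T"
      using y k T(3) by (meson connectedD_interval image_eqI less_imp_le)
    then obtain x where "x \<in> T" "x \<in> L" by (auto simp: L_def)
    then obtain v where "v \<in> I" "x \<in> ball v (d / 2)" using I(3) by blast
    then have "x \<in> D v" by (auto simp: D_def)
    then show False using \<open>x \<in> T\<close> \<open>v \<in> I\<close> by (auto simp: T_def outside_def)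
  qed
  have "\<forall>\<^sub>F k in sequentially. infdist (w k) K < d" using lim d(1) by (rule order_tendstoD)
  then have "infinite {k. infdist (w k) K < d}"
    by (simp add: eventually_sequentially infinite_nat_iff_unbounded_le) (meson le_cases order_trans)
  \<comment> \<open>There are finitely many pairs, so one pair serves infinitely many
    \<open>k\<close>. That its members meet off \<open>K\<close> makes the union connected off
    \<open>K\<close>.\<close>
  then obtain p where p: "p \<in> I \<times> I"
    "infinite {k \<in> {k. infdist (w k) K < d}. D (fst p) \<inter> D (snd p) - K \<noteq> {} \<and> w k \<notin> outside (K \<union> D (fst p) \<union> D (snd p))}"
    using pigeonhole_infinite_rel[of "{k. infdist (w k) K < d}" "I \<times> I"
        "\<lambda>k p. D (fst p) \<inter> D (snd p) - K \<noteq> {} \<and> w k \<notin> outside (K \<union> D (fst p) \<union> D (snd p))"] key I(2) by auto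
  obtain u v where uv: "p = (u, v)" "u \<in> I" "v \<in> I" using p(1) by auto
  have inf: "infinite {k. w k \<notin> far_side (D u \<union> D v)}"
    using p(2) by (rule contrapos_nn) (auto simp: uv Un_assoc elim: rev_finite_subset)
  obtain z where z: "z \<in> D u" "z \<in> D v" "z \<notin> K"
    using infinite_imp_nonempty[OF p(2)] by (auto simp: uv)
  have "connected ((D u - K) \<union> (D v - K))"
    using z uv by (intro connected_Un Dcon) auto
  then have "connected (D u \<union> D v - K)" by (simp add: Un_Diff)
  moreover have "compact (D u \<union> D v)" by (simp add: D_def compact_Un)
  moreover have "D u \<union> D v \<subseteq> cball (\<kappa> u) \<delta>"
  proof -
    have "dist (\<kappa> u) x \<le> 4 * d" if "x \<in> D u \<union> D v" for x
    proof -
      have "dist u (\<kappa> u) = d" using dv uv by auto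
      moreover have "dist u z \<le> d" "dist v z \<le> d" "dist u x \<le> d \<or> dist v x \<le> d"
        using Dball uv z that by (auto simp: subset_iff)
      moreover have "dist (\<kappa> u) x \<le> dist u (\<kappa> u) + dist u x" "dist u x \<le> dist u z + dist v z + dist v x"
        by (metric)+
      ultimately show ?thesis using d(1) by linarith
    qed
    then show ?thesis using d by auto
  qed
  ultimately show ?thesis
    using that[of "D u \<union> D v" "\<kappa> u"] \<kappa>(1) inf vD[OF uv(2)] by blast
qed

section \<open>Arcs of a circle in the complement of the continuum\<close>

text \<open>The pair gives the ends of a maximal parameter interval on which \<open>c\<close> runs
  off \<open>K\<close>, for a path with both ends in \<open>K\<close>. As pairs, the gaps can index
  covers and unions.\<close>

definition gap :: "(real \<Rightarrow> complex) \<Rightarrow> real \<times> real \<Rightarrow> bool" where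
  "gap c = (\<lambda>(\<alpha>, \<beta>). 0 \<le> \<alpha> \<and> \<alpha> < \<beta> \<and> \<beta> \<le> 1 \<and> c \<alpha> \<in> K \<and> c \<beta> \<in> K \<and> (\<forall>s\<in>{\<alpha><..<\<beta>}. c s \<notin> K))"

lemma gap_exists:
  assumes "path c" "c 0 \<in> K" "c 1 \<in> K" "t \<in> {0..1}" "c t \<notin> K"
  obtains \<alpha> \<beta> where "gap c (\<alpha>, \<beta>)" "\<alpha> < t" "t < \<beta>"
proof -
  have c: "continuous_on {0..1} c" using assms(1) by (simp add: path_def)
  have cl: "compact ({x..y} \<inter> c -` K)" if "0 \<le> x" "y \<le> 1" for x y
    using c that closed_K
    by (auto simp: compact_eq_bounded_closed intro!: continuous_closed_preimage bounded_Int
        intro: continuous_on_subset)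
  obtain \<alpha> where \<alpha>: "\<alpha> \<in> {0..t} \<inter> c -` K" "\<And>s. s \<in> {0..t} \<inter> c -` K \<Longrightarrow> s \<le> \<alpha>"
    using compact_attains_sup[OF cl[of 0 t]] assms by (metis IntI atLeastAtMost_iff empty_iff order_refl vimageI)
  obtain \<beta> where \<beta>: "\<beta> \<in> {t..1} \<inter> c -` K" "\<And>s. s \<in> {t..1} \<inter> c -` K \<Longrightarrow> \<beta> \<le> s"
    using compact_attains_inf[OF cl[of t 1]] assms by (metis IntI atLeastAtMost_iff empty_iff order_refl vimageI)
  have "\<alpha> \<noteq> t" "\<beta> \<noteq> t" using \<alpha> \<beta> assms by auto
  then have "\<alpha> < t" "t < \<beta>" using \<alpha> \<beta> by auto
  moreover have "c s \<notin> K" if "s \<in> {\<alpha><..<\<beta>}" for s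
    using \<alpha>(2)[of s] \<beta>(2)[of s] \<alpha>(1) \<beta>(1) that by (cases "s \<le> t") auto
  ultimately show ?thesis using that[of \<alpha> \<beta>] \<alpha>(1) \<beta>(1) by (auto simp: gap_def)
qed

lemma gaps_disjoint:
  assumes "gap c (\<alpha>, \<beta>)" "gap c (\<alpha>', \<beta>')" "s \<in> {\<alpha><..<\<beta>}" "s \<in> {\<alpha>'<..<\<beta>'}"
  shows "(\<alpha>, \<beta>) = (\<alpha>', \<beta>')"
proof -
  have "\<alpha> \<notin> {\<alpha>'<..<\<beta>'}" "\<beta> \<notin> {\<alpha>'<..<\<beta>'}" "\<alpha>' \<notin> {\<alpha><..<\<beta>}" "\<beta>' \<notin> {\<alpha><..<\<beta>}"
    using assms(1,2) by (auto simp: gap_def)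
  then show ?thesis using assms(3,4) by auto
qed

text \<open>If every gap arc left \<open>e\<close> free, adding the arcs to \<open>K\<close> one at
  a time would leave \<open>e\<close> free as well, by Janiszewski's theorem, although in the end
  the whole circle around \<open>e\<close> is present.\<close>

lemma circle_gap_separates:
  assumes c: "simple_path c" "path_image c = sphere a r" "c 0 \<in> K" "c 1 \<in> K"
    and e: "e \<in> ball a r" "e \<notin> K"
  obtains \<alpha> \<beta> where "gap c (\<alpha>, \<beta>)" "e \<notin> far_side (c ` {\<alpha>..\<beta>})"
proof -
  have False if no: "\<And>\<alpha> \<beta>. gap c (\<alpha>, \<beta>) \<Longrightarrow> e \<in> far_side (c ` {\<alpha>..\<beta>})"
  proof -
    have pc: "path c" using c(1) by (rule simple_path_imp_path)
    have cont: "continuous_on {0..1} c" using pc by (simp add: path_def)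
    have img: "c ` {0..1} = sphere a r" using c(2) by (simp add: path_image_def)
    have cinj: "s = s'" if "c s = c s'" "s \<in> {0..1}" "s' \<in> {0..1}" "c s \<notin> K" for s s'
      using c(1) that c(3,4) unfolding simple_path_def loop_free_def by metis
    have cKs: "compact (K \<union> sphere a r)" using compact_K by (intro compact_Un) auto
    obtain v where v: "v \<in> far_side (sphere a r)" using outside_compact_nonempty[OF cKs] by blast
    then have vK: "v \<notin> K" by (auto simp: outside_def)
    have "path_connected (- K)"
      using connected_Compl closed_K by (simp add: connected_open_path_connected open_Compl)
    then obtain p where p: "path p" "path_image p \<subseteq> - K" "pathstart p = e" "pathfinish p = v"
      using e(2) vK unfolding path_connected_def by blast
    \<comment> \<open>There may be infinitely many gaps, but the compact path \<open>p\<close> meets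
      the circle in finitely many of them. \<open>K'\<close> adds the rest of the circle to
      \<open>K\<close> in one stroke, without meeting \<open>p\<close>.\<close>
    define T where "T = {0..1} \<inter> c -` path_image p"
    have "compact T" unfolding T_def
      using cont compact_path_image[OF p(1)]
      by (auto simp: compact_eq_bounded_closed intro!: continuous_closed_preimage bounded_Int)
    have "\<exists>I. gap c I \<and> t \<in> {fst I<..<snd I}" if "t \<in> T" for t
    proof -
      have t: "t \<in> {0..1}" "c t \<notin> K" using that p(2) by (auto simp: T_def)
      obtain \<alpha> \<beta> where "gap c (\<alpha>, \<beta>)" "\<alpha> < t" "t < \<beta>" using gap_exists[OF pc c(3,4) t] .
      then show ?thesis by (intro exI[of _ "(\<alpha>, \<beta>)"]) simp
    qed
    then have "T \<subseteq> (\<Union>I\<in>Collect (gap c). {fst I<..<snd I})" by blast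
    then obtain P where P: "P \<subseteq> Collect (gap c)" "finite P" "T \<subseteq> (\<Union>I\<in>P. {fst I<..<snd I})"
      using compactE_image[OF \<open>compact T\<close>, of "Collect (gap c)" "\<lambda>I. {fst I<..<snd I}"] by auto
    define R where "R = {0..1} - (\<Union>I\<in>P. {fst I<..<snd I})"
    define K' where "K' = K \<union> c ` R"
    have "compact R" unfolding R_def
      by (intro compact_diff) (auto intro: open_UN)
    then have K'c: "compact K'" unfolding K'_def
      using compact_K cont by (intro compact_Un compact_continuous_image) (auto simp: R_def intro: continuous_on_subset)
    have piece: "compact (c ` {\<alpha>..\<beta>})" if "0 \<le> \<alpha>" "\<beta> \<le> 1" for \<alpha> \<beta>
      using that cont by (auto intro!: compact_continuous_image intro: continuous_on_subset)
    have "path_image p \<inter> K' = {}"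
      using p(2) P(3) by (auto simp: K'_def R_def T_def)
    then have "connected_component (- K') e v"
      unfolding connected_component_def
      using p pathstart_in_path_image[of p] pathfinish_in_path_image[of p]
      by (intro exI[of _ "path_image p"]) (auto simp: connected_path_image)
    moreover have "K' \<subseteq> K \<union> sphere a r" using img by (auto simp: K'_def R_def)
    then have "v \<in> outside K'" using v outside_mono by blast
    ultimately have eK': "e \<in> outside K'" using outside_same_component connected_component_sym by blast
    \<comment> \<open>A further gap arc meets what has been added so far only in \<open>K\<close>,
      so the intersection of the two enlarged sets is exactly the connected set
      \<open>K\<close>.\<close>
    have "e \<in> outside (K' \<union> (\<Union>I\<in>G. c ` {fst I..snd I}))" if "finite G" "G \<subseteq> P" for G
      using that
    proof (induction G)
      case empty
      then show ?case using eK' by simp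
    next
      case (insert I G)
      obtain \<alpha> \<beta> where I: "I = (\<alpha>, \<beta>)" by (cases I)
      have g: "gap c (\<alpha>, \<beta>)" using insert P(1) I by auto
      let ?S = "K' \<union> (\<Union>I\<in>G. c ` {fst I..snd I})"
      let ?T = "K \<union> c ` {\<alpha>..\<beta>}"
      have G01: "0 \<le> fst J" "snd J \<le> 1" if "J \<in> G" for J
        using that insert.prems P(1) by (auto simp: gap_def split: prod.splits)
      have "c u \<notin> ?S" if u: "u \<in> {\<alpha><..<\<beta>}" for u
      proof
        assume "c u \<in> ?S"
        have uK: "c u \<notin> K" "u \<in> {0..1}" using g u by (auto simp: gap_def)
        consider s where "s \<in> R" "c u = c s" | J s where "J \<in> G" "s \<in> {fst J..snd J}" "c u = c s"
          using \<open>c u \<in> ?S\<close> uK by (auto simp: K'_def)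
        then show False
        proof cases
          case 1
          then have "u = s" using cinj[of u s] uK by (auto simp: R_def)
          then show False using 1 u insert.prems I by (force simp: R_def)
        next
          case 2
          then have us: "u = s" using cinj[of u s] uK G01[of J] by auto
          have J: "gap c (fst J, snd J)" using 2 insert.prems P(1) by auto
          then have "u \<in> {fst J<..<snd J}" using 2 us uK by (auto simp: gap_def order_le_less)
          then have "(\<alpha>, \<beta>) = J" using gaps_disjoint[OF g J u] by simp
          then show False using 2 I insert.hyps by simp
        qed
      qed
      then have cK: "c u \<in> K" if "u \<in> {\<alpha>..\<beta>}" "c u \<in> ?S" for u
        using that g by (cases "u = \<alpha> \<or> u = \<beta>") (auto simp: gap_def)
      have "X \<inter> (K \<union> c ` {\<alpha>..\<beta>}) = K" if "\<And>u. u \<in> {\<alpha>..\<beta>} \<Longrightarrow> c u \<in> X \<Longrightarrow> c u \<in> K" "K \<subseteq> X" for X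
        using that by auto
      from this[of ?S] cK have "?S \<inter> ?T = K" unfolding K'_def by blast
      moreover have "compact ?S" "compact ?T"
        using K'c compact_K piece insert.hyps(1) G01 g by (auto intro!: compact_Un compact_UN simp: gap_def)
      ultimately have "e \<in> outside (?S \<union> ?T)"
        using insert no[OF g] connected_K by (intro outside_Un_compact[of ?S ?T]) simp_all
      moreover have "?S \<union> ?T = K' \<union> (\<Union>I\<in>insert I G. c ` {fst I..snd I})" by (auto simp: I K'_def)
      ultimately show ?case by simp
    qed
    from this[OF P(2) order_refl] have "e \<in> outside (K' \<union> (\<Union>I\<in>P. c ` {fst I..snd I}))" .
    moreover have "sphere a r \<subseteq> K' \<union> (\<Union>I\<in>P. c ` {fst I..snd I})"
      unfolding img[symmetric] K'_def R_def by fastforce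
    ultimately have "e \<in> outside (sphere a r)" using outside_mono by blast
    moreover have "e \<in> inside (sphere a r)" using e(1) inside_frontier_eq_interior[of "cball a r"] by auto
    ultimately show False using inside_Int_outside[of "sphere a r"] by (metis IntI empty_iff)
  qed
  then show ?thesis using that by blast
qed

text \<open>A late \<open>E n\<close> misses \<open>X\<close>, shares a captured point
  \<open>w j\<close> with it, and is too small to capture the point \<open>y\<close> of
  \<open>X\<close>. Hence of the two nesting cases only one is left: \<open>X\<close> captures
  \<open>E n - K\<close>.\<close>

lemma eventually_captured:
  fixes E :: "nat \<Rightarrow> complex set"
  assumes E: "\<And>n. compact (E n)" "\<And>n. connected (E n - K)" "a \<in> K"
      "\<And>\<eta>. \<eta> > 0 \<Longrightarrow> \<forall>\<^sub>F n in sequentially. E n \<subseteq> ball a \<eta>"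
    and w: "\<And>n. w n \<notin> K" "\<And>m n. n \<le> m \<Longrightarrow> w m \<notin> far_side (E n)"
    and X: "compact X" "connected (X - K)" "X - K \<noteq> {}" "a \<notin> X"
    and wX: "\<And>j. j \<ge> m \<Longrightarrow> w j \<notin> far_side X"
  shows "\<forall>\<^sub>F n in sequentially. E n - K \<subseteq> near_side X"
proof -
  obtain y where y: "y \<in> X" "y \<notin> K" using X(3) by blast
  obtain \<eta> where \<eta>: "\<eta> > 0" "y \<in> far_side (cball a \<eta>)" using escapes_small_cball[OF y(2) E(3)] .
  have "open (- X)" using X(1) by (simp add: compact_imp_closed open_Compl)
  then obtain \<theta> where \<theta>: "\<theta> > 0" "ball a \<theta> \<subseteq> - X" using X(4) open_contains_ball by blast
  have "\<forall>\<^sub>F n in sequentially. E n \<subseteq> ball a \<eta> \<and> E n \<subseteq> ball a \<theta>"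
    using E(4) \<eta> \<theta> by (intro eventually_conj) auto
  then show ?thesis
  proof (rule eventually_mono)
    fix n assume n: "E n \<subseteq> ball a \<eta> \<and> E n \<subseteq> ball a \<theta>"
    have EX: "E n \<inter> X = {}" using n \<theta> by blast
    have "K \<union> E n \<subseteq> K \<union> cball a \<eta>" using n ball_subset_cball by blast
    then have "y \<in> far_side (E n)" using \<eta>(2) outside_mono by blast
    moreover have "(E n - K) \<inter> far_side X = {} \<or> (X - K) \<inter> far_side (E n) = {}"
      using EX wX[of "max n m"] w(2)[of n "max n m"] by (intro captured_nested_cases[OF E(1,2) X(1,2) _ w(1)]) auto
    ultimately have "(E n - K) \<inter> far_side X = {}" using y by blast
    then show "E n - K \<subseteq> near_side X" using EX unfolding inside_outside by blast
  qed
qed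

text \<open>Using \<open>closed_segment s t\<close> admits both \<open>s < t\<close> and
  \<open>t < s\<close>, so that both halves of a gap arc are covered.\<close>

lemma cut_arcI:
  assumes c: "simple_path c" "path_image c = sphere a r" and gp: "{c 0, c 1} \<subseteq> K"
    and s: "s \<in> {0..1}" "c s \<in> K" "t \<in> {0..1}" "c t \<notin> K" "\<And>u. u \<in> closed_segment s t \<Longrightarrow> u \<noteq> s \<Longrightarrow> c u \<notin> K"
    and \<kappa>: "\<kappa> \<in> K" "closed_segment (c t) \<kappa> - {c t} \<subseteq> ball a r" "closed_segment (c t) \<kappa> \<inter> K = {\<kappa>}"
  shows "cut (c ` closed_segment s t \<union> closed_segment (c t) \<kappa>)"
proof -
  have st: "s \<noteq> t" "t \<noteq> 0" "t \<noteq> 1" using s gp by auto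
  have img: "path_image (subpath s t c) = c ` closed_segment s t" by (rule path_image_subpath_gen)
  have "closed_segment s t \<subseteq> {0..1}" using s by (auto simp: closed_segment_eq_real_ivl split: if_splits)
  then have sph: "c ` closed_segment s t \<subseteq> sphere a r" using c(2) by (auto simp: path_image_def)
  have "\<bar>s - t\<bar> < 1" using s st by auto
  then have "arc (subpath s t c)" using c(1) s(1,3) st(1) by (intro arc_simple_path_subpath_interior)
  moreover have "c t \<noteq> \<kappa>" using s \<kappa> by auto
  moreover have "c ` closed_segment s t \<inter> closed_segment (c t) \<kappa> \<subseteq> {c t}" using sph \<kappa>(2) by fastforce
  ultimately have "arc (subpath s t c +++ linepath (c t) \<kappa>)"
    by (intro arc_join) (auto simp: img)
  moreover have "path_image (subpath s t c +++ linepath (c t) \<kappa>) = c ` closed_segment s t \<union> closed_segment (c t) \<kappa>"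
    by (subst path_image_join) (auto simp: img)
  moreover have "(c ` closed_segment s t \<union> closed_segment (c t) \<kappa>) \<inter> K = {c s, \<kappa>}"
    using s \<kappa>(3) by (auto intro!: rev_image_eqI[of s])
  ultimately show ?thesis unfolding cut_def
    by (intro exI[of _ "subpath s t c +++ linepath (c t) \<kappa>"]) simp
qed

end

lemma circle_path_from:
  assumes "r > 0" "k \<in> sphere a r"
  obtains c where "simple_path c" "path_image c = sphere (a::complex) r" "c 0 = k" "c 1 = k"
proof -
  have sp: "simple_path (circlepath a r)" and img: "path_image (circlepath a r) = sphere a r"
    using assms(1) by (auto simp: simple_path_circlepath)
  have "k \<in> circlepath a r ` {0..1}" using assms(2) img unfolding path_image_def by blast
  then obtain t where t: "t \<in> {0..1}" "circlepath a r t = k" by blast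
  have cl: "pathfinish (circlepath a r) = pathstart (circlepath a r)" by simp
  let ?c = "shiftpath t (circlepath a r)"
  have "simple_path ?c" using sp cl t by (intro simple_path_shiftpath) auto
  moreover have "path_image ?c = sphere a r" using path_image_shiftpath[OF t(1) cl] img by simp
  moreover have "?c 0 = k" using t by (simp add: shiftpath_def)
  moreover have "?c 1 = k"
    using t pathfinish_shiftpath[of t "circlepath a r"] cl by (simp add: pathfinish_def)
  ultimately show ?thesis using that by blast
qed

lemma convex_combination_in_ball:
  fixes a :: "'a::real_normed_vector"
  assumes "dist a y \<le> r" "x \<in> ball a r" "z \<in> closed_segment y x" "z \<noteq> y"
  shows "z \<in> ball a r"
proof -
  obtain u where u: "0 \<le> u" "u \<le> 1" "z = (1 - u) *\<^sub>R y + u *\<^sub>R x"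
    using assms(3) by (auto simp: in_segment)
  have "u > 0" using u assms(4) by (cases "u = 0") auto
  have "a - z = (1 - u) *\<^sub>R (a - y) + u *\<^sub>R (a - x)" by (simp add: u(3) algebra_simps)
  then have "dist a z \<le> (1 - u) * dist a y + u * dist a x"
    using u norm_triangle_ineq[of "(1 - u) *\<^sub>R (a - y)" "u *\<^sub>R (a - x)"] by (simp add: dist_norm)
  also have "\<dots> \<le> (1 - u) * r + u * dist a x" using assms(1) u by (simp add: mult_left_mono)
  also have "\<dots> < (1 - u) * r + u * r" using assms(2) \<open>u > 0\<close> by simp
  finally show ?thesis by (simp add: algebra_simps)
qed

context plane_continuum
begin

text \<open>
  A circle around \<open>a\<close> has an arc \<open>X\<close> in the complement of \<open>K\<close> that captures almost all \<open>E n\<close>, but both ends of \<open>X\<close> may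
  be the same point of \<open>K\<close>. Therefore \<open>X\<close> is split at a point \<open>y\<close> from which a segment avoiding \<open>a\<close> leads to \<open>K\<close>
  inside the circle. Each half of \<open>X\<close> together with the segment is a crosscut, and by Janiszewski's theorem
  one of the two still captures almost all \<open>E n\<close>. That \<open>a\<close> is avoided makes it possible to choose successive
  crosscuts disjoint.
\<close>

lemma cut_near:
  fixes E :: "nat \<Rightarrow> complex set"
  assumes E: "\<And>n. compact (E n)" "\<And>n. connected (E n - K)" "\<And>n. E n - K \<noteq> {}" "a \<in> K"
      "\<And>\<eta>. \<eta> > 0 \<Longrightarrow> \<forall>\<^sub>F n in sequentially. E n \<subseteq> ball a \<eta>"
    and w: "\<And>n. w n \<notin> K" "\<And>m n. n \<le> m \<Longrightarrow> w m \<notin> far_side (E n)"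
    and "\<rho> > 0"
  obtains C where "cut C" "C \<subseteq> cball a \<rho>" "a \<notin> C" "\<forall>\<^sub>F n in sequentially. E n - K \<subseteq> near_side C"
proof -
  have captured: "\<forall>\<^sub>F n in sequentially. E n - K \<subseteq> near_side X"
    if "compact X" "connected (X - K)" "X - K \<noteq> {}" "a \<notin> X" "\<And>j. j \<ge> m \<Longrightarrow> w j \<notin> far_side X" for X m
    by (rule eventually_captured[of E a w X m]) (fact E w that)+
  have wE: "w m \<notin> far_side X" if "compact X" "(E n - K) \<inter> far_side X = {}" "n \<le> m" for X n m
    using captured_trans[OF that(1,2)] w(2)[OF that(3)] by blast
  have all: "(E n - K) \<inter> far_side X = {}"
    if "e \<in> E n - K" "e \<notin> far_side X" "E n \<inter> X = {}" for e n X
    using outside_connected_meets[OF E(2)[of n], of "K \<union> X"] that by blast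
  obtain b where b: "b \<in> K" "b \<noteq> a" using nontrivial by metis
  \<comment> \<open>Below \<open>dist a b\<close>, both \<open>r\<close> and \<open>r / 2\<close>
    are distances from \<open>a\<close> attained on the connected set \<open>K\<close>: the circle
    meets \<open>K\<close>, and \<open>K\<close> has a point \<open>\<kappa>\<close> halfway
    inside.\<close>
  define r where "r = min \<rho> (dist a b / 2)"
  have r: "0 < r" "r \<le> \<rho>" "r < dist a b" using b \<open>\<rho> > 0\<close> by (auto simp: r_def min_less_iff_disj)
  have "connected (dist a ` K)" by (intro connected_continuous_image connected_K continuous_intros)
  then have int: "t \<in> dist a ` K" if "0 \<le> t" "t \<le> dist a b" for t
    using connectedD_interval[of "dist a ` K" 0 "dist a b" t] b E(4) that by (metis dist_self image_eqI)
  obtain \<kappa> where \<kappa>: "\<kappa> \<in> K" "dist a \<kappa> = r / 2" using int[of "r / 2"] r by auto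
  obtain k where k: "k \<in> K" "k \<in> sphere a r" using int[of r] r by auto
  obtain c where c: "simple_path c" "path_image c = sphere a r" "c 0 = k" "c 1 = k"
    using circle_path_from[OF r(1) k(2)] .
  have img: "c ` {0..1} = sphere a r" using c(2) by (simp add: path_image_def)
  have cont: "continuous_on {0..1} c" using c(1) by (simp add: simple_path_def path_def)
  have cK: "c 0 \<in> K" "c 1 \<in> K" using c k by auto
  have cinj: "s = s'" if "c s = c s'" "s \<in> {0..1}" "s' \<in> {0..1}" "c s \<notin> K" for s s'
    using c(1) that cK unfolding simple_path_def loop_free_def by metis
  obtain N where N: "E N \<subseteq> ball a r" using E(5)[OF r(1)] by (auto simp: eventually_sequentially)
  obtain e where e: "e \<in> E N" "e \<notin> K" using E(3)[of N] by blast
  obtain \<alpha> \<beta> where g: "gap c (\<alpha>, \<beta>)" "e \<notin> far_side (c ` {\<alpha>..\<beta>})"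
    using circle_gap_separates[OF c(1,2) cK _ e(2)] e(1) N by blast
  have \<alpha>\<beta>: "0 \<le> \<alpha>" "\<alpha> < \<beta>" "\<beta> \<le> 1" "c \<alpha> \<in> K" "c \<beta> \<in> K" "\<And>s. s \<in> {\<alpha><..<\<beta>} \<Longrightarrow> c s \<notin> K"
    using g(1) by (auto simp: gap_def)
  define X where "X = c ` {\<alpha>..\<beta>}"
  have sub01: "{\<alpha>..\<beta>} \<subseteq> {0..1}" using \<alpha>\<beta> by auto
  have Xs: "X \<subseteq> sphere a r" unfolding X_def img[symmetric] using sub01 by blast
  have Xc: "compact X" unfolding X_def
    using cont sub01 by (intro compact_continuous_image) (auto intro: continuous_on_subset)
  have "{\<alpha>..\<beta>} = insert \<alpha> (insert \<beta> {\<alpha><..<\<beta>})" using \<alpha>\<beta> by auto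
  then have XK: "X - K = c ` {\<alpha><..<\<beta>}" using \<alpha>\<beta>(4-6) by (auto simp: X_def)
  have "continuous_on {\<alpha><..<\<beta>} c" by (rule continuous_on_subset[OF cont]) (use \<alpha>\<beta>(1,3) in auto)
  then have Xcon: "connected (X - K)" unfolding XK by (intro connected_continuous_image) auto
  have evX: "\<forall>\<^sub>F n in sequentially. E n - K \<subseteq> near_side X"
  proof (rule captured[OF Xc Xcon])
    show "X - K \<noteq> {}" using XK \<alpha>\<beta> by auto
    show "a \<notin> X" using Xs r by auto
    fix j assume "j \<ge> N"
    have "ball a r \<inter> sphere a r = {}" by auto
    then have "E N \<inter> X = {}" using N Xs by blast
    then show "w j \<notin> far_side X"
      using wE[OF Xc all[of e N X] \<open>j \<ge> N\<close>] e g(2) by (simp add: X_def)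
  qed
  \<comment> \<open>The segment from \<open>c s\<close> to \<open>\<kappa>\<close> passes through
    \<open>a\<close> only if \<open>c s - a\<close> is \<open>-2\<close> times
    \<open>\<kappa> - a\<close>, by the radii \<open>r\<close> and \<open>r / 2\<close>. This
    singles out one point of the circle, so one of two parameters will do.\<close>
  obtain \<tau> where \<tau>: "\<alpha> < \<tau>" "\<tau> < \<beta>" "a \<notin> closed_segment (c \<tau>) \<kappa>"
  proof -
    define t1 where "t1 = \<alpha> + (\<beta> - \<alpha>) / 3"
    define t2 where "t2 = \<alpha> + 2 * (\<beta> - \<alpha>) / 3"
    have t: "t1 \<in> {\<alpha><..<\<beta>}" "t2 \<in> {\<alpha><..<\<beta>}" "t1 \<noteq> t2"
      using \<alpha>\<beta>(2) by (auto simp: t1_def t2_def field_simps)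
    have "a \<notin> closed_segment (c t1) \<kappa> \<or> a \<notin> closed_segment (c t2) \<kappa>"
    proof (rule ccontr)
      assume "\<not> ?thesis"
      then have a: "a \<in> closed_segment (c t1) \<kappa>" "a \<in> closed_segment (c t2) \<kappa>" by auto
      have on: "c s - a = - 2 *\<^sub>R (\<kappa> - a)" if as: "a \<in> closed_segment (c s) \<kappa>" "s \<in> {\<alpha><..<\<beta>}" for s
      proof -
        obtain u where u: "0 \<le> u" "u \<le> 1" "a = (1 - u) *\<^sub>R c s + u *\<^sub>R \<kappa>"
          using as(1) by (auto simp: in_segment)
        have z: "(1 - u) *\<^sub>R (c s - a) + u *\<^sub>R (\<kappa> - a) = 0"
          using u(3) by (simp add: algebra_simps)
        then have "norm ((1 - u) *\<^sub>R (c s - a)) = norm (u *\<^sub>R (\<kappa> - a))"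
          by (metis add_eq_0_iff norm_minus_cancel)
        moreover have "norm (c s - a) = r" "norm (\<kappa> - a) = r / 2"
          using that(2) sub01 img \<kappa>(2) by (auto simp: dist_norm norm_minus_commute)
        ultimately have "(1 - u) * r = u * (r / 2)" using u by simp
        then have "u = 2 / 3" using r(1) by (simp add: field_simps)
        then have "u = 2 * (1 / 3)" "1 - u = 1 / 3" by auto
        then have "(1 / 3) *\<^sub>R ((c s - a) + 2 *\<^sub>R (\<kappa> - a)) = 0"
          using z by (simp only: scaleR_right_distrib scaleR_scaleR mult.commute)
        then have "(c s - a) + 2 *\<^sub>R (\<kappa> - a) = 0" by simp
        then show ?thesis by (simp add: eq_neg_iff_add_eq_0)
      qed
      have "c t1 = c t2" using on[OF a(1) t(1)] on[OF a(2) t(2)] by (metis diff_add_cancel)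
      then show False using cinj[of t1 t2] t \<alpha>\<beta>(6) sub01 by auto
    qed
    then show thesis using that t by auto
  qed
  define y where "y = c \<tau>"
  have y: "y \<notin> K" "y \<in> sphere a r" using \<alpha>\<beta>(6)[of \<tau>] \<tau> img sub01 by (auto simp: y_def)
  \<comment> \<open>The segment is stopped at \<open>\<mu>\<close>, its first point in
    \<open>K\<close>, because a crosscut may meet \<open>K\<close> at its ends only.\<close>
  have "compact (closed_segment y \<kappa> \<inter> K)" using closed_K by (intro compact_Int_closed) auto
  moreover have "closed_segment y \<kappa> \<inter> K \<noteq> {}" using \<kappa>(1) by auto
  ultimately obtain \<mu> where \<mu>: "\<mu> \<in> closed_segment y \<kappa> \<inter> K"
      "\<And>z. z \<in> closed_segment y \<kappa> \<inter> K \<Longrightarrow> dist y \<mu> \<le> dist y z"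
    using distance_attains_inf[of "closed_segment y \<kappa> \<inter> K" y] compact_imp_closed by blast
  define S where "S = closed_segment y \<mu>"
  have Ssub: "S \<subseteq> closed_segment y \<kappa>" unfolding S_def using \<mu>(1) by (intro closed_segment_subset) auto
  have SK: "S \<inter> K = {\<mu>}"
  proof -
    have "z = \<mu>" if "z \<in> S" "z \<in> K" for z
    proof (rule ccontr)
      assume "z \<noteq> \<mu>"
      moreover have "z \<noteq> y" using that y by auto
      ultimately have "z \<in> open_segment y \<mu>" using that by (simp add: S_def open_segment_def)
      then have "dist y z < dist y \<mu>" using dist_in_open_segment by (metis dist_commute)
      then show False using \<mu>(2)[of z] that Ssub by auto
    qed
    then show ?thesis using \<mu>(1) by (auto simp: S_def)
  qed
  have Sball: "S - {y} \<subseteq> ball a r"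
  proof
    fix z assume "z \<in> S - {y}"
    then have "z \<in> closed_segment y \<kappa>" "z \<noteq> y" using Ssub by auto
    moreover have "dist a y \<le> r" "\<kappa> \<in> ball a r" using y(2) \<kappa>(2) r(1) by auto
    ultimately show "z \<in> ball a r" by (rule convex_combination_in_ball[rotated 2])
  qed
  have aS: "a \<notin> S" using \<tau>(3) Ssub by (auto simp: y_def)
  define D1 where "D1 = c ` {\<alpha>..\<tau>} \<union> S"
  define D2 where "D2 = c ` {\<tau>..\<beta>} \<union> S"
  have "cut (c ` closed_segment \<alpha> \<tau> \<union> closed_segment (c \<tau>) \<mu>)"
    using \<alpha>\<beta> \<tau> cK \<mu>(1) Sball SK y
    by (intro cut_arcI[OF c(1,2)]) (auto simp: y_def S_def closed_segment_eq_real_ivl)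
  then have D1: "cut D1" using \<tau> by (simp add: D1_def S_def y_def closed_segment_eq_real_ivl)
  have "cut (c ` closed_segment \<beta> \<tau> \<union> closed_segment (c \<tau>) \<mu>)"
    using \<alpha>\<beta> \<tau> cK \<mu>(1) Sball SK y
    by (intro cut_arcI[OF c(1,2)]) (auto simp: y_def S_def closed_segment_eq_real_ivl)
  then have D2: "cut D2" using \<tau> by (simp add: D2_def S_def y_def closed_segment_eq_real_ivl)
  have "c ` {\<alpha>..\<tau>} \<subseteq> X" "c ` {\<tau>..\<beta>} \<subseteq> X" using \<tau> by (auto simp: X_def)
  moreover have "S \<subseteq> cball a r" using Sball y by auto
  ultimately have Dball: "D1 \<subseteq> cball a r" "D2 \<subseteq> cball a r" and aD: "a \<notin> D1" "a \<notin> D2"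
  proof -
    assume 1: "c ` {\<alpha>..\<tau>} \<subseteq> X" "c ` {\<tau>..\<beta>} \<subseteq> X" "S \<subseteq> cball a r"
    have "X \<subseteq> cball a r" "a \<notin> X" using Xs r(1) by auto
    then show "D1 \<subseteq> cball a r" "D2 \<subseteq> cball a r" "a \<notin> D1" "a \<notin> D2"
      using 1 aS unfolding D1_def D2_def by blast+
  qed
  have XD: "X \<subseteq> D1 \<union> D2"
  proof -
    have "{\<alpha>..\<beta>} \<subseteq> {\<alpha>..\<tau>} \<union> {\<tau>..\<beta>}" by auto
    then show ?thesis by (auto simp: X_def D1_def D2_def image_iff)
  qed
  have "c ` {\<alpha>..\<tau>} \<inter> c ` {\<tau>..\<beta>} \<subseteq> K \<union> S"
  proof
    fix z assume "z \<in> c ` {\<alpha>..\<tau>} \<inter> c ` {\<tau>..\<beta>}"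
    then obtain s s' where s: "s \<in> {\<alpha>..\<tau>}" "z = c s" "s' \<in> {\<tau>..\<beta>}" "z = c s'" by blast
    show "z \<in> K \<union> S"
    proof (cases "z \<in> K")
      case False
      then have "s = s'" using cinj[of s s'] s \<alpha>\<beta> \<tau> by auto
      then have "s = \<tau>" using s by auto
      then show ?thesis using s by (simp add: S_def y_def)
    qed simp
  qed
  then have DD: "(K \<union> D1) \<inter> (K \<union> D2) = K \<union> S" by (auto simp: D1_def D2_def)
  have KS: "connected (K \<union> S)"
    using connected_K SK by (intro connected_Un) (auto simp: S_def)
  \<comment> \<open>A point of a late \<open>E n\<close> is captured by \<open>X\<close>, hence by
    \<open>D1\<close> and \<open>D2\<close> together. As
    \<open>(K \<union> D1) \<inter> (K \<union> D2)\<close> is the connected set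
    \<open>K \<union> S\<close>, one of them captures it alone, and with it all of
    \<open>E n - K\<close>.\<close>
  have "\<exists>D\<in>{D1, D2}. \<exists>n. (E n - K) \<inter> far_side D = {}"
  proof -
    have "open (- (D1 \<union> D2))" using D1 D2 compact_cut by (auto intro!: open_Compl closed_Un compact_imp_closed)
    then obtain \<theta> where \<theta>: "\<theta> > 0" "ball a \<theta> \<subseteq> - (D1 \<union> D2)" using aD open_contains_ball[of "- (D1 \<union> D2)"] by blast
    have "\<forall>\<^sub>F n in sequentially. E n \<subseteq> ball a \<theta> \<and> E n - K \<subseteq> near_side X"
      using evX E(5)[OF \<theta>(1)] by eventually_elim simp
    then obtain n where n: "E n \<subseteq> ball a \<theta>" "E n - K \<subseteq> near_side X" by (auto simp: eventually_sequentially)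
    obtain e where e: "e \<in> E n - K" using E(3)[of n] by blast
    have "e \<notin> far_side X" using e n(2) inside_Int_outside by blast
    then have "e \<notin> outside ((K \<union> D1) \<union> (K \<union> D2))"
      using XD outside_mono[of "K \<union> X" "(K \<union> D1) \<union> (K \<union> D2)"] by blast
    then have "e \<notin> far_side D1 \<or> e \<notin> far_side D2"
      using outside_Un_compact[of "K \<union> D1" "K \<union> D2" e] compact_Un_cut[OF D1] compact_Un_cut[OF D2] DD KS by auto
    moreover have "E n \<inter> D1 = {}" "E n \<inter> D2 = {}" using n(1) \<theta>(2) by auto
    ultimately show ?thesis using all[OF e] by blast
  qed
  then obtain D n where D: "D \<in> {D1, D2}" "(E n - K) \<inter> far_side D = {}" by blast
  have cD: "cut D" "D \<subseteq> cball a r" "a \<notin> D" using D(1) D1 D2 Dball aD by auto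
  have "\<forall>\<^sub>F n in sequentially. E n - K \<subseteq> near_side D"
    using captured[OF compact_cut[OF cD(1)] connected_cut_minus[OF cD(1)] cut_minus_nonempty[OF cD(1)] cD(3)]
      wE[OF compact_cut[OF cD(1)] D(2)] by blast
  moreover have "cball a r \<subseteq> cball a \<rho>" using r by (intro subset_cball) simp
  ultimately show ?thesis using that cD by blast
qed

section \<open>Chains of crosscuts\<close>

text \<open>The plane version of \<open>prime_end_sequence\<close>. Diameters tending to 0 are
  expressed by small balls with arbitrary centres.\<close>

definition chain :: "(nat \<Rightarrow> complex set) \<Rightarrow> bool" where
  "chain C \<longleftrightarrow> (\<forall>n. cut (C n)) \<and> disjoint_family C \<and>
     (\<forall>\<eta>>0. \<forall>\<^sub>F n in sequentially. \<exists>c. C n \<subseteq> ball c \<eta>) \<and>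
     (\<forall>n. C (Suc n) \<subseteq> closure (near_side (C n)))"

lemma cut_subset_closure:
  assumes "cut C"
  shows "C \<subseteq> closure (C - K)"
proof -
  obtain g where g: "C = g ` {0..1}" "continuous_on {0..1} g" "C - K = g ` {0<..<1::real}"
    using cutE[OF assms] by metis
  have "g ` closure {0<..<1} \<subseteq> closure (g ` {0<..<1})"
    using g(2) by (intro image_closure_subset[OF _ closed_closure closure_subset]) simp
  then show ?thesis unfolding g(3) unfolding g(1) by simp
qed

text \<open>The closure of the near side adds only points of \<open>K\<close> and of
  \<open>C n\<close>, and \<open>C (Suc n)\<close> is disjoint from \<open>C n\<close>.\<close>

lemma chain_step:
  assumes "chain C"
  shows "C (Suc n) - K \<subseteq> near_side (C n)"
proof -
  have "cut (C n)" "C (Suc n) \<subseteq> closure (near_side (C n))" and d: "C (Suc n) \<inter> C n = {}"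
    using assms by (auto simp: chain_def disjoint_family_on_def)
  moreover have "closure (near_side (C n)) \<subseteq> K \<union> C n \<union> near_side (C n)"
    using compact_Un_cut[OF \<open>cut (C n)\<close>] compact_imp_closed by (intro closure_inside_subset) blast
  ultimately show ?thesis by blast
qed

lemma chain_inside_Suc:
  assumes "chain C"
  shows "near_side (C (Suc n)) \<subseteq> near_side (C n)"
  using assms chain_step[OF assms, of n]
  by (intro inside_cut_mono) (auto simp: chain_def disjoint_family_on_def)

lemma chain_inside_mono:
  assumes "chain C" "m \<le> n"
  shows "near_side (C n) \<subseteq> near_side (C m)"
  using lift_Suc_antimono_le[of "\<lambda>n. near_side (C n)", OF chain_inside_Suc[OF assms(1)] assms(2)] .

text \<open>Separators of size \<open>1 / (n + 1)\<close> are chosen along nested subsequences. Each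
  captures all late terms of the diagonal sequence, and compactness of \<open>K\<close> makes their
  base points \<open>\<kappa> n\<close> accumulate at some \<open>a\<close>.\<close>

lemma small_separators_converging:
  fixes w :: "nat \<Rightarrow> complex"
  assumes wK: "\<And>k. w k \<notin> K" and lim: "(\<lambda>k. infdist (w k) K) \<longlonglongrightarrow> 0"
  obtains r E a where "strict_mono (r :: nat \<Rightarrow> nat)" "\<And>n::nat. compact (E n)" "\<And>n. connected (E n - K)"
    "\<And>n. E n - K \<noteq> {}" "a \<in> K" "\<And>\<eta>. \<eta> > 0 \<Longrightarrow> \<forall>\<^sub>F n in sequentially. E n \<subseteq> ball a \<eta>"
    "\<And>m n. n \<le> m \<Longrightarrow> w (r m) \<notin> far_side (E n)"
proof -
  define P where "P n s \<longleftrightarrow> (\<exists>E \<kappa>. compact E \<and> connected (E - K) \<and> E - K \<noteq> {} \<and> \<kappa> \<in> K \<and>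
      E \<subseteq> cball \<kappa> (1 / real (Suc n)) \<and> (\<forall>k. w (s k) \<notin> far_side E))" for n and s :: "nat \<Rightarrow> nat"
  interpret subseqs P
  proof
    fix n and s :: "nat \<Rightarrow> nat" assume s: "strict_mono s"
    have "(\<lambda>k. infdist ((w \<circ> s) k) K) \<longlonglongrightarrow> 0"
      using LIMSEQ_subseq_LIMSEQ[OF lim s] by (simp add: o_def)
    then obtain E \<kappa> where E: "compact E" "connected (E - K)" "E - K \<noteq> {}" "\<kappa> \<in> K" "E \<subseteq> cball \<kappa> (1 / real (Suc n))"
      "infinite {k. (w \<circ> s) k \<notin> far_side E}"
      using small_separator[of "w \<circ> s" "1 / real (Suc n)"] wK by auto
    let ?r = "enumerate {k. (w \<circ> s) k \<notin> far_side E}"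
    have "strict_mono ?r" using E(6) by (rule strict_mono_enumerate)
    moreover have "w ((s \<circ> ?r) k) \<notin> far_side E" for k
      using enumerate_in_set[OF E(6), of k] by simp
    ultimately show "\<exists>r'. strict_mono r' \<and> P n (s \<circ> r')"
      unfolding P_def using E by blast
  qed
  \<comment> \<open>\<open>P n\<close> speaks of all terms and so survives passing to subsequences;
    from index \<open>Suc n\<close> on, the diagonal sequence is a subsequence of the one made for
    \<open>P n\<close>.\<close>
  have "P n (diagseq \<circ> (+) (Suc n))" for n
  proof (rule diagseq_holds)
    fix n s r assume "strict_mono (r :: nat \<Rightarrow> nat)" "P n s"
    then show "P n (s \<circ> r)" unfolding P_def o_def by blast
  qed
  then have "\<forall>n. \<exists>E \<kappa>. compact E \<and> connected (E - K) \<and> E - K \<noteq> {} \<and> \<kappa> \<in> K \<and>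
      E \<subseteq> cball \<kappa> (1 / real (Suc n)) \<and> (\<forall>k. w (diagseq (Suc n + k)) \<notin> far_side E)"
    unfolding P_def o_def by blast
  from choice2[OF this]
  obtain E \<kappa> where E: "compact (E n)" "connected (E n - K)" "E n - K \<noteq> {}" "\<kappa> n \<in> K"
      "E n \<subseteq> cball (\<kappa> n) (1 / real (Suc n))" "w (diagseq (Suc n + k)) \<notin> far_side (E n)" for n k
    by blast
  obtain a q where aq: "a \<in> K" "strict_mono (q :: nat \<Rightarrow> nat)" "(\<kappa> \<circ> q) \<longlonglongrightarrow> a"
    using compact_K E(4) unfolding compact_def by metis
  define r where "r m = diagseq (Suc (q m))" for m
  have "strict_mono r"
    unfolding r_def using subseq_diagseq aq(2) by (auto simp: strict_mono_def)
  moreover have "w (r m) \<notin> far_side (E (q n))" if "n \<le> m" for m n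
  proof -
    have "q n \<le> q m" using aq(2) that by (simp add: strict_mono_less_eq)
    then have "Suc (q m) = Suc (q n) + (q m - q n)" by simp
    then show ?thesis unfolding r_def using E(6)[of "q n" "q m - q n"] by metis
  qed
  moreover have "\<forall>\<^sub>F n in sequentially. E (q n) \<subseteq> ball a \<eta>" if \<eta>: "\<eta> > 0" for \<eta>
  proof -
    have "\<forall>\<^sub>F n in sequentially. dist (\<kappa> (q n)) a < \<eta> / 2"
      using tendstoD[OF aq(3), of "\<eta> / 2"] \<eta> by (simp add: o_def)
    moreover have "\<forall>\<^sub>F n in sequentially. 1 / real (Suc n) < \<eta> / 2"
      using LIMSEQ_inverse_real_of_nat \<eta> order_tendstoD(2)[of "\<lambda>n. inverse (real (Suc n))" 0 sequentially "\<eta> / 2"]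
      by (simp add: inverse_eq_divide)
    ultimately show ?thesis
    proof eventually_elim
      case (elim n)
      have "n \<le> q n" using aq(2) by (rule seq_suble)
      then have "1 / real (Suc (q n)) \<le> 1 / real (Suc n)" by (simp add: frac_le)
      show ?case
      proof
        fix x assume "x \<in> E (q n)"
        then have "dist (\<kappa> (q n)) x \<le> 1 / real (Suc (q n))" using E(5)[of "q n"] by auto
        then have "dist a x < \<eta> / 2 + \<eta> / 2"
          using elim \<open>1 / real (Suc (q n)) \<le> 1 / real (Suc n)\<close> dist_triangle[of a x "\<kappa> (q n)"]
          by (simp add: dist_commute)
        then show "x \<in> ball a \<eta>" by simp
      qed
    qed
  qed
  ultimately show ?thesis using that[of r "E \<circ> q" a] E(1-3) aq(1) by simp
qed

text \<open>All crosscuts come from \<open>cut_near\<close> at the same limit point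
  \<open>a\<close>. Since each avoids \<open>a\<close>, the next one can be taken in a disc around
  \<open>a\<close> that it misses.\<close>

lemma chain_subsequence:
  fixes w :: "nat \<Rightarrow> complex"
  assumes wK: "\<And>k. w k \<notin> K" and lim: "(\<lambda>k. infdist (w k) K) \<longlonglongrightarrow> 0"
  obtains r C where "strict_mono (r :: nat \<Rightarrow> nat)" "chain C"
    "\<And>n. \<forall>\<^sub>F j in sequentially. w (r j) \<in> near_side (C n)"
proof -
  obtain r E a where r: "strict_mono (r :: nat \<Rightarrow> nat)" and E: "\<And>n::nat. compact (E n)" "\<And>n. connected (E n - K)"
    "\<And>n. E n - K \<noteq> {}" "a \<in> K" "\<And>\<eta>. \<eta> > 0 \<Longrightarrow> \<forall>\<^sub>F n in sequentially. E n \<subseteq> ball a \<eta>"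
    and w: "\<And>m n. n \<le> m \<Longrightarrow> w (r m) \<notin> far_side (E n)"
    using small_separators_converging[of w, OF wK lim] by blast
  have near: "\<exists>C. cut C \<and> C \<subseteq> cball a \<rho> \<and> a \<notin> C \<and> (\<forall>\<^sub>F n in sequentially. E n - K \<subseteq> near_side C)"
    if "\<rho> > 0" for \<rho>
    using cut_near[of E a "w \<circ> r" \<rho>] E w wK that by (metis comp_apply)
  define Q where "Q n x \<longleftrightarrow> (case x of (C, \<rho>) \<Rightarrow> cut C \<and> C \<subseteq> cball a \<rho> \<and> a \<notin> C \<and> 0 < \<rho> \<and> \<rho> \<le> 1 / real (Suc n) \<and>
     (\<forall>\<^sub>F n in sequentially. E n - K \<subseteq> near_side C))" for n :: nat and x
  define S where "S x y \<longleftrightarrow> (case (x, y) of ((C, \<rho>), (C', \<rho>')) \<Rightarrow>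
     \<rho>' \<le> \<rho> \<and> C \<inter> cball a \<rho>' = {} \<and> C' - K \<subseteq> near_side C)" for x y :: "complex set \<times> real"
  have "\<exists>x. Q 0 x" using near[of 1] unfolding Q_def by (metis (no_types, lifting) case_prodI div_by_1 of_nat_1 One_nat_def order_refl zero_less_one)
  moreover have "\<exists>y. Q (Suc n) y \<and> S x y" if x: "Q n x" for n x
  proof -
    obtain C \<rho> where C: "x = (C, \<rho>)" "cut C" "C \<subseteq> cball a \<rho>" "a \<notin> C" "0 < \<rho>"
      "\<forall>\<^sub>F n in sequentially. E n - K \<subseteq> near_side C" using x by (cases x) (auto simp: Q_def)
    obtain c where c: "c \<in> C" "c \<notin> K" using cut_minus_nonempty[OF C(2)] by blast
    obtain \<eta> where \<eta>: "\<eta> > 0" "c \<in> far_side (cball a \<eta>)" using escapes_small_cball[OF c(2) E(4)] .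
    have "open (- C)" using compact_cut[OF C(2)] by (simp add: compact_imp_closed open_Compl)
    then obtain \<theta> where \<theta>: "\<theta> > 0" "cball a \<theta> \<subseteq> - C" using C(4) open_contains_cball by blast
    \<comment> \<open>\<open>\<theta>\<close> keeps \<open>C'\<close> off \<open>C\<close>,
      \<open>\<eta>\<close> keeps it from capturing the point \<open>c\<close> of \<open>C\<close>,
      and the last bound makes the crosscuts shrink.\<close>
    define \<rho>' where "\<rho>' = Min {\<rho>, \<eta>, \<theta>, 1 / real (Suc (Suc n))}"
    have \<rho>': "\<rho>' > 0" "\<rho>' \<le> \<rho>" "\<rho>' \<le> \<eta>" "\<rho>' \<le> \<theta>" "\<rho>' \<le> 1 / real (Suc (Suc n))"
      using C(5) \<eta> \<theta> by (auto simp: \<rho>'_def)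
    obtain C' where C': "cut C'" "C' \<subseteq> cball a \<rho>'" "a \<notin> C'"
      "\<forall>\<^sub>F n in sequentially. E n - K \<subseteq> near_side C'" using near[OF \<rho>'(1)] by blast
    have dis: "C \<inter> cball a \<rho>' = {}" using \<theta>(2) subset_cball[OF \<rho>'(4), of a] by blast
    have "\<forall>\<^sub>F n in sequentially. E n - K \<subseteq> near_side C \<and> E n - K \<subseteq> near_side C'"
      using C(6) C'(4) by eventually_elim simp
    then obtain m where "E m - K \<subseteq> near_side C" "E m - K \<subseteq> near_side C'"
      by (auto simp: eventually_sequentially)
    then obtain e where e: "e \<notin> K" "e \<in> near_side C" "e \<in> near_side C'" using E(3)[of m] by blast
    \<comment> \<open>Both crosscuts capture \<open>e\<close>, so one captures the other; as
      \<open>C'\<close> does not capture \<open>c\<close>, it is \<open>C\<close> that captures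
      \<open>C'\<close>.\<close>
    then have "(C' - K) \<inter> far_side C = {} \<or> (C - K) \<inter> far_side C' = {}"
      using C(2) C'(1,2) dis inside_Int_outside
      by (intro captured_nested_cases[OF compact_cut connected_cut_minus compact_cut connected_cut_minus _ e(1)]) blast+
    moreover have "K \<union> C' \<subseteq> K \<union> cball a \<eta>" using C'(2) subset_cball[OF \<rho>'(3), of a] by blast
    then have "c \<in> far_side C'" using \<eta>(2) outside_mono by blast
    ultimately have "(C' - K) \<inter> far_side C = {}" using c by blast
    then have "C' - K \<subseteq> near_side C" using dis C'(2) unfolding inside_outside by blast
    then have "Q (Suc n) (C', \<rho>') \<and> S x (C', \<rho>')" using C' \<rho>' dis by (simp add: Q_def S_def C(1))
    then show ?thesis by blast
  qed
  ultimately obtain f where f: "\<And>n. Q n (f n)" "\<And>n. S (f n) (f (Suc n))"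
    using dependent_nat_choice[of Q "\<lambda>n. S"] by metis
  define C where "C n = fst (f n)" for n
  define \<rho> where "\<rho> n = snd (f n)" for n
  have C: "cut (C n)" "C n \<subseteq> cball a (\<rho> n)" "a \<notin> C n" "0 < \<rho> n" "\<rho> n \<le> 1 / real (Suc n)"
     "\<forall>\<^sub>F m in sequentially. E m - K \<subseteq> near_side (C n)" for n
    using f(1)[of n] by (auto simp: Q_def C_def \<rho>_def split: prod.splits)
  have CS: "\<rho> (Suc n) \<le> \<rho> n" "C n \<inter> cball a (\<rho> (Suc n)) = {}" "C (Suc n) - K \<subseteq> near_side (C n)" for n
    using f(2)[of n] by (auto simp: S_def C_def \<rho>_def split: prod.splits)
  have disj: "C m \<inter> C n = {}" if "m < n" for m n
  proof -
    have "\<rho> n \<le> \<rho> (Suc m)" using lift_Suc_antimono_le[of \<rho>, OF CS(1)] that by simp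
    then have "C n \<subseteq> cball a (\<rho> (Suc m))" using C(2)[of n] subset_cball by blast
    then show ?thesis using CS(2)[of m] by blast
  qed
  have "disjoint_family C"
    unfolding disjoint_family_on_def using disj by (metis Int_commute linorder_neqE_nat)
  moreover have "\<forall>\<^sub>F n in sequentially. \<exists>c. C n \<subseteq> ball c \<eta>" if \<eta>: "\<eta> > 0" for \<eta>
  proof -
    have "\<forall>\<^sub>F n in sequentially. 1 / real (Suc n) < \<eta>"
      using LIMSEQ_inverse_real_of_nat \<eta> order_tendstoD(2)[of "\<lambda>n. inverse (real (Suc n))" 0 sequentially "\<eta>"]
      by (simp add: inverse_eq_divide)
    then show ?thesis
    proof eventually_elim
      case (elim n)
      then have "cball a (\<rho> n) \<subseteq> ball a \<eta>" using C(5)[of n] by auto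
      then show ?case using C(2)[of n] by blast
    qed
  qed
  moreover have "C (Suc n) \<subseteq> closure (near_side (C n))" for n
    using cut_subset_closure[OF C(1)] closure_mono[OF CS(3)] by blast
  ultimately have "chain C" using C(1) by (simp add: chain_def)
  moreover have "\<forall>\<^sub>F j in sequentially. w (r j) \<in> near_side (C n)" for n
  proof -
    obtain m where "E m - K \<subseteq> near_side (C (Suc n))" using C(6)[of "Suc n"] by (auto simp: eventually_sequentially)
    then have "(E m - K) \<inter> far_side (C (Suc n)) = {}" using inside_Int_outside by blast
    then have cap: "far_side (C (Suc n)) \<subseteq> far_side (E m)" using captured_trans compact_cut C(1) by blast
    \<comment> \<open>A captured point may lie on the crosscut itself, so the capture by
      \<open>C (Suc n)\<close> is used for the near side of \<open>C n\<close>, which contains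
      \<open>C (Suc n) - K\<close>.\<close>
    have "w (r j) \<in> near_side (C n)" if "j \<ge> m" for j
    proof (cases "w (r j) \<in> C (Suc n)")
      case True then show ?thesis using CS(3) wK by blast
    next
      case False
      then have "w (r j) \<in> near_side (C (Suc n))" using cap w[OF that] wK unfolding inside_outside by blast
      then show ?thesis using chain_inside_Suc[OF \<open>chain C\<close>] by blast
    qed
    then show ?thesis by (auto simp: eventually_sequentially)
  qed
  ultimately show ?thesis using that r by blast
qed

text \<open>A small \<open>E k\<close> cannot meet both of the disjoint crosscuts \<open>C n\<close> and \<open>C (Suc n)\<close>.\<close>

lemma chain_captures_companion:
  fixes y y' :: "nat \<Rightarrow> complex"
  assumes "chain C" and y: "\<And>n. \<forall>\<^sub>F k in sequentially. y k \<in> near_side (C n)" and y': "\<And>k. y' k \<notin> K"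
    and E: "\<And>k. compact (E k)" "\<And>k. connected (E k - K)" "\<And>k. \<kappa> k \<in> K" "\<And>k. E k \<subseteq> cball (\<kappa> k) (\<epsilon> k)" "\<epsilon> \<longlonglongrightarrow> 0"
    and cap: "\<And>k. y k \<notin> far_side (E k)" "\<And>k. y' k \<notin> far_side (E k)"
  shows "\<forall>\<^sub>F k in sequentially. y' k \<in> near_side (C n)"
proof -
  have cut: "cut (C n)" for n using assms(1) by (simp add: chain_def)
  have dj: "C n \<inter> C (Suc n) = {}" using assms(1) by (auto simp: chain_def disjoint_family_on_def)
  obtain d where d: "d > 0" "\<And>x z. x \<in> C n \<Longrightarrow> z \<in> C (Suc n) \<Longrightarrow> d \<le> dist x z"
    using separate_compact_closed[OF compact_cut[OF cut] compact_imp_closed[OF compact_cut[OF cut]] dj] by blast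
  obtain c c' where c: "c \<in> C n" "c \<notin> K" "c' \<in> C (Suc n)" "c' \<notin> K"
    using cut_minus_nonempty[OF cut] by (metis Diff_iff ex_in_conv)
  obtain \<eta> \<eta>' where \<eta>: "\<eta> > 0" "c \<in> outside {x. infdist x K \<le> \<eta>}" "\<eta>' > 0" "c' \<in> outside {x. infdist x K \<le> \<eta>'}"
    using escapes_neighbourhood c by metis
  \<comment> \<open>Below \<open>d / 2\<close>, \<open>E k\<close> misses one of the two crosscuts;
    below \<open>\<eta>\<close> and \<open>\<eta>'\<close> it cannot capture the points
    \<open>c\<close> and \<open>c'\<close> on them.\<close>
  have "\<forall>\<^sub>F k in sequentially. \<epsilon> k < Min {d / 2, \<eta>, \<eta>'}"
    using E(5) d(1) \<eta> by (intro order_tendstoD(2)) auto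
  then show ?thesis using y[of "Suc n"]
  proof eventually_elim
    case (elim k)
    have Ek: "infdist x K \<le> \<epsilon> k" if "x \<in> E k" for x
      using infdist_le[OF E(3)[of k], of x] E(4)[of k] that by (auto simp: dist_commute)
    have eK: "infdist x K = 0" if "x \<in> K" for x using that by simp
    have "K \<union> E k \<subseteq> {x. infdist x K \<le> \<eta>}" "K \<union> E k \<subseteq> {x. infdist x K \<le> \<eta>'}"
      using Ek eK elim(1) \<eta> by force+
    then have out: "c \<in> far_side (E k)" "c' \<in> far_side (E k)" using \<eta> outside_mono by blast+
    \<comment> \<open>\<open>E k\<close> and \<open>D\<close> both capture \<open>y k\<close>, and
      \<open>E k\<close> does not capture \<open>z \<in> D\<close>; so \<open>D\<close> captures
      \<open>E k\<close> and everything that \<open>E k\<close> captures.\<close>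
    have main: "y' k \<in> near_side D"
      if D: "cut D" "E k \<inter> D = {}" "z \<in> D" "z \<notin> K" "z \<in> far_side (E k)" "y k \<in> near_side D" for D z
    proof -
      have "y k \<notin> K" using D(6) by (auto simp: inside_def)
      have "(D - K) \<inter> far_side (E k) = {} \<or> (E k - K) \<inter> far_side D = {}"
        using D cap(1)[of k] inside_Int_outside[of "K \<union> D"]
        by (intro captured_nested_cases[OF compact_cut connected_cut_minus E(1,2) _ \<open>y k \<notin> K\<close>]) blast+
      then have "(E k - K) \<inter> far_side D = {}" using D by blast
      then have "far_side D \<subseteq> far_side (E k)" using captured_trans compact_cut D(1) by blast
      then have "y' k \<notin> far_side D" using cap(2) by blast
      moreover have "D - K \<subseteq> far_side (E k)"
        using D by (intro outside_connected_meets connected_cut_minus) auto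
      then have "y' k \<notin> D" using cap(2) y' by blast
      ultimately show ?thesis using y' unfolding inside_outside by blast
    qed
    have "E k \<inter> C n = {} \<or> E k \<inter> C (Suc n) = {}"
    proof (rule ccontr)
      assume "\<not> ?thesis"
      then obtain x z where x: "x \<in> E k" "x \<in> C n" "z \<in> E k" "z \<in> C (Suc n)" by blast
      then have "dist (\<kappa> k) x \<le> \<epsilon> k" "dist (\<kappa> k) z \<le> \<epsilon> k" using E(4)[of k] by auto
      then have "dist x z \<le> 2 * \<epsilon> k" using dist_triangle2[of x z "\<kappa> k"] by (simp add: dist_commute)
      then show False using d(2)[OF x(2,4)] elim(1) by auto
    qed
    then show ?case
    proof
      assume "E k \<inter> C n = {}"
      then show ?thesis
        using main[OF cut _ c(1,2) out(1)] elim(2) chain_inside_Suc[OF assms(1), of n] by blast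
    next
      assume "E k \<inter> C (Suc n) = {}"
      then have "y' k \<in> near_side (C (Suc n))" using main[OF cut _ c(3,4) out(2) elim(2)] by blast
      then show ?thesis using chain_inside_Suc[OF assms(1), of n] by blast
    qed
  qed
qed

section \<open>Local connectivity of a plane continuum\<close>

lemma segment_cut:
  assumes "p \<noteq> q" "closed_segment p q \<inter> K = {p, q}"
  shows "cut (closed_segment p q)"
  unfolding cut_def using assms by (intro exI[of _ "linepath p q"]) auto

text \<open>Near the midpoint the segment leaves two half discs. If they were joined, they would lie
  in one component; every component comes near the midpoint, so there would be only one, although
  near side and far side are both nonempty.\<close>

lemma segment_cut_separates:
  assumes pq: "p \<noteq> q" "closed_segment p q \<inter> K = {p, q}"
    and e: "0 < e" "e \<le> norm (q - p) / 2" "ball (midpoint p q) e \<inter> K = {}"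
    and g: "g1 \<in> ball (midpoint p q) e" "Im ((g1 - midpoint p q) / (q - p)) > 0"
      "g2 \<in> ball (midpoint p q) e" "Im ((g2 - midpoint p q) / (q - p)) < 0"
  shows "\<not> joined (closed_segment p q) g1 g2"
proof
  define m where "m = midpoint p q"
  define v where "v = q - p"
  let ?X = "K \<union> closed_segment p q"
  have v: "v \<noteq> 0" using pq by (simp add: v_def)
  \<comment> \<open>In the coordinate \<open>(y - m) / v\<close> the segment is the real interval
    from \<open>- 1/2\<close> to \<open>1/2\<close>.\<close>
  have seg: "y \<in> closed_segment p q \<longleftrightarrow> Im ((y - m) / v) = 0 \<and> \<bar>Re ((y - m) / v)\<bar> \<le> 1/2" for y
  proof -
    have "(1 - u) *\<^sub>R p + u *\<^sub>R q = m + of_real (u - 1/2) * v" for u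
      by (simp add: m_def v_def midpoint_def complex_eq_iff field_simps)
    then have "y \<in> closed_segment p q \<longleftrightarrow> (\<exists>u. 0 \<le> u \<and> u \<le> 1 \<and> y = m + of_real (u - 1/2) * v)"
      by (simp add: in_segment)
    also have "\<dots> \<longleftrightarrow> (\<exists>u. 0 \<le> u \<and> u \<le> 1 \<and> (y - m) / v = of_real (u - 1/2))"
      using v by (intro arg_cong[where f = Ex] ext) (auto simp: field_simps)
    also have "\<dots> \<longleftrightarrow> Im ((y - m) / v) = 0 \<and> \<bar>Re ((y - m) / v)\<bar> \<le> 1/2"
    proof
      assume "Im ((y - m) / v) = 0 \<and> \<bar>Re ((y - m) / v)\<bar> \<le> 1/2"
      then show "\<exists>u. 0 \<le> u \<and> u \<le> 1 \<and> (y - m) / v = of_real (u - 1/2)"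
        by (intro exI[of _ "Re ((y - m) / v) + 1/2"]) (auto simp: complex_eq_iff)
    next
      assume "\<exists>u. 0 \<le> u \<and> u \<le> 1 \<and> (y - m) / v = of_real (u - 1/2)"
      then obtain u where "0 \<le> u" "u \<le> 1" "(y - m) / v = of_real (u - 1/2)" by blast
      then show "Im ((y - m) / v) = 0 \<and> \<bar>Re ((y - m) / v)\<bar> \<le> 1/2"
        by (simp only: Re_complex_of_real Im_complex_of_real) linarith
    qed
    finally show ?thesis .
  qed
  define H where "H \<sigma> = ball m e \<inter> {y. \<sigma> * Im ((y - m) / v) > 0}" for \<sigma> :: real
  have Hconv: "convex (H \<sigma>)" for \<sigma>
  proof -
    have "convex {y. \<sigma> * Im ((y - m) / v) > 0}"
    proof (rule convexI)
      fix x y :: complex and a b :: real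
      assume *: "x \<in> {y. \<sigma> * Im ((y - m) / v) > 0}" "y \<in> {y. \<sigma> * Im ((y - m) / v) > 0}" "0 \<le> a" "0 \<le> b" "a + b = 1"
      have b: "b = 1 - a" using *(5) by simp
      have "(a *\<^sub>R x + b *\<^sub>R y - m) / v = a *\<^sub>R ((x - m) / v) + b *\<^sub>R ((y - m) / v)"
        using v unfolding b by (simp add: field_simps scaleR_conv_of_real)
      then have "\<sigma> * Im ((a *\<^sub>R x + b *\<^sub>R y - m) / v) = a * (\<sigma> * Im ((x - m) / v)) + b * (\<sigma> * Im ((y - m) / v))"
        by (simp add: algebra_simps)
      moreover have "a * (\<sigma> * Im ((x - m) / v)) + b * (\<sigma> * Im ((y - m) / v)) > 0"
        using * by (cases "a = 0") (auto intro!: add_pos_nonneg)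
      ultimately show "a *\<^sub>R x + b *\<^sub>R y \<in> {y. \<sigma> * Im ((y - m) / v) > 0}" by simp
    qed
    then show ?thesis unfolding H_def by (intro convex_Int) auto
  qed
  have Hsub: "H \<sigma> \<subseteq> - ?X" for \<sigma>
    using e(3) seg by (auto simp: H_def m_def[symmetric])
  have ballH: "y \<in> H 1 \<union> H (- 1)" if "y \<in> ball m e" "y \<notin> ?X" for y
  proof (rule ccontr)
    assume "y \<notin> H 1 \<union> H (- 1)"
    then have Im0: "Im ((y - m) / v) = 0" using that by (auto simp: H_def)
    have "\<bar>Re ((y - m) / v)\<bar> \<le> norm ((y - m) / v)" by (rule abs_Re_le_cmod)
    also have "\<dots> \<le> 1/2" using that(1) e(2) v
      by (simp add: norm_divide dist_norm norm_minus_commute v_def[symmetric] field_simps)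
    finally show False using seg Im0 that(2) by auto
  qed
  assume cc: "connected_component (- ?X) g1 g2"
  have g': "g1 \<in> H 1" "g2 \<in> H (- 1)" using g by (auto simp: H_def m_def v_def)
  have "connected_component (- ?X) g1 y" if "y \<in> ball m e" "y \<notin> ?X" for y
    using ballH[OF that]
  proof
    assume "y \<in> H 1"
    then show ?thesis unfolding connected_component_def
      using g' Hsub convex_connected[OF Hconv] by blast
  next
    assume "y \<in> H (- 1)"
    then have "connected_component (- ?X) g2 y" unfolding connected_component_def
      using g' Hsub convex_connected[OF Hconv] by blast
    then show ?thesis using cc connected_component_trans by blast
  qed
  moreover have "\<exists>y\<in>V. y \<in> ball m e \<and> y \<notin> ?X" if "V \<in> components (- ?X)" for V
  proof -
    have "m \<in> ball m e" using e(1) by simp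
    then have "m \<notin> K" using e(3) unfolding m_def by (metis disjoint_iff)
    then have "m \<in> closed_segment p q - K" by (simp add: m_def)
    then have "m \<in> closure V" using cut_point_in_closure[OF segment_cut[OF pq] that] by blast
    then obtain y where "y \<in> V" "dist y m < e" using e(1) closure_approachable by blast
    then show ?thesis using in_components_subset[OF that] by (auto simp: dist_commute)
  qed
  moreover have "outside ?X \<in> components (- ?X)" "inside ?X \<in> components (- ?X)"
    using outside_cut_component connected_inside_cut cut_inside_nonempty segment_cut[OF pq]
    unfolding inside_in_components by blast+
  ultimately obtain x y where xy: "x \<in> outside ?X" "y \<in> inside ?X"
    "connected_component (- ?X) g1 x" "connected_component (- ?X) g1 y" by metis
  then have "connected_component (- ?X) x y" by (meson connected_component_sym connected_component_trans)
  then show False using xy(1,2) outside_same_component[of ?X x y] inside_Int_outside[of ?X] by blast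
qed

text \<open>The detour leads around the end \<open>m\<close> of the half segment, through a point
  \<open>t\<close> on its prolongation, and stays in a ball that misses \<open>P\<close>.\<close>

lemma midpoint_bypass:
  fixes P :: "complex set"
  assumes "p \<noteq> q" "0 < \<eta>" "ball (midpoint p q) e \<inter> P = {}" "\<eta> * norm (q - p) < e"
  defines "m \<equiv> midpoint p q" and "v \<equiv> q - p"
  shows "connected_component (- (P \<union> closed_segment p m)) (m + \<eta> *\<^sub>R (\<i> * v)) (m - \<eta> *\<^sub>R (\<i> * v))"
proof -
  have v: "v \<noteq> 0" using assms(1) by (simp add: v_def)
  define t where "t = m + \<eta> *\<^sub>R v"
  have "m + \<eta> *\<^sub>R (\<i> * v) \<in> ball m e" "m - \<eta> *\<^sub>R (\<i> * v) \<in> ball m e" "t \<in> ball m e"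
    using assms(2,4) by (auto simp: t_def dist_norm norm_mult v_def)
  then have ball: "closed_segment (m + \<eta> *\<^sub>R (\<i> * v)) t \<subseteq> ball m e" "closed_segment (m - \<eta> *\<^sub>R (\<i> * v)) t \<subseteq> ball m e"
    using closed_segment_subset[OF _ _ convex_ball] by blast+
  have avoid: "y \<notin> closed_segment p m" if y: "y \<in> closed_segment (m + (\<sigma> * \<eta>) *\<^sub>R (\<i> * v)) t" "\<sigma> \<noteq> 0" for y \<sigma>
  proof
    assume "y \<in> closed_segment p m"
    then obtain u where u: "0 \<le> u" "u \<le> 1" "y = (1 - u) *\<^sub>R p + u *\<^sub>R m" by (auto simp: in_segment)
    have p: "p = m - (1/2) *\<^sub>R v" by (simp add: m_def v_def midpoint_def complex_eq_iff field_simps)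
    have 1: "(y - m) / v = - of_real ((1 - u) / 2)"
      using v unfolding u(3) p by (simp add: field_simps scaleR_conv_of_real)
    obtain u' where u': "0 \<le> u'" "u' \<le> 1" "y = (1 - u') *\<^sub>R (m + (\<sigma> * \<eta>) *\<^sub>R (\<i> * v)) + u' *\<^sub>R t"
      using y(1) by (auto simp: in_segment)
    have "(y - m) / v = of_real ((1 - u') * (\<sigma> * \<eta>)) * \<i> + of_real (u' * \<eta>)"
      using v unfolding u'(3) t_def by (simp add: field_simps scaleR_conv_of_real)
    then have "Im ((y - m) / v) = (1 - u') * (\<sigma> * \<eta>)" "Re ((y - m) / v) = u' * \<eta>" by simp_all
    then have "(1 - u') * (\<sigma> * \<eta>) = 0" "u' * \<eta> = - ((1 - u) / 2)" unfolding 1 by simp_all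
    then have "u' = 1" "u' * \<eta> \<le> 0" using y(2) assms(2) u by auto
    then show False using assms(2) by simp
  qed
  let ?T = "closed_segment (m + \<eta> *\<^sub>R (\<i> * v)) t \<union> closed_segment (m - \<eta> *\<^sub>R (\<i> * v)) t"
  have "connected ?T" by (intro connected_Un) auto
  moreover have "?T \<inter> P = {}" using ball assms(3) by (auto simp: m_def)
  moreover have "?T \<inter> closed_segment p m = {}"
    using avoid[of _ 1] avoid[of _ "- 1"] by auto
  ultimately show ?thesis unfolding connected_component_def
    by (intro exI[of _ ?T]) auto
qed

text \<open>
  Split \<open>K \<inter> cball z s\<close> into a part \<open>P\<close> containing \<open>z\<close> and a part \<open>Q\<close> containing \<open>x\<close>. A segment from \<open>p \<in> P\<close> to \<open>q \<in> Q\<close>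
  within \<open>ball z r\<close> is a crosscut. Both of its sides reach the circle of radius \<open>s\<close>, as otherwise \<open>P\<close>, \<open>Q\<close> and
  the segment would separate the plane locally at its midpoint, contrary to Janiszewski's theorem.
\<close>

lemma separated_near_point:
  assumes z: "z \<in> K" and r: "0 < r" "r < s"
    and x: "x \<in> K" "dist z x < r" "x \<notin> connected_component_set (K \<inter> cball z s) z"
  obtains w w' where "dist z w = s" "dist z w' = s" "w \<notin> K" "w' \<notin> K"
    "\<not> joined (cball z r) w w'"
proof -
  let ?S = "K \<inter> cball z s"
  have cS: "compact ?S" using compact_K by (intro compact_Int_closed) auto
  have zS: "z \<in> ?S" using z r by simp
  have comp: "connected_component_set ?S z \<in> components ?S" using zS by (intro componentsI)
  have "compact (connected_component_set ?S z)"
    using cS comp closed_components compact_imp_closed compact_components by blast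
  \<comment> \<open>Sura-Bura: a component of a compact set has a clopen neighbourhood within any
    open set around it, here \<open>- {x}\<close>.\<close>
  then obtain P where P: "openin (top_of_set ?S) P" "compact P" "connected_component_set ?S z \<subseteq> P" "P \<subseteq> - {x}"
    using Sura_Bura_clopen_subset[OF closed_imp_locally_compact[OF compact_imp_closed[OF cS]] comp, of "- {x}"] x(3) by auto
  define Q where "Q = ?S - P"
  have "closedin (top_of_set ?S) Q" unfolding Q_def using P(1) by (simp add: closedin_diff)
  then have Qc: "compact Q" using cS closedin_compact by blast
  have PS: "P \<subseteq> ?S" using P(1) openin_imp_subset by auto
  have zP: "z \<in> P" using P(3) zS connected_component_refl_eq[of ?S z] by auto
  have xQ: "x \<in> Q" using x r P(4) by (auto simp: Q_def)
  have PQ: "P \<inter> Q = {}" "P \<union> Q = ?S" using PS by (auto simp: Q_def)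
  let ?L = "closed_segment z x"
  have L: "?L \<subseteq> ball z r" using x(2) r by (intro closed_segment_subset) auto
  have "compact (P \<inter> ?L)" "compact (Q \<inter> ?L)" using P(2) Qc by (auto intro: compact_Int)
  \<comment> \<open>For a closest pair on the segment from \<open>z\<close> to \<open>x\<close>, no
    point of \<open>K\<close> lies strictly between \<open>p\<close> and \<open>q\<close>.\<close>
  then obtain p q where pq: "p \<in> P \<inter> ?L" "q \<in> Q \<inter> ?L" "dist p q = setdist (P \<inter> ?L) (Q \<inter> ?L)"
    using setdist_compact_closed[of "P \<inter> ?L" "Q \<inter> ?L"] zP xQ compact_imp_closed by (metis IntI empty_iff ends_in_segment)
  have pqL: "closed_segment p q \<subseteq> ?L" using pq by (intro closed_segment_subset) auto
  then have \<sigma>r: "closed_segment p q \<subseteq> ball z r" using L by blast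
  have pqne: "p \<noteq> q" using pq PQ by auto
  have \<sigma>K: "closed_segment p q \<inter> K = {p, q}"
  proof -
    have "y = p \<or> y = q" if y: "y \<in> closed_segment p q" "y \<in> K" for y
    proof (rule ccontr)
      assume "\<not> ?thesis"
      then have o: "y \<in> open_segment p q" using y by (simp add: open_segment_def)
      have "y \<in> P \<union> Q" using y \<sigma>r r PQ(2) by force
      then show False
      proof
        assume "y \<in> P"
        then have "setdist (P \<inter> ?L) (Q \<inter> ?L) \<le> dist y q" using y pqL pq by (intro setdist_le_dist) auto
        then show False using pq(3) by (metis dist_commute dist_in_open_segment not_le o open_segment_commute)
      next
        assume "y \<in> Q"
        then have "setdist (P \<inter> ?L) (Q \<inter> ?L) \<le> dist p y" using y pqL pq by (intro setdist_le_dist) auto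
        then show False using pq(3) by (metis dist_commute dist_in_open_segment not_le o)
      qed
    qed
    moreover have "Q \<subseteq> K" by (auto simp: Q_def)
    ultimately show ?thesis using pq PS by auto
  qed
  define m where "m = midpoint p q"
  define v where "v = q - p"
  have v: "v \<noteq> 0" using pqne by (simp add: v_def)
  have m\<sigma>: "m \<in> closed_segment p q" by (simp add: m_def)
  have mpq: "m \<noteq> p" "m \<noteq> q" using pqne by (auto simp: m_def)
  then have "m \<in> ball z r - K" using \<sigma>K m\<sigma> \<sigma>r by blast
  moreover have "open (ball z r - K)" using closed_K by (simp add: open_Diff)
  ultimately obtain e0 where e0: "e0 > 0" "ball m e0 \<subseteq> ball z r - K" using open_contains_ball by blast
  define e where "e = min e0 (norm v / 2)"
  have e: "0 < e" "e \<le> norm v / 2" "ball m e \<subseteq> ball z r - K" using e0 v by (auto simp: e_def)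
  define \<eta> where "\<eta> = e / (2 * norm v)"
  have \<eta>: "0 < \<eta>" "\<eta> * norm v < e" using e(1) v by (auto simp: \<eta>_def field_simps)
  define g1 where "g1 = m + \<eta> *\<^sub>R (\<i> * v)"
  define g2 where "g2 = m - \<eta> *\<^sub>R (\<i> * v)"
  have gball: "g1 \<in> ball m e" "g2 \<in> ball m e" using \<eta> by (auto simp: g1_def g2_def dist_norm norm_mult)
  let ?X = "K \<union> closed_segment p q"
  have sep: "\<not> connected_component (- ?X) g1 g2"
  proof (rule segment_cut_separates[OF pqne \<sigma>K, folded m_def v_def])
    show "0 < e" "e \<le> norm v / 2" "ball m e \<inter> K = {}" "g1 \<in> ball m e" "g2 \<in> ball m e" using e gball by auto
    have "(g1 - m) / v = of_real \<eta> * \<i>" "(g2 - m) / v = - of_real \<eta> * \<i>"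
      using v by (auto simp: g1_def g2_def scaleR_conv_of_real)
    then show "Im ((g1 - m) / v) > 0" "Im ((g2 - m) / v) < 0" using \<eta>(1) by simp_all
  qed
  \<comment> \<open>\<open>P\<close> with one half of the segment and \<open>Q\<close> with the
    other can each be bypassed at \<open>m\<close>. The two sets meet only in \<open>m\<close>, so
    their union can be bypassed too.\<close>
  have byp: "connected_component (- (P \<union> Q \<union> closed_segment p q)) g1 g2"
  proof -
    have 1: "connected_component (- (P \<union> closed_segment p m)) g1 g2"
      unfolding g1_def g2_def m_def v_def
      using e PS \<eta> by (intro midpoint_bypass[OF pqne \<eta>(1)]) (auto simp: m_def v_def)
    have mid: "midpoint q p = m" "p - q = - v" "norm (p - q) = norm v"
      by (auto simp: m_def v_def midpoint_sym norm_minus_commute)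
    have "connected_component (- (Q \<union> closed_segment q (midpoint q p)))
        (midpoint q p + \<eta> *\<^sub>R (\<i> * (p - q))) (midpoint q p - \<eta> *\<^sub>R (\<i> * (p - q)))"
      using e PQ \<eta> pqne by (intro midpoint_bypass) (auto simp: mid)
    then have "connected_component (- (Q \<union> closed_segment q m)) g2 g1"
      unfolding mid by (simp add: g1_def g2_def)
    then have 2: "connected_component (- (Q \<union> closed_segment q m)) g1 g2" by (rule connected_component_sym)
    have halves: "closed_segment p m \<union> closed_segment q m = closed_segment p q"
      using m\<sigma> Un_closed_segment[of m p q] by (simp add: closed_segment_commute)
    have int: "closed_segment p m \<inter> closed_segment q m = {m}"
      using m\<sigma> Int_closed_segment[of m p q] by (simp add: closed_segment_commute)
    have sub: "closed_segment p m \<subseteq> closed_segment p q" "closed_segment q m \<subseteq> closed_segment p q"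
      using halves by blast+
    have "q \<notin> closed_segment p m" "p \<notin> closed_segment q m" using int mpq by (metis IntI ends_in_segment(1) singletonD)+
    moreover have "P \<inter> closed_segment q m \<subseteq> {p, q}" "closed_segment p m \<inter> Q \<subseteq> {p, q}"
      using sub \<sigma>K PS unfolding Q_def by fast+
    moreover have "q \<notin> P" "p \<notin> Q" using PQ(1) pq by auto
    ultimately have "P \<inter> closed_segment q m = {}" "closed_segment p m \<inter> Q = {}" by auto
    then have "(P \<union> closed_segment p m) \<inter> (Q \<union> closed_segment q m) = {m}" using PQ(1) int by blast
    then have "connected_component (- ((P \<union> closed_segment p m) \<union> (Q \<union> closed_segment q m))) g1 g2"
      using Janiszewski[OF _ _ _ 1 2] P(2) Qc by (simp add: compact_Un compact_imp_closed closed_Un)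
    moreover have "(P \<union> closed_segment p m) \<union> (Q \<union> closed_segment q m) = P \<union> Q \<union> closed_segment p q"
      using halves by blast
    ultimately show ?thesis by simp
  qed
  \<comment> \<open>A component staying within \<open>ball z s\<close> has its frontier in
    \<open>P\<close>, \<open>Q\<close> and the segment; but a connected set from \<open>g\<close> to
    \<open>g'\<close> off these has to cross that frontier.\<close>
  have reach: "\<exists>w. dist z w = s \<and> connected_component (- ?X) g w"
    if g: "g \<in> ball m e" "g' \<in> ball m e" "\<not> connected_component (- ?X) g g'"
      "connected_component (- (P \<union> Q \<union> closed_segment p q)) g g'" for g g'
  proof (rule ccontr)
    assume no: "\<not> ?thesis"
    let ?G = "connected_component_set (- ?X) g"
    have "g \<in> - (P \<union> Q \<union> closed_segment p q)" using g(4) connected_component_in by blast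
    then have gG: "g \<in> ?G" using g(1) e(3) by (auto simp: connected_component_refl_eq)
    have gs: "g \<in> ball z s" using g(1) e(3) r(2) by force
    have "?G \<subseteq> ball z s"
    proof (rule ccontr)
      assume "\<not> ?thesis"
      then obtain y where y: "y \<in> ?G" "dist z y \<ge> s" by force
      have "connected (dist z ` ?G)" by (intro connected_continuous_image continuous_intros) simp
      then have "s \<in> dist z ` ?G"
        using connectedD_interval[of "dist z ` ?G" "dist z g" "dist z y" s] gG gs y by auto
      then show False using no by auto
    qed
    then have "closure ?G \<subseteq> cball z s" by (metis ball_subset_cball closed_cball closure_minimal order_trans)
    moreover have "frontier ?G \<subseteq> ?X"
      using gG g(1) frontier_of_components_closed_complement[of ?X ?G] closed_K
      by (metis closed_Un closed_segment componentsI connected_component_in mem_Collect_eq)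
    ultimately have fr: "frontier ?G \<subseteq> P \<union> Q \<union> closed_segment p q"
      using PQ(2) by (auto simp: frontier_def)
    obtain T where T: "connected T" "T \<subseteq> - (P \<union> Q \<union> closed_segment p q)" "g \<in> T" "g' \<in> T"
      using g(4) by (auto simp: connected_component_def)
    have "T \<inter> frontier ?G \<noteq> {}"
      using T gG g(3) by (intro connected_Int_frontier[OF T(1)]) auto
    then show False using T(2) fr by blast
  qed
  obtain w where w: "dist z w = s" "connected_component (- ?X) g1 w"
    using reach[OF gball sep byp] by blast
  obtain w' where w': "dist z w' = s" "connected_component (- ?X) g2 w'"
    using reach[OF gball(2,1)] sep byp connected_component_sym by blast
  have "\<not> joined (cball z r) w w'"
  proof
    assume "joined (cball z r) w w'"
    moreover have "- (K \<union> cball z r) \<subseteq> - ?X" using \<sigma>r ball_subset_cball by blast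
    ultimately have "connected_component (- ?X) w w'" by (rule connected_component_of_subset)
    then show False using sep w(2) w'(2) by (meson connected_component_sym connected_component_trans)
  qed
  moreover have "w \<notin> K" "w' \<notin> K" using w w' connected_component_in by blast+
  ultimately show ?thesis using that w(1) w'(1) by blast
qed

text \<open>The connected neighbourhood \<open>N\<close> need not be open; it only has to contain a
  relative ball around \<open>z\<close>.\<close>

definition loc_conn_at :: "complex \<Rightarrow> bool" where
  "loc_conn_at z \<longleftrightarrow>
     (\<forall>\<epsilon>>0. \<exists>\<delta>>0. \<exists>N. connected N \<and> K \<inter> ball z \<delta> \<subseteq> N \<and> N \<subseteq> K \<inter> ball z \<epsilon>)"

lemma infdist_tendsto_zeroI:
  fixes u :: "nat \<Rightarrow> complex"
  assumes "bounded (range u)" and lim: "\<And>q l. strict_mono (q :: nat \<Rightarrow> nat) \<Longrightarrow> (u \<circ> q) \<longlonglongrightarrow> l \<Longrightarrow> l \<in> K"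
  shows "(\<lambda>n. infdist (u n) K) \<longlonglongrightarrow> 0"
proof (rule ccontr)
  assume "\<not> ?thesis"
  then obtain \<eta> where \<eta>: "\<eta> > 0" "\<And>N. \<exists>n\<ge>N. \<eta> \<le> infdist (u n) K"
    by (auto simp: LIMSEQ_iff not_less infdist_nonneg)
  define A where "A = {n. \<eta> \<le> infdist (u n) K}"
  have A: "infinite A" using \<eta>(2) by (auto simp: A_def infinite_nat_iff_unbounded_le)
  have "bounded (range (u \<circ> enumerate A))" using assms(1) by (rule bounded_subset) auto
  then obtain l q where q: "strict_mono (q :: nat \<Rightarrow> nat)" "((u \<circ> enumerate A) \<circ> q) \<longlonglongrightarrow> l"
    using bounded_imp_convergent_subsequence by blast
  then have "l \<in> K"
    using lim[of "enumerate A \<circ> q" l] strict_mono_enumerate[OF A] by (auto simp: o_assoc strict_mono_o)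
  moreover have "(\<lambda>n. infdist (((u \<circ> enumerate A) \<circ> q) n) K) \<longlonglongrightarrow> infdist l K"
    by (intro tendsto_infdist q)
  moreover have "\<eta> \<le> infdist (((u \<circ> enumerate A) \<circ> q) n) K" for n
    using enumerate_in_set[OF A, of "q n"] by (simp add: A_def)
  ultimately have "\<eta> \<le> 0" using LIMSEQ_le_const[of _ "infdist l K" \<eta>] by auto
  then show False using \<eta> by simp
qed

text \<open>A limit point off \<open>K\<close> would lie on the circle of radius
  \<open>s > r\<close>; a ball around it, free of \<open>K\<close> and of the disc, would join two
  of the points.\<close>

lemma separated_sequence_tendsto:
  fixes y :: "nat \<Rightarrow> complex"
  assumes "0 < r" "r < s" and y: "\<And>k. dist z (y k) = s"
    and sep: "\<And>k l. k \<noteq> l \<Longrightarrow> \<not> joined (cball z r) (y k) (y l)"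
  shows "(\<lambda>n. infdist (y n) K) \<longlonglongrightarrow> 0"
proof (rule infdist_tendsto_zeroI)
  have "range y \<subseteq> cball z s" using y by auto
  then show "bounded (range y)" using bounded_cball bounded_subset by blast
  fix q l assume q: "strict_mono (q :: nat \<Rightarrow> nat)" "(y \<circ> q) \<longlonglongrightarrow> l"
  show "l \<in> K"
  proof (rule ccontr)
    assume "l \<notin> K"
    have "(\<lambda>n. dist z ((y \<circ> q) n)) \<longlonglongrightarrow> dist z l" by (intro tendsto_intros q)
    then have "(\<lambda>n::nat. s) \<longlonglongrightarrow> dist z l" using y by simp
    then have "dist z l = s" by (rule LIMSEQ_unique[OF _ tendsto_const])
    then have "l \<in> - (K \<union> cball z r)" using \<open>l \<notin> K\<close> assms(2) by auto
    moreover have "open (- (K \<union> cball z r))" using closed_K by (intro open_Compl closed_Un) auto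
    ultimately obtain e where e: "e > 0" "ball l e \<subseteq> - (K \<union> cball z r)" using open_contains_ball by blast
    have "\<forall>\<^sub>F n in sequentially. dist ((y \<circ> q) n) l < e" using q(2) e(1) by (rule tendstoD)
    then obtain n where "\<And>m. m \<ge> n \<Longrightarrow> y (q m) \<in> ball l e"
      by (auto simp: eventually_sequentially dist_commute)
    then have "y (q n) \<in> ball l e" "y (q (Suc n)) \<in> ball l e" by auto
    then have "joined (cball z r) (y (q n)) (y (q (Suc n)))"
      unfolding connected_component_def using e(2) connected_ball by blast
    moreover have "q n \<noteq> q (Suc n)" using q(1) by (simp add: strict_mono_eq)
    ultimately show False using sep by blast
  qed
qed

text \<open>A limit point off \<open>K\<close> reaches infinity while staying farther than some
  \<open>\<eta>\<close> from \<open>K\<close>, and so do all points near it. Sets within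
  \<open>\<eta>\<close> of \<open>K\<close> cannot capture those.\<close>

lemma captured_sequence_tendsto:
  fixes u :: "nat \<Rightarrow> complex"
  assumes "bounded (range u)"
    and E: "\<And>k. \<kappa> k \<in> K" "\<And>k. E k \<subseteq> cball (\<kappa> k) (\<epsilon> k)" "\<epsilon> \<longlonglongrightarrow> 0"
    and cap: "\<And>k. u k \<notin> far_side (E k)"
  shows "(\<lambda>n. infdist (u n) K) \<longlonglongrightarrow> 0"
proof (rule infdist_tendsto_zeroI[OF assms(1)])
  fix q l assume q: "strict_mono (q :: nat \<Rightarrow> nat)" "(u \<circ> q) \<longlonglongrightarrow> l"
  show "l \<in> K"
  proof (rule ccontr)
    assume "l \<notin> K"
    then obtain \<eta> where \<eta>: "\<eta> > 0" "l \<in> outside {x. infdist x K \<le> \<eta>}" using escapes_neighbourhood by blast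
    have "open (outside {x. infdist x K \<le> \<eta>})"
      using compact_infdist_le compact_imp_closed by (intro open_outside) blast
    then have "\<forall>\<^sub>F n in sequentially. (u \<circ> q) n \<in> outside {x. infdist x K \<le> \<eta>}"
      using q(2) \<eta>(2) topological_tendstoD by blast
    moreover have "\<forall>\<^sub>F n in sequentially. (\<epsilon> \<circ> q) n < \<eta>"
      using LIMSEQ_subseq_LIMSEQ[OF E(3) q(1)] \<eta>(1) by (rule order_tendstoD)
    ultimately have "\<forall>\<^sub>F n in sequentially. False"
    proof eventually_elim
      case (elim n)
      have "infdist x K \<le> \<eta>" if "x \<in> E (q n)" for x
        using infdist_le[OF E(1)[of "q n"], of x] E(2)[of "q n"] that elim(2) by (auto simp: dist_commute)
      moreover have "infdist x K \<le> \<eta>" if "x \<in> K" for x using that \<eta>(1) by simp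
      ultimately have "K \<union> E (q n) \<subseteq> {x. infdist x K \<le> \<eta>}" by blast
      then have "u (q n) \<in> far_side (E (q n))" using elim(1) outside_mono[of "K \<union> E (q n)"] by auto
      then show False using cap by blast
    qed
    then show False by simp
  qed
qed

text \<open>
  With only finitely many components meeting the circle, all of them would merge when the disc of radius \<open>r\<close> is
  shrunk, as the complement of \<open>K\<close> is connected.
\<close>

lemma infinitely_many_separated:
  assumes z: "z \<in> K" and r: "0 < r" "r < s"
    and sep: "\<And>r. 0 < r \<Longrightarrow> r < s \<Longrightarrow> \<exists>w w'. dist z w = s \<and> dist z w' = s \<and> w \<notin> K \<and> w' \<notin> K \<and>
        \<not> joined (cball z r) w w'"
  obtains y :: "nat \<Rightarrow> complex" where "\<And>k. dist z (y k) = s" "\<And>k. y k \<notin> K"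
    "\<And>k l. k \<noteq> l \<Longrightarrow> \<not> joined (cball z r) (y k) (y l)"
proof -
  define W where "W = {w. dist z w = s \<and> w \<notin> K}"
  define cc where "cc w = connected_component_set (- (K \<union> cball z r)) w" for w
  have Wr: "w \<in> - (K \<union> cball z r)" if "w \<in> W" for w using that r by (auto simp: W_def)
  have "infinite (cc ` W)"
  proof
    assume "finite (cc ` W)"
    then obtain F where F: "F \<subseteq> W" "finite F" "cc ` W = cc ` F" by (meson finite_subset_image order_refl)
    have "\<exists>\<eta>>0. f \<in> far_side (cball z \<eta>)" if "f \<in> F" for f
      using escapes_small_cball[of f z] z that F(1) by (auto simp: W_def)
    then obtain h where h: "\<And>f. f \<in> F \<Longrightarrow> h f > 0 \<and> f \<in> far_side (cball z (h f))" by metis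
    \<comment> \<open>One representative \<open>f\<close> for each component suffices: a point
      joined to \<open>f\<close> off the disc of radius \<open>r\<close> is joined to it off the
      smaller disc as well.\<close>
    define \<eta> where "\<eta> = Min (insert r (h ` F))"
    have \<eta>: "\<eta> > 0" "\<eta> \<le> r" "\<And>f. f \<in> F \<Longrightarrow> \<eta> \<le> h f" using F(2) h r by (auto simp: \<eta>_def)
    have out: "w \<in> far_side (cball z \<eta>)" if w: "w \<in> W" for w
    proof -
      obtain f where f: "f \<in> F" "cc w = cc f" using F(3) w by blast
      have "w \<in> cc f" using f(2) Wr[OF w] unfolding cc_def by (metis connected_component_refl_eq mem_Collect_eq)
      then have 1: "joined (cball z r) f w" by (simp add: cc_def)
      have "- (K \<union> cball z r) \<subseteq> - (K \<union> cball z \<eta>)" using \<eta>(2) by auto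
      then have 2: "joined (cball z \<eta>) f w" using 1 connected_component_of_subset by blast
      have "K \<union> cball z \<eta> \<subseteq> K \<union> cball z (h f)" using \<eta>(3)[OF f(1)] by auto
      then have "f \<in> far_side (cball z \<eta>)" using h[OF f(1)] outside_mono by blast
      then show ?thesis using 2 outside_same_component by blast
    qed
    obtain w w' where w: "w \<in> W" "w' \<in> W" "\<not> joined (cball z \<eta>) w w'"
      using sep[of \<eta>] \<eta> r by (auto simp: W_def)
    have "connected (far_side (cball z \<eta>))"
      using compact_K by (intro connected_outside_compact compact_Un) auto
    then have "joined (cball z \<eta>) w w'"
      unfolding connected_component_def using out[OF w(1)] out[OF w(2)] outside_no_overlap
      by (intro exI[of _ "far_side (cball z \<eta>)"]) blast
    then show False using w(3) by blast
  qed
  then obtain f :: "nat \<Rightarrow> complex set" where f: "inj f" "range f \<subseteq> cc ` W"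
    using infinite_countable_subset by blast
  then have "\<forall>k. \<exists>y. y \<in> W \<and> cc y = f k" by (metis image_iff rangeI subsetD)
  then obtain y where y: "\<And>k. y k \<in> W" "\<And>k. cc (y k) = f k" by metis
  have "\<not> joined (cball z r) (y k) (y l)" if "k \<noteq> l" for k l
  proof
    assume "joined (cball z r) (y k) (y l)"
    then have "f k = f l" unfolding y(2)[symmetric] cc_def using connected_component_eq by blast
    then show False using f(1) that by (auto dest: injD)
  qed
  then show ?thesis using that y(1) by (auto simp: W_def)
qed

text \<open>For each radius, infinitely many separated points approach \<open>K\<close>, so two of
  them are captured by one small separator. A chain is fitted to the first members of these pairs,
  and the second members follow by \<open>chain_captures_companion\<close>.\<close>

lemma not_loc_conn_chain:
  assumes z: "z \<in> K" "\<not> loc_conn_at z"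
  obtains C w w' s and r :: "nat \<Rightarrow> real" where "chain C" "0 < s"
    "\<And>k. dist z (w k) = s" "\<And>k. dist z (w' k) = s" "\<And>k. w k \<notin> K" "\<And>k. w' k \<notin> K"
    "(\<lambda>k. infdist (w k) K) \<longlonglongrightarrow> 0" "(\<lambda>k. infdist (w' k) K) \<longlonglongrightarrow> 0"
    "\<And>n. \<forall>\<^sub>F k in sequentially. w k \<in> near_side (C n)" "\<And>n. \<forall>\<^sub>F k in sequentially. w' k \<in> near_side (C n)"
    "r \<longlonglongrightarrow> 0" "\<And>k. \<not> joined (cball z (r k)) (w k) (w' k)"
proof -
  obtain \<epsilon> where \<epsilon>: "\<epsilon> > 0" "\<And>\<delta> N. \<delta> > 0 \<Longrightarrow> connected N \<Longrightarrow> K \<inter> ball z \<delta> \<subseteq> N \<Longrightarrow> \<not> N \<subseteq> K \<inter> ball z \<epsilon>"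
    using z(2) unfolding loc_conn_at_def by blast
  define s where "s = \<epsilon> / 2"
  have s: "s > 0" using \<epsilon> by (simp add: s_def)
  define N where "N = connected_component_set (K \<inter> cball z s) z"
  have "N \<subseteq> K \<inter> cball z s" unfolding N_def by (rule connected_component_subset)
  moreover have "cball z s \<subseteq> ball z \<epsilon>" using \<epsilon> by (auto simp: s_def)
  ultimately have Nsub: "N \<subseteq> K \<inter> ball z \<epsilon>" by blast
  have "\<exists>x. x \<in> K \<and> dist z x < r \<and> x \<notin> N" if "r > 0" for r
  proof -
    have "connected N" unfolding N_def by simp
    then have "\<not> K \<inter> ball z r \<subseteq> N" using \<epsilon>(2)[OF that] Nsub by blast
    then show ?thesis by auto
  qed
  then have sep: "\<exists>w w'. dist z w = s \<and> dist z w' = s \<and> w \<notin> K \<and> w' \<notin> K \<and>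
        \<not> joined (cball z r) w w'" if "0 < r" "r < s" for r
    using separated_near_point[OF z(1) that] that unfolding N_def by metis
  \<comment> \<open>\<open>n + 2\<close> makes the radius of the disc smaller than \<open>s\<close>
    already for \<open>n = 0\<close>.\<close>
  define good where "good n p \<longleftrightarrow> (case p of (E, \<kappa>, u, v) \<Rightarrow> compact E \<and> connected (E - K) \<and> \<kappa> \<in> K \<and> E \<subseteq> cball \<kappa> (1 / real (Suc n)) \<and>
      dist z u = s \<and> dist z v = s \<and> u \<notin> K \<and> v \<notin> K \<and> u \<notin> far_side E \<and> v \<notin> far_side E \<and>
      \<not> joined (cball z (s / real (n + 2))) u v)" for n p
  have "\<exists>p. good n p" for n
  proof -
    have r: "0 < s / real (n + 2)" "s / real (n + 2) < s" using s by (auto simp: field_simps add_pos_nonneg)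
    obtain y :: "nat \<Rightarrow> complex" where y: "\<And>k. dist z (y k) = s" "\<And>k. y k \<notin> K"
      "\<And>k l. k \<noteq> l \<Longrightarrow> \<not> joined (cball z (s / real (n + 2))) (y k) (y l)"
      using infinitely_many_separated[OF z(1) r sep] by metis
    have lim: "(\<lambda>k. infdist (y k) K) \<longlonglongrightarrow> 0" by (rule separated_sequence_tendsto[OF r y(1) y(3)])
    obtain E \<kappa> where E: "compact E" "connected (E - K)" "E - K \<noteq> {}" "\<kappa> \<in> K" "E \<subseteq> cball \<kappa> (1 / real (Suc n))"
      "infinite {k. y k \<notin> far_side E}"
      using small_separator[OF y(2) lim, of "1 / real (Suc n)"] by auto
    obtain k where k: "y k \<notin> far_side E" using infinite_imp_nonempty[OF E(6)] by blast
    obtain l where l: "l > k" "y l \<notin> far_side E" using iffD1[OF infinite_nat_iff_unbounded E(6)] by blast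
    have "k \<noteq> l" using l by simp
    then show ?thesis using E y k l by (intro exI[of _ "(E, \<kappa>, y k, y l)"]) (auto simp: good_def)
  qed
  then obtain p where p: "\<And>n. good n (p n)" by metis
  define E where "E n = fst (p n)" for n
  define \<kappa> where "\<kappa> n = fst (snd (p n))" for n
  define u where "u n = fst (snd (snd (p n)))" for n
  define v where "v n = snd (snd (snd (p n)))" for n
  define \<rho> where "\<rho> n = s / real (n + 2)" for n
  define \<epsilon>' where "\<epsilon>' n = 1 / real (Suc n)" for n
  have P: "compact (E n)" "connected (E n - K)" "\<kappa> n \<in> K" "E n \<subseteq> cball (\<kappa> n) (\<epsilon>' n)"
      "dist z (u n) = s" "dist z (v n) = s" "u n \<notin> K" "v n \<notin> K" "u n \<notin> far_side (E n)" "v n \<notin> far_side (E n)"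
      "\<not> joined (cball z (\<rho> n)) (u n) (v n)" for n
    using p[of n] by (auto simp: good_def E_def \<kappa>_def u_def v_def \<rho>_def \<epsilon>'_def split: prod.splits)
  have \<epsilon>': "\<epsilon>' \<longlonglongrightarrow> 0" using LIMSEQ_inverse_real_of_nat by (simp add: \<epsilon>'_def[abs_def] inverse_eq_divide)
  have \<rho>: "\<rho> \<longlonglongrightarrow> 0"
  proof -
    have "(\<lambda>n. s * inverse (real (Suc (Suc n)))) \<longlonglongrightarrow> s * 0"
      using LIMSEQ_Suc[OF LIMSEQ_inverse_real_of_nat] by (intro tendsto_mult_left)
    then show ?thesis by (simp add: \<rho>_def[abs_def] divide_inverse)
  qed
  have "range u \<subseteq> cball z s" "range v \<subseteq> cball z s" using P by auto
  then have "bounded (range u)" "bounded (range v)" using bounded_cball bounded_subset by blast+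
  then have lim: "(\<lambda>n. infdist (u n) K) \<longlonglongrightarrow> 0" "(\<lambda>n. infdist (v n) K) \<longlonglongrightarrow> 0"
    using captured_sequence_tendsto[OF _ P(3) P(4) \<epsilon>'] P(9,10) by blast+
  obtain r C where r: "strict_mono (r :: nat \<Rightarrow> nat)" "chain C"
    "\<And>n. \<forall>\<^sub>F j in sequentially. u (r j) \<in> near_side (C n)"
    using chain_subsequence[OF P(7) lim(1)] by blast
  have "\<forall>\<^sub>F k in sequentially. v (r k) \<in> near_side (C n)" for n
  proof (rule chain_captures_companion[OF r(2,3)])
    show "(\<lambda>k. \<epsilon>' (r k)) \<longlonglongrightarrow> 0" using LIMSEQ_subseq_LIMSEQ[OF \<epsilon>' r(1)] by (simp add: o_def)
  qed (fact P)+
  moreover have "(\<lambda>k. infdist (u (r k)) K) \<longlonglongrightarrow> 0" "(\<lambda>k. infdist (v (r k)) K) \<longlonglongrightarrow> 0" "(\<lambda>k. \<rho> (r k)) \<longlonglongrightarrow> 0"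
    using LIMSEQ_subseq_LIMSEQ[OF lim(1) r(1)] LIMSEQ_subseq_LIMSEQ[OF lim(2) r(1)] LIMSEQ_subseq_LIMSEQ[OF \<rho> r(1)]
    by (simp_all add: o_def)
  ultimately show ?thesis
    using that[of C s "u \<circ> r" "v \<circ> r" "\<rho> \<circ> r"] r(2,3) s P by (simp add: o_def)
qed

text \<open>Janiszewski's theorem needs \<open>closure N\<close> with the disc to meet
  \<open>K \<union> C\<close> in a connected set, which a crosscut passing through the rim of the
  disc may spoil. A small crosscut is harmless for one of two discs: it lies in the one of radius
  \<open>\<theta>\<close> or misses the one of radius \<open>\<rho>\<close>.\<close>

lemma joined_off_small_cball:
  assumes "loc_conn_at z" "\<epsilon> > 0"
  obtains \<rho> where "\<rho> > 0" "\<And>C p q c. \<lbrakk>cut C; C \<subseteq> ball c \<rho>; p \<in> near_side C; q \<in> near_side C;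
      dist z p \<ge> \<epsilon>; dist z q \<ge> \<epsilon>\<rbrakk> \<Longrightarrow> connected_component (- (K \<union> C \<union> cball z \<rho>)) p q"
proof -
  obtain \<delta> N where N: "\<delta> > 0" "connected N" "K \<inter> ball z \<delta> \<subseteq> N" "N \<subseteq> K \<inter> ball z (\<epsilon> / 2)"
    using assms unfolding loc_conn_at_def by (metis half_gt_zero)
  define \<theta> where "\<theta> = min \<delta> \<epsilon> / 2"
  \<comment> \<open>A set in a ball of radius \<open>\<rho>\<close> with one point within
    \<open>\<rho>\<close> of \<open>z\<close> lies within \<open>3 * \<rho>\<close>, which is less
    than \<open>\<theta>\<close>.\<close>
  define \<rho> where "\<rho> = \<theta> / 4"
  have \<theta>: "0 < \<theta>" "\<theta> < \<delta>" "\<theta> < \<epsilon>" using N(1) assms(2) by (auto simp: \<theta>_def)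
  have main: "connected_component (- (K \<union> C \<union> cball z t)) p q"
    if C: "cut C" "p \<in> near_side C" "q \<in> near_side C" "dist z p \<ge> \<epsilon>" "dist z q \<ge> \<epsilon>"
      and t: "0 < t" "t \<le> \<theta>" "C \<inter> cball z t = {} \<or> C \<subseteq> cball z t" for C p q t
  proof -
    \<comment> \<open>\<open>T\<close> meets \<open>K\<close> exactly in \<open>closure N\<close>,
      and it lies in \<open>ball z \<epsilon>\<close>, so that \<open>p\<close> and \<open>q\<close>
      are joined around it.\<close>
    define T where "T = closure N \<union> cball z t"
    have clN: "closure N \<subseteq> K \<inter> cball z (\<epsilon> / 2)"
      using N(4) closed_K by (intro closure_minimal) (auto intro: closed_Int)
    have N': "K \<inter> cball z t \<subseteq> N" using N(3) t(2) \<theta> by auto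
    have KT: "K \<inter> T = closure N" using clN N' closure_subset[of N] unfolding T_def by blast
    have KC: "(K \<union> C) \<inter> T = closure N \<union> (C \<inter> cball z t)"
      using KT clN by (auto simp: T_def)
    have "connected (closure N \<union> (C \<inter> cball z t))"
    proof (cases "C \<inter> cball z t = {}")
      case True then show ?thesis using N(2) by (simp add: connected_imp_connected_closure)
    next
      case False
      then have "C \<subseteq> cball z t" using t(3) by blast
      moreover obtain x where "x \<in> C" "x \<in> K" using cut_meets[OF C(1)] by blast
      ultimately have "x \<in> closure N \<inter> (C \<inter> cball z t)" using N' closure_subset[of N] by blast
      then show ?thesis
        using N(2) connected_cut[OF C(1)] \<open>C \<subseteq> cball z t\<close>
        by (intro connected_Un) (auto simp: connected_imp_connected_closure Int_absorb2)
    qed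
    then have con: "connected ((K \<union> C) \<inter> T)" unfolding KC .
    have "T \<subseteq> cball z (max (\<epsilon> / 2) \<theta>)" using clN t by (auto simp: T_def)
    then have Tb: "T \<subseteq> ball z \<epsilon>" using \<theta> assms(2) by force
    have "- ball z \<epsilon> \<subseteq> outside (ball z \<epsilon>)" by (rule outside_subset_convex) auto
    moreover have "connected (outside (ball z \<epsilon>))" by (intro connected_outside) auto
    moreover have "p \<in> - ball z \<epsilon>" "q \<in> - ball z \<epsilon>" using C(4,5) by auto
    ultimately have 1: "connected_component (- T) p q"
      unfolding connected_component_def using Tb outside_no_overlap[of "ball z \<epsilon>"]
      by (intro exI[of _ "outside (ball z \<epsilon>)"]) blast
    have 2: "joined C p q"
      unfolding connected_component_def using connected_inside_cut[OF C(1)] C(2,3) inside_no_overlap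
      by (intro exI[of _ "near_side C"]) blast
    have "connected_component (- ((K \<union> C) \<union> T)) p q"
      using Janiszewski[OF compact_Un_cut[OF C(1)] _ con 2 1] by (auto simp: T_def)
    moreover have "- ((K \<union> C) \<union> T) \<subseteq> - (K \<union> C \<union> cball z t)" by (auto simp: T_def)
    ultimately show ?thesis using connected_component_of_subset by blast
  qed
  have "connected_component (- (K \<union> C \<union> cball z \<rho>)) p q"
    if C: "cut C" "C \<subseteq> ball c \<rho>" "p \<in> near_side C" "q \<in> near_side C" "dist z p \<ge> \<epsilon>" "dist z q \<ge> \<epsilon>"
    for C p q c
  proof (cases "C \<subseteq> cball z \<theta>")
    case True
    then have "connected_component (- (K \<union> C \<union> cball z \<theta>)) p q" using main[OF C(1,3-6)] \<theta> by blast
    moreover have "- (K \<union> C \<union> cball z \<theta>) \<subseteq> - (K \<union> C \<union> cball z \<rho>)" using \<theta> by (auto simp: \<rho>_def)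
    ultimately show ?thesis using connected_component_of_subset by blast
  next
    case False
    then obtain x where x: "x \<in> C" "dist z x > \<theta>" by force
    have "y \<notin> cball z \<rho>" if "y \<in> C" for y
    proof
      assume "y \<in> cball z \<rho>"
      moreover have "dist c x < \<rho>" "dist c y < \<rho>" using C(2) x that by auto
      ultimately have "dist z x < 3 * \<rho>"
        using dist_triangle[of z x y] dist_triangle3[of y x c] by (simp add: dist_commute)
      then show False using x \<theta> by (simp add: \<rho>_def)
    qed
    then have "C \<inter> cball z \<rho> = {}" by blast
    then show ?thesis using main[OF C(1,3-6), of \<rho>] \<theta> by (auto simp: \<rho>_def)
  qed
  then show ?thesis using that[of \<rho>] \<theta> by (simp add: \<rho>_def)
qed

end

section \<open>From the sphere to the plane\<close>

lemma compact_riemann_sphere: "compact riemann_sphere"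
  by (simp add: riemann_sphere_def)

lemma inner_riemann_sphere:
  assumes "x \<in> riemann_sphere" "y \<in> riemann_sphere"
  shows "x \<bullet> y = 1 - (dist x y)\<^sup>2 / 2" "-1 \<le> x \<bullet> y" "x \<bullet> y \<le> 1"
proof -
  have n: "norm x = 1" "norm y = 1" using assms by (auto simp: riemann_sphere_def)
  show "x \<bullet> y = 1 - (dist x y)\<^sup>2 / 2"
    using n by (simp add: dist_norm dot_norm_neg[of x y])
  have "\<bar>x \<bullet> y\<bar> \<le> 1" using Cauchy_Schwarz_ineq2[of x y] n by simp
  then show "-1 \<le> x \<bullet> y" "x \<bullet> y \<le> 1" by auto
qed

text \<open>The chord has length \<open>2 * sin (\<theta> / 2)\<close>, which is at most the angle
  \<open>\<theta>\<close>.\<close>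

lemma dist_le_spherical_dist:
  assumes "x \<in> riemann_sphere" "y \<in> riemann_sphere"
  shows "dist x y \<le> spherical_dist x y"
proof -
  define \<theta> where "\<theta> = arccos (x \<bullet> y)"
  note xy = inner_riemann_sphere[OF assms]
  have \<theta>: "0 \<le> \<theta>" "cos \<theta> = x \<bullet> y" using xy by (auto simp: \<theta>_def arccos_lbound)
  have "(dist x y)\<^sup>2 = 2 * (1 - cos \<theta>)" using xy(1) \<theta>(2) by simp
  also have "\<dots> = 4 * (sin (\<theta> / 2))\<^sup>2"
    using cos_double_sin[of "\<theta> / 2"] by simp
  also have "\<dots> \<le> 4 * (\<theta> / 2)\<^sup>2"
    using abs_sin_x_le_abs_x[of "\<theta> / 2"] by (intro mult_left_mono) (simp_all only: abs_le_square_iff)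
  finally have "(dist x y)\<^sup>2 \<le> \<theta>\<^sup>2" by (simp add: power2_eq_square)
  then have "dist x y \<le> \<theta>" using \<theta>(1) by (rule power2_le_imp_le)
  then show ?thesis by (simp add: \<theta>_def spherical_dist_def)
qed

lemma dist_le_spherical_diam:
  assumes "X \<subseteq> riemann_sphere" "x \<in> X" "y \<in> X"
  shows "dist x y \<le> spherical_diam X"
proof -
  have "spherical_dist x y \<le> (SUP (x, y) \<in> X \<times> X. spherical_dist x y)"
  proof (rule cSUP_upper2[of _ _ "(x, y)"])
    have "spherical_dist u v \<le> pi" if "u \<in> X" "v \<in> X" for u v
      using inner_riemann_sphere(2,3)[of u v] assms(1) that
      unfolding spherical_dist_def by (intro arccos_ubound) auto
    then show "bdd_above ((\<lambda>(x, y). spherical_dist x y) ` (X \<times> X))"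
      by (intro bdd_aboveI2[of _ _ pi]) (simp only: split_paired_all mem_Sigma_iff case_prod_conv)
  qed (use assms in auto)
  moreover have "dist x y \<le> spherical_dist x y"
    using assms by (intro dist_le_spherical_dist) auto
  moreover have "X \<noteq> {}" using assms by auto
  ultimately show ?thesis by (simp add: spherical_diam_def)
qed

text \<open>\<open>\<eta>\<close> is the chord of the angle \<open>\<epsilon>'\<close>; the bound 1
  keeps this angle in the range where \<open>arccos\<close> inverts \<open>cos\<close>.\<close>

lemma spherical_diam_small:
  assumes "\<epsilon> > 0"
  obtains \<eta> where "\<eta> > 0" "\<And>X. \<lbrakk>X \<subseteq> riemann_sphere; \<And>x y. x \<in> X \<Longrightarrow> y \<in> X \<Longrightarrow> dist x y \<le> \<eta>\<rbrakk>
      \<Longrightarrow> spherical_diam X \<le> \<epsilon>"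
proof -
  define \<epsilon>' where "\<epsilon>' = min \<epsilon> 1"
  have \<epsilon>': "0 < \<epsilon>'" "\<epsilon>' \<le> \<epsilon>" "\<epsilon>' \<le> pi" using assms pi_gt3 by (auto simp: \<epsilon>'_def)
  have "cos \<epsilon>' < cos 0" using \<epsilon>' by (intro cos_monotone_0_pi) auto
  then have c: "cos \<epsilon>' < 1" by simp
  define \<eta> where "\<eta> = sqrt (2 * (1 - cos \<epsilon>'))"
  have \<eta>: "\<eta> > 0" "\<eta>\<^sup>2 = 2 * (1 - cos \<epsilon>')" using c by (auto simp: \<eta>_def)
  have "spherical_diam X \<le> \<epsilon>"
    if X: "X \<subseteq> riemann_sphere" "\<And>x y. x \<in> X \<Longrightarrow> y \<in> X \<Longrightarrow> dist x y \<le> \<eta>" for X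
  proof -
    have "spherical_dist x y \<le> \<epsilon>'" if "x \<in> X" "y \<in> X" for x y
    proof -
      have S: "x \<in> riemann_sphere" "y \<in> riemann_sphere" using that X(1) by auto
      have "(dist x y)\<^sup>2 \<le> \<eta>\<^sup>2" using X(2)[OF that] by (intro power_mono) auto
      then have "cos \<epsilon>' \<le> x \<bullet> y" using inner_riemann_sphere(1)[OF S] \<eta>(2) by simp
      then have "arccos (x \<bullet> y) \<le> arccos (cos \<epsilon>')"
        using inner_riemann_sphere(2,3)[OF S] by (intro arccos_le_arccos) auto
      then show ?thesis using \<epsilon>' by (simp add: spherical_dist_def arccos_cos)
    qed
    then have "spherical_dist x y \<le> \<epsilon>" if "x \<in> X" "y \<in> X" for x y
      using that \<epsilon>'(2) order_trans by blast
    then have "(SUP (x, y) \<in> X \<times> X. spherical_dist x y) \<le> \<epsilon>" if "X \<noteq> {}"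
      using that by (intro cSUP_least) auto
    then show ?thesis using assms by (simp add: spherical_diam_def)
  qed
  then show ?thesis using that \<eta>(1) by blast
qed

text \<open>No formula for the projection is kept: sizes of crosscuts are compared later by uniform
  continuity on compact sets away from the pole.\<close>

lemma punctured_sphere_homeomorphism:
  assumes "c \<in> riemann_sphere"
  obtains h g where "homeomorphism (riemann_sphere - {c}) (UNIV :: complex set) h g"
proof -
  have "(riemann_sphere - {c}) homeomorphic (UNIV :: complex set)"
    unfolding riemann_sphere_def using assms homeomorphic_punctured_affine_sphere_affine[of 1 c 0 UNIV "UNIV :: complex set"]
    by (auto simp: riemann_sphere_def)
  then show ?thesis using that unfolding homeomorphic_def by blast
qed

lemma arc_homeomorphic_image:
  assumes "homeomorphism A B h g" "arc \<gamma>" "path_image \<gamma> \<subseteq> A"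
  shows "arc (h \<circ> \<gamma>)"
proof -
  have "continuous_on (path_image \<gamma>) h"
    using assms(1,3) by (auto simp: homeomorphism_def intro: continuous_on_subset)
  moreover have "inj_on h (path_image \<gamma>)"
    using homeomorphism_apply1[OF assms(1)] assms(3) by (intro inj_on_inverseI[of _ g]) blast
  ultimately show ?thesis using assms(2)
    by (auto simp: arc_def path_image_def intro!: path_continuous_image comp_inj_on)
qed

lemma continuous_on_atLeast_real:
  fixes f :: "real \<Rightarrow> 'a::topological_space"
  assumes "\<And>N :: nat. continuous_on {0..real N} f"
  shows "continuous_on {0..} f"
  unfolding continuous_on_def
proof
  fix x :: real assume x: "x \<in> {0..}"
  obtain N :: nat where N: "x < real N" using reals_Archimedean2 by blast
  have "(f \<longlongrightarrow> f x) (at x within {0..real N})"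
    using assms[of N] x N by (auto simp: continuous_on_def)
  moreover have "at x within {0..real N} = at x within {0..}"
    by (rule at_within_nhd[of x "{..<real N}"]) (use N in auto)
  ultimately show "(f \<longlongrightarrow> f x) (at x within {0..})" by simp
qed

lemma not_accumulates_imp_far:
  fixes w :: "nat \<Rightarrow> complex \<times> real"
  assumes "\<not> seq_accumulates_on w z"
  obtains e N where "e > 0" "\<And>n. n \<ge> N \<Longrightarrow> e \<le> dist (w n) z"
proof -
  have False if ex: "\<And>e N. e > 0 \<Longrightarrow> \<exists>n\<ge>N. dist (w n) z < e"
  proof -
    have "\<exists>k. dist (w k) z < 1 / real (Suc 0)" using ex[of "1 / real (Suc 0)" 0] by auto
    moreover have "\<exists>l. dist (w l) z < 1 / real (Suc (Suc n)) \<and> k < l" for n k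
      using ex[of "1 / real (Suc (Suc n))" "Suc k"] by (auto simp: Suc_le_eq)
    ultimately obtain r where r: "\<And>n. dist (w (r n)) z < 1 / real (Suc n)" "\<And>n. r n < r (Suc n)"
      using dependent_nat_choice[of "\<lambda>n k. dist (w k) z < 1 / real (Suc n)" "\<lambda>n k l. k < l"] by blast
    have "strict_mono r" using r(2) by (simp add: strict_mono_Suc_iff)
    moreover have "(w \<circ> r) \<longlonglongrightarrow> z"
    proof (rule metric_tendsto_imp_tendsto[of "\<lambda>n. 1 / real (Suc n)" 0])
      show "(\<lambda>n. 1 / real (Suc n)) \<longlonglongrightarrow> 0" using LIMSEQ_inverse_real_of_nat by (simp add: inverse_eq_divide)
      show "\<forall>\<^sub>F n in sequentially. dist ((w \<circ> r) n) z \<le> dist (1 / real (Suc n)) 0"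
        using r(1) by (auto intro!: always_eventually less_imp_le)
    qed
    ultimately show False using assms by (auto simp: seq_accumulates_on_def)
  qed
  then show ?thesis using that by (metis not_le)
qed

section \<open>Domains on the sphere and their complements\<close>

text \<open>Projected from a point off \<open>U\<close>, the domain becomes open and connected in
  the plane, where deleting a point does not disconnect it.\<close>

lemma punctured_sphere_domain_connected:
  assumes U: "openin (top_of_set riemann_sphere) U" "connected U" "\<not> riemann_sphere \<subseteq> U"
  shows "connected (U - {b})"
proof -
  obtain a where a: "a \<in> riemann_sphere" "a \<notin> U" using U(3) by blast
  obtain h g where hg: "homeomorphism (riemann_sphere - {a}) (UNIV :: complex set) h g"
    using punctured_sphere_homeomorphism[OF a(1)] .
  have US: "U \<subseteq> riemann_sphere - {a}" using U(1) a openin_imp_subset by auto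
  have "openin (top_of_set (riemann_sphere - {a})) U" using U(1) US by (metis Diff_subset openin_subset_trans)
  then have "open (h ` U)" using homeomorphism_imp_open_map[OF hg] by simp
  moreover have "connected (h ` U)"
    using U(2) US hg by (auto simp: homeomorphism_def intro!: connected_continuous_image intro: continuous_on_subset)
  ultimately have c: "connected (h ` U - {h b})" by (intro connected_open_delete) auto
  have "continuous_on (h ` U - {h b}) g" using hg by (auto simp: homeomorphism_def intro: continuous_on_subset)
  then have "connected (g ` (h ` U - {h b}))" using c by (rule connected_continuous_image)
  moreover have gh: "g (h x) = x" if "x \<in> U" for x using homeomorphism_apply1[OF hg] US that by blast
  have "g ` (h ` U - {h b}) = U - {b} \<or> b \<notin> U"
  proof (cases "b \<in> U")
    case True
    have "x = b" if "x \<in> U" "h x = h b" for x using gh that True by metis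
    then have "h ` U - {h b} = h ` (U - {b})" by auto
    then have "g ` (h ` U - {h b}) = (\<lambda>x. g (h x)) ` (U - {b})" by (simp add: image_image)
    also have "\<dots> = U - {b}" using gh by (simp add: image_def)
    finally show ?thesis by simp
  qed simp
  ultimately show ?thesis using U(2) by auto
qed

text \<open>If the complement split into \<open>A\<close> and \<open>B\<close>, projection from a
  point of \<open>A\<close> would make \<open>B\<close> bounded, so the complement of a simply
  connected open plane set would have a bounded component.\<close>

lemma sphere_complement_connected:
  assumes U: "openin (top_of_set riemann_sphere) U" "simply_connected U"
  shows "connected (riemann_sphere - U)"
proof (rule ccontr)
  assume nc: "\<not> connected (riemann_sphere - U)"
  have "closedin (top_of_set riemann_sphere) (riemann_sphere - U)"
    using U(1) by (simp add: closedin_diff)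
  then have Kc: "compact (riemann_sphere - U)" using compact_riemann_sphere closedin_compact by blast
  then obtain A B where AB: "closed A" "closed B" "A \<noteq> {}" "B \<noteq> {}" "A \<union> B = riemann_sphere - U" "A \<inter> B = {}"
    using nc connected_closed_set[OF compact_imp_closed] by metis
  have AB': "compact A" "compact B"
    using AB Kc by (metis Un_upper1 Un_upper2 compact_Int_closed inf.absorb_iff2)+
  obtain a where a: "a \<in> A" using AB(3) by blast
  have aS: "a \<in> riemann_sphere" "a \<notin> U" using a AB(5) by auto
  obtain h g where hg: "homeomorphism (riemann_sphere - {a}) (UNIV :: complex set) h g"
    using punctured_sphere_homeomorphism[OF aS(1)] .
  have US: "U \<subseteq> riemann_sphere - {a}" using U(1) aS openin_imp_subset by auto
  have "openin (top_of_set (riemann_sphere - {a})) U" using U(1) US by (metis Diff_subset openin_subset_trans)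
  then have oU: "open (h ` U)" using homeomorphism_imp_open_map[OF hg] by simp
  have "U homeomorphic h ` U"
    using homeomorphism_of_subsets[OF hg US] hg unfolding homeomorphic_def by blast
  then have "simply_connected (h ` U)" using U(2) homeomorphic_simply_connected by blast
  then have unb: "\<not> bounded D" if "D \<in> components (- (h ` U))" for D
    using simply_connected_eq_unbounded_complement_components[OF oU] that by blast
  have inj: "inj_on h (riemann_sphere - {a})" using homeomorphism_apply1[OF hg] by (intro inj_on_inverseI[of _ g])
  have himg: "h ` (riemann_sphere - {a}) = UNIV" using hg by (simp add: homeomorphism_def)
  have cov: "- (h ` U) = h ` (A - {a}) \<union> h ` B"
  proof -
    have "- (h ` U) = h ` (riemann_sphere - {a}) - h ` U" using himg by auto
    also have "\<dots> = h ` ((riemann_sphere - {a}) - U)" using inj US by (simp add: inj_on_image_set_diff)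
    also have "(riemann_sphere - {a}) - U = (A - {a}) \<union> B" using AB a by auto
    finally show ?thesis by (simp add: image_Un)
  qed
  have BS: "B \<subseteq> riemann_sphere - {a}" "A - {a} \<subseteq> riemann_sphere - {a}" using AB a by auto
  have hB: "compact (h ` B)"
    using AB'(2) BS hg by (auto simp: homeomorphism_def intro!: compact_continuous_image intro: continuous_on_subset)
  have "closedin (top_of_set (riemann_sphere - {a})) (A - {a})"
    using AB(1) BS(2) by (auto simp: closedin_closed intro!: exI[of _ A])
  then have hA: "closed (h ` (A - {a}))" using homeomorphism_imp_closed_map[OF hg] by simp
  have dis: "h ` (A - {a}) \<inter> h ` B = {}"
    using inj_on_image_Int[OF inj BS(2,1)] AB(6) by auto
  obtain x where x: "x \<in> h ` B" using AB(4) by blast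
  define D where "D = connected_component_set (- (h ` U)) x"
  have D: "D \<in> components (- (h ` U))" unfolding D_def using x cov by (intro componentsI) auto
  have "connected D" "D \<subseteq> h ` (A - {a}) \<union> h ` B" "x \<in> D"
    using in_components_connected[OF D] in_components_subset[OF D] cov x
    by (auto simp: D_def connected_component_refl_eq)
  then have "D \<inter> h ` (A - {a}) = {}"
    using connected_closedD[of D "h ` (A - {a})" "h ` B"] hA hB dis x compact_imp_closed by blast
  then have "D \<subseteq> h ` B" using \<open>D \<subseteq> h ` (A - {a}) \<union> h ` B\<close> by blast
  then have "bounded D" using hB compact_imp_bounded bounded_subset by blast
  then show False using unb[OF D] by simp
qed

section \<open>Transfer of crosscuts and prime ends between sphere and plane\<close>

locale sphere_domain =
  fixes U :: "(complex \<times> real) set" and b :: "complex \<times> real"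
    and h :: "complex \<times> real \<Rightarrow> complex" and g :: "complex \<Rightarrow> complex \<times> real"
  assumes openin_U: "openin (top_of_set riemann_sphere) U" and connected_U: "connected U"
    and simply_connected_U: "simply_connected U" and b_in_U: "b \<in> U"
    and two_points: "\<exists>x \<in> riemann_sphere - U. \<exists>y \<in> riemann_sphere - U. x \<noteq> y"
    and hg: "homeomorphism (riemann_sphere - {b}) UNIV h g"
begin

abbreviation "S \<equiv> riemann_sphere"

lemma U_subset: "U \<subseteq> S" and b_in_S: "b \<in> S"
  using openin_U b_in_U openin_imp_subset by auto

lemma compact_complement: "compact (S - U)"
  using openin_U closedin_compact[OF compact_riemann_sphere] by (simp add: closedin_diff)

lemma gh: "x \<in> S \<Longrightarrow> x \<noteq> b \<Longrightarrow> g (h x) = x" and hg': "h (g y) = y"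
  and g_range: "g y \<in> S - {b}" and h_onto: "h ` (S - {b}) = UNIV"
  and cont_h: "continuous_on (S - {b}) h" and cont_g: "continuous_on UNIV g"
  using hg by (auto simp: homeomorphism_def)

lemma inj_h: "inj_on h (S - {b})"
  using gh by (intro inj_on_inverseI[of _ g]) auto

lemma inj_g: "inj g"
  using hg' by (intro inj_on_inverseI[of _ h])

lemma h_image_eq: "h ` A = g -` A" if "A \<subseteq> S - {b}"
proof -
  have "y \<in> h ` A" if "g y \<in> A" for y using that hg' by (metis image_eqI)
  moreover have "g (h x) = x" if "x \<in> A" for x using gh \<open>A \<subseteq> S - {b}\<close> that by blast
  ultimately show ?thesis by auto
qed

lemma gh_image: "g ` h ` A = A" if "A \<subseteq> S - {b}"
  using gh that by (force simp: image_image)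

lemma hg_image: "h ` g ` A = A"
  using hg' by (force simp: image_image)

lemma complement_subset: "S - U \<subseteq> S - {b}"
  using b_in_U by auto

sublocale plane: plane_continuum "h ` (S - U)"
proof
  show "compact (h ` (S - U))"
    using compact_complement complement_subset cont_h
    by (auto intro!: compact_continuous_image intro: continuous_on_subset)
  show "connected (h ` (S - U))"
    using sphere_complement_connected[OF openin_U simply_connected_U] complement_subset cont_h
    by (auto intro!: connected_continuous_image intro: continuous_on_subset)
  have "- h ` (S - U) = h ` (U - {b})"
  proof -
    have "- h ` (S - U) = h ` (S - {b}) - h ` (S - U)" using h_onto by auto
    also have "\<dots> = h ` ((S - {b}) - (S - U))" using inj_h complement_subset by (simp add: inj_on_image_set_diff)
    also have "(S - {b}) - (S - U) = U - {b}" using U_subset by auto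
    finally show ?thesis .
  qed
  moreover have "connected (h ` (U - {b}))"
    using punctured_sphere_domain_connected[OF openin_U connected_U, of b] two_points U_subset cont_h
    by (auto intro!: connected_continuous_image intro: continuous_on_subset)
  ultimately show "connected (- h ` (S - U))" by simp
  show "\<exists>x\<in>h ` (S - U). \<exists>y\<in>h ` (S - U). x \<noteq> y"
  proof -
    obtain x y where xy: "x \<in> S - U" "y \<in> S - U" "x \<noteq> y" using two_points by blast
    then have "h x \<noteq> h y" using inj_onD[OF inj_h, of x y] complement_subset by blast
    then show ?thesis using xy by blast
  qed
qed

abbreviation "K \<equiv> h ` (S - U)"

lemma g_in_U: "g y \<in> U \<longleftrightarrow> y \<notin> K"
  using g_range[of y] by (auto simp: h_image_eq[OF complement_subset])

lemma h_in_K: "x \<in> S \<Longrightarrow> x \<noteq> b \<Longrightarrow> h x \<in> K \<longleftrightarrow> x \<notin> U"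
  using g_in_U[of "h x"] gh by auto

lemma crosscut_imp_cut:
  assumes "crosscut U C" "b \<notin> C"
  shows "plane.cut (h ` C)" "C \<subseteq> S - {b}"
proof -
  obtain \<gamma> where \<gamma>: "arc \<gamma>" "path_image \<gamma> = C" "C \<subseteq> S" "C \<inter> (S - U) = {pathstart \<gamma>, pathfinish \<gamma>}"
    using assms(1) unfolding crosscut_def by blast
  show sub: "C \<subseteq> S - {b}" using \<gamma>(3) assms(2) by auto
  have "arc (h \<circ> \<gamma>)" using arc_homeomorphic_image[OF hg \<gamma>(1)] \<gamma>(2) sub by simp
  moreover have "path_image (h \<circ> \<gamma>) = h ` C" using \<gamma>(2) by (simp add: path_image_compose)
  moreover have "h ` C \<inter> K = {pathstart (h \<circ> \<gamma>), pathfinish (h \<circ> \<gamma>)}"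
    using inj_on_image_Int[OF inj_h sub complement_subset] \<gamma>(4) by (simp add: pathstart_compose pathfinish_compose)
  ultimately show "plane.cut (h ` C)" unfolding plane.cut_def by blast
qed

lemma cut_imp_crosscut:
  assumes "plane.cut C"
  shows "crosscut U (g ` C)" "b \<notin> g ` C"
proof -
  show "b \<notin> g ` C" using g_range by blast
  obtain \<gamma> where \<gamma>: "arc \<gamma>" "path_image \<gamma> = C" "C \<inter> K = {pathstart \<gamma>, pathfinish \<gamma>}"
    using assms(1) unfolding plane.cut_def by blast
  have "homeomorphism UNIV (S - {b}) g h" using hg homeomorphism_symD by blast
  then have "arc (g \<circ> \<gamma>)" using arc_homeomorphic_image \<gamma>(1) by blast
  moreover have "path_image (g \<circ> \<gamma>) = g ` C" using \<gamma>(2) by (simp add: path_image_compose)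
  moreover have "g ` C \<inter> (S - U) = g ` (C \<inter> K)"
    using image_Int[OF inj_g, of C K] gh_image[OF complement_subset] by simp
  then have "g ` C \<inter> (S - U) = {pathstart (g \<circ> \<gamma>), pathfinish (g \<circ> \<gamma>)}"
    using \<gamma>(3) by (simp add: pathstart_compose pathfinish_compose)
  moreover have "g ` C \<subseteq> S" using g_range by blast
  ultimately show "crosscut U (g ` C)" unfolding crosscut_def by blast
qed

text \<open>The near side, and the far side together with \<open>b\<close>, are connected and make
  up the domain without the crosscut. Hence exactly one component omits \<open>b\<close>, and the
  \<open>THE\<close> in \<open>crosscut_side\<close> is well defined.\<close>

lemma side_eq:
  assumes C: "plane.cut C"
  shows "crosscut_side U b (g ` C) = g ` inside (K \<union> C)"
proof -
  let ?V = "g ` inside (K \<union> C)" and ?O = "g ` outside (K \<union> C)"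
  have cg: "continuous_on A g" for A using cont_g continuous_on_subset by blast
  have "g ` X \<subseteq> U - g ` C" if "X \<inter> (K \<union> C) = {}" for X
    using that g_in_U inj_image_mem_iff[OF inj_g] by blast
  then have Vsub: "?V \<subseteq> U - g ` C" and Osub: "?O \<subseteq> U - g ` C" by simp_all
  have cover: "U - g ` C = insert b (?V \<union> ?O)"
  proof
    show "U - g ` C \<subseteq> insert b (?V \<union> ?O)"
    proof
      fix x assume x: "x \<in> U - g ` C"
      show "x \<in> insert b (?V \<union> ?O)"
      proof (cases "x = b")
        case False
        have xS: "x \<in> S" using x U_subset by blast
        then have "g (h x) = x" using gh False by blast
        moreover have "h x \<notin> K" using x h_in_K[OF xS False] by blast
        moreover have "h x \<notin> C" using x \<open>g (h x) = x\<close> by (metis DiffD2 image_eqI)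
        ultimately have "g (h x) = x" "h x \<notin> K \<union> C" by blast+
        then have "h x \<in> inside (K \<union> C) \<union> outside (K \<union> C)" by simp
        then show ?thesis using \<open>g (h x) = x\<close> by (metis UnCI UnE image_eqI insertCI)
      qed simp
    qed
    show "insert b (?V \<union> ?O) \<subseteq> U - g ` C" using Vsub Osub b_in_U cut_imp_crosscut(2)[OF C] by blast
  qed
  have Vcon: "connected ?V" using plane.connected_inside_cut[OF C] cg by (intro connected_continuous_image)
  have cpt: "compact (K \<union> C)" using plane.compact_Un_cut[OF C] .
  have Ocon: "connected (insert b ?O)"
  proof (rule connected_intermediate_closure)
    show "connected ?O" using connected_outside_compact[OF cpt] cg by (intro connected_continuous_image)
    \<comment> \<open>Away from \<open>b\<close> the sphere is compact and \<open>h\<close> has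
      bounded image, but the far side is unbounded.\<close>
    have "b \<in> closure ?O"
    proof (rule ccontr)
      assume "b \<notin> closure ?O"
      then obtain e where e: "e > 0" "ball b e \<inter> ?O = {}"
        by (metis closure_iff_nhds_not_empty disjoint_iff open_ball centre_in_ball closure_approachable dist_commute mem_ball)
      have "closed (S - ball b e)" using compact_riemann_sphere compact_imp_closed by (intro closed_Diff) auto
      then have "compact (S - ball b e)" using compact_riemann_sphere by (metis Diff_subset compact_Int_closed inf.absorb_iff2)
      moreover have "S - ball b e \<subseteq> S - {b}" using e by auto
      ultimately have "compact (h ` (S - ball b e))"
        using cont_h by (auto intro!: compact_continuous_image intro: continuous_on_subset)
      moreover have "outside (K \<union> C) \<subseteq> h ` (S - ball b e)"
      proof
        fix y assume "y \<in> outside (K \<union> C)"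
        then have "g y \<in> S - ball b e" using e(2) g_range[of y] by auto
        then show "y \<in> h ` (S - ball b e)" using hg'[of y] by (metis image_eqI)
      qed
      ultimately have "bounded (outside (K \<union> C))" using compact_imp_bounded bounded_subset by blast
      then show False using unbounded_outside[OF compact_imp_bounded[OF cpt]] by simp
    qed
    then show "insert b ?O \<subseteq> closure ?O" by (simp add: closure_subset)
    show "?O \<subseteq> insert b ?O" by (rule subset_insertI)
  qed
  have compact_rest: "closed (g ` (K \<union> C \<union> inside (K \<union> C)))"
  proof -
    have eq: "K \<union> C \<union> inside (K \<union> C) = - outside (K \<union> C)" by (rule union_with_inside)
    have "closed (- outside (K \<union> C))" using open_outside[OF compact_imp_closed[OF cpt]] by (rule closed_Compl)
    moreover have "bounded (K \<union> C \<union> inside (K \<union> C))"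
      using compact_imp_bounded[OF cpt] bounded_inside by (metis bounded_Un)
    ultimately have "compact (K \<union> C \<union> inside (K \<union> C))" unfolding eq by (simp add: compact_eq_bounded_closed)
    then show ?thesis using cg by (intro compact_imp_closed compact_continuous_image)
  qed
  have Vcomp: "?V \<in> components (U - g ` C)"
  proof (rule in_components_maximal[THEN iffD2], intro conjI allI impI)
    show "?V \<noteq> {}" using plane.cut_inside_nonempty[OF C] by blast
    show "?V \<subseteq> U - g ` C" by (rule Vsub)
    show "connected ?V" by (rule Vcon)
    fix T assume T: "T \<noteq> {} \<and> ?V \<subseteq> T \<and> T \<subseteq> U - g ` C \<and> connected T"
    have "open (inside (K \<union> C))" using cpt compact_imp_closed open_inside by blast
    then have "openin (top_of_set (S - {b})) ?V"
      using homeomorphism_imp_open_map[OF homeomorphism_symD[OF hg]] by simp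
    moreover have "openin (top_of_set S) (S - {b})" by (simp add: openin_delete)
    ultimately have "openin (top_of_set S) ?V" using openin_trans by blast
    moreover have "?V \<subseteq> T" "T \<subseteq> S" using T U_subset by fast+
    ultimately have 1: "openin (top_of_set T) ?V" by (rule openin_subset_trans)
    have "T \<inter> g ` (K \<union> C \<union> inside (K \<union> C)) = ?V"
    proof -
      have "T \<inter> g ` (K \<union> C) = {}" using T g_in_U by blast
      then show ?thesis using T by (auto simp: image_Un)
    qed
    then have 2: "closedin (top_of_set T) ?V" using closedin_closed_Int[OF compact_rest, of T] by simp
    have "connected T" using T by blast
    then show "T = ?V" using 1 2 \<open>?V \<noteq> {}\<close> unfolding connected_clopen by blast
  qed
  show ?thesis unfolding crosscut_side_def
  proof (rule the_equality)
    show "?V \<in> components (U - g ` C) \<and> b \<notin> ?V" using Vcomp g_range by blast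
    fix V assume V: "V \<in> components (U - g ` C) \<and> b \<notin> V"
    show "V = ?V"
    proof (rule ccontr)
      assume "V \<noteq> ?V"
      then have disj: "V \<inter> ?V = {}" using components_nonoverlap V Vcomp by blast
      have VU: "V \<subseteq> U - g ` C" "V \<noteq> {}" using V in_components_subset in_components_nonempty by blast+
      obtain x where x: "x \<in> V" using VU(2) by (meson ex_in_conv)
      have "x \<in> insert b (?V \<union> ?O)" using subsetD[OF VU(1) x] unfolding cover .
      moreover have "x \<notin> ?V" using disj x by (metis IntI empty_iff)
      ultimately have "x \<in> insert b ?O" by (simp only: insert_iff Un_iff) simp
      then have "V \<inter> insert b ?O \<noteq> {}" using x by (metis IntI empty_iff)
      moreover have "insert b ?O \<subseteq> U - g ` C" unfolding cover by (simp add: subset_insertI2)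
      ultimately have "insert b ?O \<subseteq> V" by (intro components_maximal[OF conjunct1[OF V] Ocon]) (simp_all add: Int_commute)
      then show False using V by simp
    qed
  qed
qed

lemma h_image_Diff: "C \<subseteq> S - {b} \<Longrightarrow> h ` C - K = h ` (C \<inter> U)"
proof -
  assume C: "C \<subseteq> S - {b}"
  have "C - (S - U) = C \<inter> U" using C by blast
  moreover have "h ` (C - (S - U)) = h ` C - K"
    by (rule inj_on_image_set_diff[OF inj_h _ complement_subset]) (use C in blast)
  ultimately show ?thesis by simp
qed

text \<open>For bounded \<open>X\<close> the closure is compact and its image closed; an unbounded
  \<open>X\<close> would bring in the pole \<open>b\<close>.\<close>

lemma closure_g_image:
  assumes "bounded X"
  shows "closure (g ` X) = g ` closure X"
proof
  have cg: "continuous_on A g" for A using cont_g continuous_on_subset by blast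
  have "compact (closure X)" using assms by (simp add: compact_closure)
  then have "closed (g ` closure X)" using cg by (intro compact_imp_closed compact_continuous_image)
  then show "closure (g ` X) \<subseteq> g ` closure X" by (intro closure_minimal image_mono closure_subset)
  show "g ` closure X \<subseteq> closure (g ` X)" by (rule image_closure_subset[OF cg closed_closure closure_subset])
qed

lemma bounded_inside_cut: "plane.cut C \<Longrightarrow> bounded (inside (K \<union> C))"
  using plane.compact_Un_cut compact_imp_bounded bounded_inside by blast

lemma prime_end_crosscut:
  assumes "prime_end_sequence U b D"
  shows "D n \<subseteq> S - {b}" "plane.cut (h ` D n)" "g ` h ` D n = D n"
    "crosscut_side U b (D n) = g ` inside (K \<union> h ` D n)"
proof -
  have D: "crosscut U (D n)" "b \<notin> D n" using assms by (auto simp: prime_end_sequence_def)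
  show 1: "plane.cut (h ` D n)" "D n \<subseteq> S - {b}" using crosscut_imp_cut[OF D] by auto
  show "g ` h ` D n = D n" by (rule gh_image[OF 1(2)])
  then show "crosscut_side U b (D n) = g ` inside (K \<union> h ` D n)" using side_eq[OF 1(1)] by simp
qed

lemma prime_end_imp_chain:
  assumes "prime_end_sequence U b D"
  shows "plane.chain (\<lambda>n. h ` D n)"
  unfolding plane.chain_def
proof (intro conjI allI impI)
  note D = prime_end_crosscut[OF assms]
  show "plane.cut (h ` D n)" for n by (rule D)
  have disj: "D m \<inter> D n = {}" if "m \<noteq> n" for m n
    using assms that by (auto simp: prime_end_sequence_def disjoint_family_on_def)
  show "disjoint_family (\<lambda>n. h ` D n)"
    unfolding disjoint_family_on_def
    using inj_on_image_Int[OF inj_h D(1) D(1)] disj by (metis image_empty)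
  show "h ` D (Suc n) \<subseteq> closure (inside (K \<union> h ` D n))" for n
  proof -
    have "D (Suc n) \<subseteq> closure (crosscut_side U b (D n))" using assms by (simp add: prime_end_sequence_def)
    also have "\<dots> = g ` closure (inside (K \<union> h ` D n))"
      unfolding D(4) by (rule closure_g_image[OF bounded_inside_cut[OF D(2)]])
    finally have "h ` D (Suc n) \<subseteq> h ` g ` closure (inside (K \<union> h ` D n))" by (rule image_mono)
    then show ?thesis unfolding hg_image .
  qed
  fix \<eta> :: real assume \<eta>: "\<eta> > 0"
  have ne: "S - U \<noteq> {}" using two_points by blast
  have cl: "closed (S - U)" using compact_complement by (rule compact_imp_closed)
  \<comment> \<open>A crosscut of diameter below \<open>d\<close> has its ends in
    \<open>S - U\<close>, so it stays in the compact set \<open>L\<close>, which avoids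
    \<open>b\<close> and on which \<open>h\<close> is uniformly continuous.\<close>
  define d where "d = infdist b (S - U) / 2"
  have d: "d > 0" using infdist_pos_not_in_closed[OF cl ne, of b] b_in_U by (simp add: d_def)
  define L where "L = S \<inter> {x. infdist x (S - U) \<le> d}"
  have "compact L" unfolding L_def
    using compact_riemann_sphere by (intro compact_Int_closed closed_Collect_le continuous_intros)
  moreover have Lb: "L \<subseteq> S - {b}" using d by (auto simp: L_def d_def)
  then have "continuous_on L h" using cont_h continuous_on_subset by blast
  ultimately have "uniformly_continuous_on L h" by (intro compact_uniformly_continuous)
  then obtain \<theta> where \<theta>: "\<theta> > 0" "\<And>x y. x \<in> L \<Longrightarrow> y \<in> L \<Longrightarrow> dist x y < \<theta> \<Longrightarrow> dist (h x) (h y) < \<eta>"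
    using \<eta> unfolding uniformly_continuous_on_def by metis
  have "(\<lambda>n. spherical_diam (D n)) \<longlonglongrightarrow> 0" using assms by (simp add: prime_end_sequence_def)
  then have "\<forall>\<^sub>F n in sequentially. spherical_diam (D n) < min d \<theta>"
    using d \<theta>(1) by (intro order_tendstoD(2)) auto
  then show "\<forall>\<^sub>F n in sequentially. \<exists>c. h ` D n \<subseteq> ball c \<eta>"
  proof (rule eventually_mono)
    fix n assume n: "spherical_diam (D n) < min d \<theta>"
    have DS: "D n \<subseteq> S" using D(1)[of n] by blast
    have small: "dist x y < d" "dist x y < \<theta>" if "x \<in> D n" "y \<in> D n" for x y
      using dist_le_spherical_diam[OF DS that] n by auto
    obtain y where y: "y \<in> h ` D n" "y \<in> K" using plane.cut_meets[OF D(2)[of n]] by blast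
    have "g y \<in> D n" using y(1) D(3)[of n] by blast
    moreover have "g y \<in> S - U" using y(2) gh_image[OF complement_subset] by blast
    ultimately have DL: "x \<in> L" if "x \<in> D n" for x
      using infdist_le[of "g y" "S - U" x] small(1)[OF that, of "g y"] DS that by (auto simp: L_def)
    have "h x \<in> ball (h (g y)) \<eta>" if "x \<in> D n" for x
      using \<theta>(2)[OF DL DL] small(2)[of "g y" x] that \<open>g y \<in> D n\<close> by auto
    then show "\<exists>c. h ` D n \<subseteq> ball c \<eta>" by blast
  qed
qed

lemma chain_imp_prime_end:
  assumes "plane.chain C"
  shows "prime_end_sequence U b (\<lambda>n. g ` C n)"
  unfolding prime_end_sequence_def
proof (intro conjI allI)
  have cut: "plane.cut (C n)" for n using assms by (simp add: plane.chain_def)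
  show "crosscut U (g ` C n)" "b \<notin> g ` C n" for n using cut_imp_crosscut[OF cut] by auto
  have "C m \<inter> C n = {}" if "m \<noteq> n" for m n
    using assms that by (auto simp: plane.chain_def disjoint_family_on_def)
  then show "disjoint_family (\<lambda>n. g ` C n)"
    unfolding disjoint_family_on_def using image_Int[OF inj_g] by (metis image_empty)
  show "g ` C (Suc n) \<subseteq> closure (crosscut_side U b (g ` C n))" for n
    unfolding side_eq[OF cut] closure_g_image[OF bounded_inside_cut[OF cut]]
    using assms by (intro image_mono) (simp add: plane.chain_def)
  show "(\<lambda>n. spherical_diam (g ` C n)) \<longlonglongrightarrow> 0"
  proof (rule LIMSEQ_I)
    fix r :: real assume r: "0 < r"
    then have r2: "r / 2 > 0" by simp
    obtain \<eta> where \<eta>: "\<eta> > 0" "\<And>X. \<lbrakk>X \<subseteq> S; \<And>x y. x \<in> X \<Longrightarrow> y \<in> X \<Longrightarrow> dist x y \<le> \<eta>\<rbrakk> \<Longrightarrow> spherical_diam X \<le> r / 2"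
      using spherical_diam_small[OF r2] by blast
    \<comment> \<open>A crosscut in a ball of radius at most 1 meets \<open>K\<close> and has
      diameter at most 2, hence lies in \<open>L\<close>.\<close>
    define L where "L = {x. infdist x K \<le> 2}"
    have "uniformly_continuous_on L g"
      unfolding L_def using plane.compact_infdist_le cont_g by (intro compact_uniformly_continuous) (auto intro: continuous_on_subset)
    then obtain \<theta> where \<theta>: "\<theta> > 0" "\<And>x y. x \<in> L \<Longrightarrow> y \<in> L \<Longrightarrow> dist x y < \<theta> \<Longrightarrow> dist (g x) (g y) < \<eta>"
      using \<eta>(1) unfolding uniformly_continuous_on_def by metis
    have "\<forall>\<^sub>F n in sequentially. \<exists>c. C n \<subseteq> ball c (min 1 (\<theta> / 2))"
      using assms \<theta>(1) by (simp add: plane.chain_def)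
    then obtain N where N: "\<And>n. n \<ge> N \<Longrightarrow> \<exists>c. C n \<subseteq> ball c (min 1 (\<theta> / 2))" by (auto simp: eventually_sequentially)
    have "norm (spherical_diam (g ` C n) - 0) < r" if nN: "n \<ge> N" for n
    proof -
      obtain c where c: "C n \<subseteq> ball c (min 1 (\<theta> / 2))" using N[OF nN] by blast
      have small: "dist x y < 2" "dist x y < \<theta>" if "x \<in> C n" "y \<in> C n" for x y
      proof -
        have "dist c x < min 1 (\<theta> / 2)" "dist c y < min 1 (\<theta> / 2)" using c that by auto
        then show "dist x y < 2" "dist x y < \<theta>" using dist_triangle3[of x y c] by auto
      qed
      obtain z where z: "z \<in> C n" "z \<in> K" using plane.cut_meets[OF cut] by blast
      have CL: "x \<in> L" if "x \<in> C n" for x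
        using infdist_le[OF z(2), of x] small(1)[OF that z(1)] by (simp add: L_def)
      have "dist x y \<le> \<eta>" if "x \<in> g ` C n" "y \<in> g ` C n" for x y
        using that \<theta>(2)[OF CL CL] small(2) by (auto intro: less_imp_le)
      moreover have gS: "g ` C n \<subseteq> S" using g_range by blast
      ultimately have "spherical_diam (g ` C n) \<le> r / 2" using \<eta>(2) by blast
      moreover have "0 \<le> spherical_diam (g ` C n)"
        using dist_le_spherical_diam[OF gS, of "g z" "g z"] z(1) by simp
      ultimately show ?thesis using r by simp
    qed
    then show "\<exists>no. \<forall>n\<ge>no. norm (spherical_diam (g ` C n) - 0) < r" by blast
  qed
qed

lemma prime_end_cut_inside:
  assumes "prime_end_sequence U b D" "n < j"
  shows "D j \<inter> U \<subseteq> crosscut_side U b (D n)"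
proof -
  note D = prime_end_crosscut[OF assms(1)]
  note chain = prime_end_imp_chain[OF assms(1)]
  obtain i where i: "j = Suc i" "n \<le> i" using assms(2) by (metis Suc_leD less_eq_Suc_le Suc_le_D Suc_le_mono)
  have "h ` (D j \<inter> U) \<subseteq> inside (K \<union> h ` D n)"
    using plane.chain_step[OF chain, of i] plane.chain_inside_mono[OF chain i(2)] h_image_Diff[OF D(1)] i(1) by blast
  then have "g ` h ` (D j \<inter> U) \<subseteq> g ` inside (K \<union> h ` D n)" by (rule image_mono)
  moreover have "g ` h ` (D j \<inter> U) = D j \<inter> U" using D(1)[of j] by (intro gh_image) blast
  ultimately show ?thesis unfolding D(4) by simp
qed

lemma prime_end_rel_refl:
  assumes "prime_end_sequence U b D"
  shows "(D, D) \<in> prime_end_rel U b"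
proof -
  have "\<forall>\<^sub>F j in sequentially. D j \<inter> U \<subseteq> crosscut_side U b (D n)" for n
    by (rule eventually_mono[OF eventually_gt_at_top[of n]]) (rule prime_end_cut_inside[OF assms])
  then show ?thesis unfolding prime_end_rel_def using assms by simp
qed

text \<open>The relation speaks of crosscuts only; \<open>inside_cut_mono\<close> promotes their
  nesting to nesting of the sides. This allows a constructed sequence to be traded for the chosen
  representative.\<close>

lemma prime_end_rel_side_subset:
  assumes "(D, R) \<in> prime_end_rel U b"
  obtains j where "crosscut_side U b (D j) \<subseteq> crosscut_side U b (R n)"
proof -
  have DR: "prime_end_sequence U b D" "prime_end_sequence U b R"
    "\<forall>\<^sub>F j in sequentially. D j \<inter> U \<subseteq> crosscut_side U b (R n)"
    using assms by (auto simp: prime_end_rel_def)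
  obtain j where j: "D j \<inter> U \<subseteq> crosscut_side U b (R n)" using DR(3) by (auto simp: eventually_sequentially)
  note D = prime_end_crosscut[OF DR(1)] and R = prime_end_crosscut[OF DR(2)]
  have "h ` (D j \<inter> U) \<subseteq> h ` g ` inside (K \<union> h ` R n)" using j unfolding R(4) by (rule image_mono)
  then have sub: "h ` D j - K \<subseteq> inside (K \<union> h ` R n)" unfolding hg_image h_image_Diff[OF D(1)] .
  then have "h ` R n \<inter> h ` D j \<subseteq> K" using inside_no_overlap[of "K \<union> h ` R n"] by blast
  then have "inside (K \<union> h ` D j) \<subseteq> inside (K \<union> h ` R n)" using plane.inside_cut_mono[OF R(2) D(2)] sub by blast
  then have "crosscut_side U b (D j) \<subseteq> crosscut_side U b (R n)" unfolding D(4) R(4) by (rule image_mono)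
  then show ?thesis by (rule that)
qed

text \<open>By reflexivity the class of \<open>D\<close> is nonempty, so the choice in
  \<open>representative\<close> yields a genuine member.\<close>

lemma representative_of_class:
  assumes "prime_end_sequence U b D"
  shows "(D, representative (prime_end_rel U b `` {D})) \<in> prime_end_rel U b"
proof -
  have "D \<in> prime_end_rel U b `` {D}" using prime_end_rel_refl[OF assms] by simp
  then have "representative (prime_end_rel U b `` {D}) \<in> prime_end_rel U b `` {D}"
    unfolding representative_def by (rule someI[of "\<lambda>C. C \<in> prime_end_rel U b `` {D}"])
  then show ?thesis by simp
qed

lemma prime_end_representative:
  assumes "p \<in> prime_ends U b"
  shows "prime_end_sequence U b (representative p)"
proof -
  obtain D where "prime_end_sequence U b D" "p = prime_end_rel U b `` {D}"
    using assms by (auto simp: prime_ends_def quotient_def)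
  then show ?thesis using representative_of_class[of D] by (auto simp: prime_end_rel_def)
qed

lemma weakly_locally_connected_iff:
  assumes z: "z \<in> S - U"
  shows "weakly_locally_connected_at z (top_of_set (S - U)) \<longleftrightarrow> plane.loc_conn_at (h z)"
proof -
  have hKg: "homeomorphism (S - U) K h g"
    using homeomorphism_of_subsets[OF hg complement_subset] by simp
  have hz: "h z \<in> K" using z by blast
  have gz: "g (h z) = z" using z complement_subset gh by blast
  show ?thesis
  proof
    assume L: "weakly_locally_connected_at z (top_of_set (S - U))"
    show "plane.loc_conn_at (h z)" unfolding plane.loc_conn_at_def
    proof (intro allI impI)
      fix \<epsilon> :: real assume \<epsilon>: "\<epsilon> > 0"
      have "openin (top_of_set K) (K \<inter> ball (h z) \<epsilon>)" by (simp add: openin_open_Int)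
      then have "openin (top_of_set (S - U)) (g ` (K \<inter> ball (h z) \<epsilon>))"
        using homeomorphism_imp_open_map[OF homeomorphism_symD[OF hKg]] by blast
      moreover have "z \<in> g ` (K \<inter> ball (h z) \<epsilon>)" using hz gz \<epsilon> by force
      ultimately obtain V N where V: "openin (top_of_set (S - U)) V" "connectedin (top_of_set (S - U)) N"
        "z \<in> V" "V \<subseteq> N" "N \<subseteq> g ` (K \<inter> ball (h z) \<epsilon>)"
        using L unfolding weakly_locally_connected_at_def neighbourhood_base_at_def by metis
      have N: "connected N" "N \<subseteq> S - U" using V(2) by (auto simp: connectedin_subtopology)
      have "openin (top_of_set K) (h ` V)" using homeomorphism_imp_open_map[OF hKg V(1)] .
      then obtain \<delta> where \<delta>: "\<delta> > 0" "ball (h z) \<delta> \<inter> K \<subseteq> h ` V"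
        using V(3) unfolding openin_contains_ball by blast
      have "connected (h ` N)"
        using N complement_subset cont_h by (intro connected_continuous_image) (auto intro: continuous_on_subset)
      moreover have "K \<inter> ball (h z) \<delta> \<subseteq> h ` N" using \<delta>(2) V(4) by blast
      moreover have "h ` N \<subseteq> K \<inter> ball (h z) \<epsilon>" using image_mono[OF V(5), of h] unfolding hg_image .
      ultimately show "\<exists>\<delta>>0. \<exists>N. connected N \<and> K \<inter> ball (h z) \<delta> \<subseteq> N \<and> N \<subseteq> K \<inter> ball (h z) \<epsilon>"
        using \<delta>(1) by blast
    qed
  next
    assume R: "plane.loc_conn_at (h z)"
    show "weakly_locally_connected_at z (top_of_set (S - U))"
      unfolding weakly_locally_connected_at_def neighbourhood_base_at_def
    proof (intro allI impI, elim conjE)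
      fix W assume W: "openin (top_of_set (S - U)) W" "z \<in> W"
      have WS: "W \<subseteq> S - {b}" using openin_imp_subset[OF W(1)] complement_subset by blast
      have "openin (top_of_set K) (h ` W)" using homeomorphism_imp_open_map[OF hKg W(1)] .
      then obtain \<epsilon> where \<epsilon>: "\<epsilon> > 0" "ball (h z) \<epsilon> \<inter> K \<subseteq> h ` W"
        using W(2) unfolding openin_contains_ball by blast
      obtain \<delta> N where N: "\<delta> > 0" "connected N" "K \<inter> ball (h z) \<delta> \<subseteq> N" "N \<subseteq> K \<inter> ball (h z) \<epsilon>"
        using R \<epsilon>(1) unfolding plane.loc_conn_at_def by blast
      have "openin (top_of_set K) (K \<inter> ball (h z) \<delta>)" by (simp add: openin_open_Int)
      then have "openin (top_of_set (S - U)) (g ` (K \<inter> ball (h z) \<delta>))"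
        using homeomorphism_imp_open_map[OF homeomorphism_symD[OF hKg]] by blast
      moreover have "connectedin (top_of_set (S - U)) (g ` N)"
      proof -
        have "connected (g ` N)" using N(2) cont_g by (intro connected_continuous_image) (auto intro: continuous_on_subset)
        moreover have "g ` N \<subseteq> S - U" using N(4) gh_image[OF complement_subset] by blast
        ultimately show ?thesis by (simp add: connectedin_subtopology)
      qed
      moreover have "z \<in> g ` (K \<inter> ball (h z) \<delta>)" using hz gz N(1) by force
      moreover have "g ` (K \<inter> ball (h z) \<delta>) \<subseteq> g ` N" using N(3) by (rule image_mono)
      moreover have "N \<subseteq> h ` W" using N(4) \<epsilon>(2) by blast
      then have "g ` N \<subseteq> g ` h ` W" by (rule image_mono)
      then have "g ` N \<subseteq> W" unfolding gh_image[OF WS] .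
      ultimately show "\<exists>V N. openin (top_of_set (S - U)) V \<and> connectedin (top_of_set (S - U)) N \<and> z \<in> V \<and> V \<subseteq> N \<and> N \<subseteq> W"
        by blast
    qed
  qed
qed

section \<open>Strong minimality implies local connectivity\<close>

lemma strongly_minimal_imp_loc_conn:
  assumes z: "z \<in> S - U"
    and sm: "\<And>p. \<lbrakk>p \<in> prime_ends U b; z \<in> impression U b p\<rbrakk> \<Longrightarrow> strongly_minimal U b p z"
  shows "plane.loc_conn_at (h z)"
proof (rule ccontr)
  assume nlc: "\<not> plane.loc_conn_at (h z)"
  define z' where "z' = h z"
  have z'K: "z' \<in> K" and gz: "g z' = z" using z complement_subset gh unfolding z'_def by blast+
  obtain C w w' s and r :: "nat \<Rightarrow> real" where C: "plane.chain C" and s: "0 < s"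
    and w: "\<And>k. dist z' (w k) = s" "\<And>k. dist z' (w' k) = s" "\<And>k. w k \<notin> K" "\<And>k. w' k \<notin> K"
    and wK: "(\<lambda>k. infdist (w k) K) \<longlonglongrightarrow> 0" "(\<lambda>k. infdist (w' k) K) \<longlonglongrightarrow> 0"
    and win: "\<And>n. \<forall>\<^sub>F k in sequentially. w k \<in> inside (K \<union> C n)" "\<And>n. \<forall>\<^sub>F k in sequentially. w' k \<in> inside (K \<union> C n)"
    and r: "r \<longlonglongrightarrow> 0" "\<And>k. \<not> connected_component (- (K \<union> cball z' (r k))) (w k) (w' k)"
    using plane.not_loc_conn_chain[OF z'K nlc[folded z'_def]] by metis
  have cut: "plane.cut (C n)" for n using C by (simp add: plane.chain_def)
  define D where "D n = g ` C n" for n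
  have D: "prime_end_sequence U b D" unfolding D_def by (rule chain_imp_prime_end[OF C])
  have Dside: "crosscut_side U b (D n) = g ` inside (K \<union> C n)" for n
    unfolding D_def by (rule side_eq[OF cut])
  define p where "p = prime_end_rel U b `` {D}"
  define R where "R = representative p"
  have p: "p \<in> prime_ends U b" unfolding p_def prime_ends_def by (rule quotientI) (use D in simp)
  have DR: "(D, R) \<in> prime_end_rel U b" unfolding R_def p_def by (rule representative_of_class[OF D])
  have sub: "\<exists>j. g ` inside (K \<union> C j) \<subseteq> crosscut_side U b (R n)" for n
    using prime_end_rel_side_subset[OF DR, of n] unfolding Dside by blast
  \<comment> \<open>The connected near side contains \<open>w k\<close> and \<open>w' k\<close>,
    which are not joined off the disc of radius \<open>r k\<close>; so it enters the disc.\<close>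
  have zcl: "z' \<in> closure (inside (K \<union> C j))" for j
    unfolding closure_approachable
  proof (intro allI impI)
    fix e :: real assume "e > 0"
    then have "\<forall>\<^sub>F k in sequentially. r k < e" by (rule order_tendstoD(2)[OF r(1)])
    then have "\<forall>\<^sub>F k in sequentially. r k < e \<and> w k \<in> inside (K \<union> C j) \<and> w' k \<in> inside (K \<union> C j)"
      using win[of j] by eventually_elim simp
    then obtain k where k: "r k < e" "w k \<in> inside (K \<union> C j)" "w' k \<in> inside (K \<union> C j)"
      by (auto simp: eventually_sequentially)
    have "inside (K \<union> C j) \<inter> cball z' (r k) \<noteq> {}"
    proof
      assume "inside (K \<union> C j) \<inter> cball z' (r k) = {}"
      then have "inside (K \<union> C j) \<subseteq> - (K \<union> cball z' (r k))" using inside_no_overlap[of "K \<union> C j"] by blast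
      then have "connected_component (- (K \<union> cball z' (r k))) (w k) (w' k)"
        unfolding connected_component_def using k plane.connected_inside_cut[OF cut[of j]] by blast
      then show False using r(2) by blast
    qed
    then show "\<exists>y\<in>inside (K \<union> C j). dist y z' < e" using k(1) by (force simp: dist_commute)
  qed
  have "z \<in> impression U b p"
    unfolding impression_def R_def[symmetric]
  proof
    fix n
    obtain j where j: "g ` inside (K \<union> C j) \<subseteq> crosscut_side U b (R n)" using sub by blast
    have "z \<in> g ` closure (inside (K \<union> C j))" using zcl[of j] gz by blast
    then have "z \<in> closure (g ` inside (K \<union> C j))" unfolding closure_g_image[OF bounded_inside_cut[OF cut]] .
    then show "z \<in> closure (crosscut_side U b (R n))" using closure_mono[OF j] by blast
  qed
  then have "strongly_minimal U b p z" using sm p by blast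
  define v where "v i = (if even i then w (i div 2) else w' (i div 2))" for i
  have v2: "v (2 * k) = w k" "v (2 * k + 1) = w' k" for k by (auto simp: v_def)
  have ev: "\<forall>\<^sub>F i in sequentially. P (v i)"
    if Pw: "\<forall>\<^sub>F k in sequentially. P (w k)" "\<forall>\<^sub>F k in sequentially. P (w' k)" for P
  proof -
    obtain N M where "\<And>k. k \<ge> N \<Longrightarrow> P (w k)" "\<And>k. k \<ge> M \<Longrightarrow> P (w' k)"
      using Pw by (auto simp: eventually_sequentially)
    then have "P (v i)" if "i \<ge> 2 * max N M" for i
      using that by (auto simp: v_def)
    then show ?thesis by (auto simp: eventually_sequentially)
  qed
  have vK: "v i \<notin> K" and vs: "dist z' (v i) = s" for i using w by (auto simp: v_def)
  define W where "W i = g (v i)" for i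
  have "range W \<subseteq> U" using vK g_in_U by (auto simp: W_def)
  moreover have "seq_converges_to_prime_end U b W p"
    unfolding seq_converges_to_prime_end_def R_def[symmetric]
  proof
    fix n
    obtain j where j: "g ` inside (K \<union> C j) \<subseteq> crosscut_side U b (R n)" using sub by blast
    have "\<forall>\<^sub>F i in sequentially. v i \<in> inside (K \<union> C j)" by (rule ev[OF win])
    then show "\<forall>\<^sub>F i in sequentially. W i \<in> crosscut_side U b (R n)"
      by (rule eventually_mono) (use j in \<open>auto simp: W_def\<close>)
  qed
  moreover have "\<not> seq_accumulates_on W z"
  proof
    assume "seq_accumulates_on W z"
    then obtain q where q: "(W \<circ> q) \<longlonglongrightarrow> z" by (auto simp: seq_accumulates_on_def)
    have zSb: "z \<in> S - {b}" using z complement_subset by blast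
    moreover have "\<forall>\<^sub>F i in sequentially. (W \<circ> q) i \<in> S - {b}" using g_range by (simp add: W_def)
    ultimately have "(\<lambda>i. h ((W \<circ> q) i)) \<longlonglongrightarrow> h z"
      by (rule continuous_on_tendsto_compose[OF cont_h q])
    then have "(\<lambda>i. v (q i)) \<longlonglongrightarrow> z'" by (simp add: W_def hg' z'_def)
    then have "(\<lambda>i. dist z' (v (q i))) \<longlonglongrightarrow> dist z' z'"
      by (intro tendsto_intros)
    then have "(\<lambda>i::nat. s) \<longlonglongrightarrow> 0" unfolding vs by simp
    then show False using s LIMSEQ_unique tendsto_const by (metis less_irrefl)
  qed
  ultimately obtain \<Gamma> where \<Gamma>: "continuous_on {0..} \<Gamma>" "\<Gamma> ` {0..} \<subseteq> U" "curve_converges_to_prime_end U b \<Gamma> p"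
    "range W \<subseteq> \<Gamma> ` {0..}" "\<not> curve_accumulates_on \<Gamma> z"
    using \<open>strongly_minimal U b p z\<close> unfolding strongly_minimal_def by blast
  have "\<forall>i. \<exists>\<tau>. \<tau> \<ge> 0 \<and> \<Gamma> \<tau> = W i" 
  proof
    fix i
    have "W i \<in> \<Gamma> ` {0..}" using \<Gamma>(4) by (rule subsetD) simp
    then show "\<exists>\<tau>. \<tau> \<ge> 0 \<and> \<Gamma> \<tau> = W i" by (metis atLeast_iff imageE)
  qed
  then obtain t where t: "\<And>i. t i \<ge> 0" "\<And>i. \<Gamma> (t i) = W i" by metis
  \<comment> \<open>The points of the circle that the curve visits up to time \<open>M\<close> form
    a compact set \<open>F\<close> off \<open>K\<close>, whereas the points \<open>v i\<close>
    approach \<open>K\<close>.\<close>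
  have late: "\<forall>\<^sub>F i in sequentially. t i > M" for M
  proof -
    define F where "F = sphere z' s \<inter> g -` (\<Gamma> ` {0..M})"
    have "compact (\<Gamma> ` {0..M})"
      using \<Gamma>(1) by (intro compact_continuous_image) (auto intro: continuous_on_subset)
    then have "closed (g -` (\<Gamma> ` {0..M}))"
      using continuous_on_closed_vimage[of UNIV g] cont_g by (simp add: compact_imp_closed)
    then have Fc: "compact F" unfolding F_def by (intro compact_Int_closed) auto
    have pos: "infdist y K > 0" if "y \<in> F" for y
    proof -
      have "g y \<in> U" using that \<Gamma>(2) by (auto simp: F_def)
      then have "y \<notin> K" using g_in_U by blast
      then show ?thesis using infdist_pos_not_in_closed[OF plane.closed_K] z'K by blast
    qed
    have tF: "v i \<in> F" if "t i \<le> M" for i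
    proof -
      have "g (v i) \<in> \<Gamma> ` {0..M}" using t[of i] that unfolding W_def by (metis atLeastAtMost_iff image_eqI)
      then show ?thesis using vs[of i] by (simp add: F_def)
    qed
    show ?thesis
    proof (cases "F = {}")
      case True
      then have "t i > M" for i using tF[of i] by force
      then show ?thesis by simp
    next
      case False
      have "continuous_on F (\<lambda>y. infdist y K)" by (intro continuous_intros)
      then obtain y where y: "y \<in> F" "\<And>x. x \<in> F \<Longrightarrow> infdist y K \<le> infdist x K"
        using continuous_attains_inf[OF Fc False] by metis
      have "\<forall>\<^sub>F i in sequentially. infdist (v i) K < infdist y K"
        using order_tendstoD(2)[OF wK(1) pos[OF y(1)]] order_tendstoD(2)[OF wK(2) pos[OF y(1)]] by (rule ev)
      then show ?thesis
        by (rule eventually_mono) (meson tF y(2) not_le)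
    qed
  qed
  have R: "prime_end_sequence U b R" using DR by (simp add: prime_end_rel_def)
  have "\<forall>\<^sub>F \<tau> in at_top. \<Gamma> \<tau> \<in> crosscut_side U b (R 0)"
    using \<Gamma>(3) unfolding curve_converges_to_prime_end_def R_def[symmetric] by blast
  then obtain T where T: "\<And>\<tau>. \<tau> \<ge> T \<Longrightarrow> \<Gamma> \<tau> \<in> g ` inside (K \<union> h ` R 0)"
    unfolding prime_end_crosscut(4)[OF R] by (auto simp: eventually_at_top_linorder)
  \<comment> \<open>From \<open>T0\<close> on the curve runs in a side of a crosscut and avoids
    \<open>b\<close>, so it can be followed in the plane.\<close>
  define T0 where "T0 = max 0 T"
  have T0: "h (\<Gamma> \<tau>) \<notin> K" "g (h (\<Gamma> \<tau>)) = \<Gamma> \<tau>" "\<Gamma> \<tau> \<in> S - {b}" if \<tau>T0: "\<tau> \<ge> T0" for \<tau>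
  proof -
    obtain y where y: "\<Gamma> \<tau> = g y" "y \<in> inside (K \<union> h ` R 0)" using T[of \<tau>] \<tau>T0 by (auto simp: T0_def)
    have "y \<notin> K" using y(2) inside_no_overlap[of "K \<union> h ` R 0"] by blast
    then show "h (\<Gamma> \<tau>) \<notin> K" "g (h (\<Gamma> \<tau>)) = \<Gamma> \<tau>" "\<Gamma> \<tau> \<in> S - {b}" using y(1) hg' g_range by auto
  qed
  have contT: "continuous_on {T0..} (\<lambda>\<tau>. h (\<Gamma> \<tau>))"
  proof (rule continuous_on_compose2[OF cont_h])
    show "continuous_on {T0..} \<Gamma>" using \<Gamma>(1) by (rule continuous_on_subset) (auto simp: T0_def)
    show "\<Gamma> ` {T0..} \<subseteq> S - {b}" using T0(3) by blast
  qed
  \<comment> \<open>Between the two parameters, in whichever order they come, the curve connects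
    \<open>w k\<close> and \<open>w' k\<close> off \<open>K\<close>, so it has to enter the
    disc.\<close>
  have cross: "\<exists>\<tau>. \<tau> \<ge> min (t (2 * k)) (t (2 * k + 1)) \<and> dist z' (h (\<Gamma> \<tau>)) \<le> r k"
    if k: "t (2 * k) \<ge> T0" "t (2 * k + 1) \<ge> T0" for k
  proof (rule ccontr)
    assume no: "\<not> ?thesis"
    let ?I = "closed_segment (t (2 * k)) (t (2 * k + 1))"
    have I: "\<tau> \<ge> min (t (2 * k)) (t (2 * k + 1))" "\<tau> \<ge> T0" if "\<tau> \<in> ?I" for \<tau>
      using that k by (auto simp: closed_segment_eq_real_ivl split: if_splits)
    let ?A = "(\<lambda>\<tau>. h (\<Gamma> \<tau>)) ` ?I"
    have "continuous_on ?I (\<lambda>\<tau>. h (\<Gamma> \<tau>))" by (rule continuous_on_subset[OF contT]) (use I in auto)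
    then have "connected ?A" by (rule connected_continuous_image) simp
    moreover have "?A \<subseteq> - (K \<union> cball z' (r k))"
    proof
      fix y assume "y \<in> ?A"
      then obtain \<tau> where \<tau>: "\<tau> \<in> ?I" "y = h (\<Gamma> \<tau>)" by blast
      have "y \<notin> K" using T0(1)[OF I(2)[OF \<tau>(1)]] \<tau>(2) by simp
      moreover have "\<not> dist z' y \<le> r k" using no I(1)[OF \<tau>(1)] \<tau>(2) by blast
      ultimately show "y \<in> - (K \<union> cball z' (r k))" by (simp add: mem_cball)
    qed
    moreover have "h (\<Gamma> (t (2 * k))) = w k" "h (\<Gamma> (t (2 * k + 1))) = w' k"
      using t(2)[of "2 * k"] t(2)[of "2 * k + 1"] v2[of k] hg' by (simp_all add: W_def)
    then have "w k \<in> ?A" "w' k \<in> ?A" by (metis ends_in_segment image_eqI)+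
    ultimately have "connected_component (- (K \<union> cball z' (r k))) (w k) (w' k)"
      unfolding connected_component_def by blast
    then show False using r(2) by blast
  qed
  have late2: "\<forall>\<^sub>F k in sequentially. t (2 * k) > M \<and> t (2 * k + 1) > M" for M
  proof -
    obtain N where "\<And>i. i \<ge> N \<Longrightarrow> t i > M" using late[of M] by (auto simp: eventually_sequentially)
    then have "t (2 * k) > M \<and> t (2 * k + 1) > M" if "k \<ge> N" for k using that by simp
    then show ?thesis by (auto simp: eventually_sequentially)
  qed
  obtain N where N: "\<And>k. k \<ge> N \<Longrightarrow> t (2 * k) > T0 \<and> t (2 * k + 1) > T0"
    using late2[of T0] by (auto simp: eventually_sequentially)
  have "\<forall>k. \<exists>\<tau>. \<tau> \<ge> min (t (2 * (k + N))) (t (2 * (k + N) + 1)) \<and> dist z' (h (\<Gamma> \<tau>)) \<le> r (k + N)"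
  proof
    fix k
    have "T0 \<le> t (2 * (k + N))" "T0 \<le> t (2 * (k + N) + 1)" using N[of "k + N"] by auto
    then show "\<exists>\<tau>. \<tau> \<ge> min (t (2 * (k + N))) (t (2 * (k + N) + 1)) \<and> dist z' (h (\<Gamma> \<tau>)) \<le> r (k + N)"
      by (rule cross)
  qed
  then obtain \<tau> where \<tau>: "\<And>k. \<tau> k \<ge> min (t (2 * (k + N))) (t (2 * (k + N) + 1))"
    "\<And>k. dist z' (h (\<Gamma> (\<tau> k))) \<le> r (k + N)" by metis
  have \<tau>T: "\<tau> k \<ge> T0" for k using \<tau>(1)[of k] N[of "k + N"] by linarith
  have "filterlim \<tau> at_top sequentially"
    unfolding filterlim_at_top
  proof
    fix M
    obtain N' where N': "\<And>k. k \<ge> N' \<Longrightarrow> t (2 * k) > M \<and> t (2 * k + 1) > M"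
      using late2[of M] by (auto simp: eventually_sequentially)
    have "M \<le> \<tau> k" if "k \<ge> N'" for k using \<tau>(1)[of k] N'[of "k + N"] that by linarith
    then show "\<forall>\<^sub>F k in sequentially. M \<le> \<tau> k" by (auto simp: eventually_sequentially)
  qed
  moreover have "(\<lambda>k. \<Gamma> (\<tau> k)) \<longlonglongrightarrow> z"
  proof -
    have "(\<lambda>k. dist z' (h (\<Gamma> (\<tau> k)))) \<longlonglongrightarrow> 0"
      by (rule tendsto_sandwich[OF _ _ tendsto_const LIMSEQ_ignore_initial_segment[OF r(1), of N]]) (use \<tau>(2) in auto)
    then have "(\<lambda>k. h (\<Gamma> (\<tau> k))) \<longlonglongrightarrow> z'" by (subst tendsto_dist_iff) (simp add: dist_commute)
    then have "(\<lambda>k. g (h (\<Gamma> (\<tau> k)))) \<longlonglongrightarrow> g z'"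
      by (intro continuous_on_tendsto_compose[OF cont_g]) auto
    then show ?thesis unfolding gz using T0(2)[OF \<tau>T] by simp
  qed
  moreover have "0 \<le> \<tau> k" for k using \<tau>T[of k] by (simp add: T0_def)
  ultimately show False using \<Gamma>(5) unfolding curve_accumulates_on_def by blast
qed

section \<open>Local connectivity implies strong minimality\<close>

lemma loc_conn_imp_strongly_minimal:
  assumes z: "z \<in> S - U" and lc: "plane.loc_conn_at (h z)" and p: "p \<in> prime_ends U b"
  shows "strongly_minimal U b p z"
  unfolding strongly_minimal_def
proof (intro allI impI, elim conjE)
  fix w assume wU: "range w \<subseteq> U" and conv: "seq_converges_to_prime_end U b w p" and na: "\<not> seq_accumulates_on w z"
  define R where "R = representative p"
  have R: "prime_end_sequence U b R" unfolding R_def by (rule prime_end_representative[OF p])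
  have chain: "plane.chain (\<lambda>n. h ` R n)" by (rule prime_end_imp_chain[OF R])
  have cut: "plane.cut (h ` R n)" for n by (rule prime_end_crosscut(2)[OF R])
  define In where "In n = inside (K \<union> h ` R n)" for n
  have side: "crosscut_side U b (R n) = g ` In n" for n unfolding In_def by (rule prime_end_crosscut(4)[OF R])
  have In_mono: "In n \<subseteq> In m" if "m \<le> n" for m n
    unfolding In_def by (rule plane.chain_inside_mono[OF chain that])
  have gIn: "g ` In n \<subseteq> U" for n
    using g_in_U inside_no_overlap[of "K \<union> h ` R n"] unfolding In_def by blast
  have zSb: "z \<in> S" "z \<noteq> b" using z b_in_U by auto
  have gz: "g (h z) = z" by (rule gh[OF zSb])
  obtain e N where e: "e > 0" "\<And>n. n \<ge> N \<Longrightarrow> e \<le> dist (w n) z" using not_accumulates_imp_far[OF na] by blast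
  have "isCont g (h z)" using cont_g by (simp add: continuous_on_eq_continuous_at)
  then obtain \<epsilon> where \<epsilon>: "\<epsilon> > 0" "\<And>y. dist y (h z) < \<epsilon> \<Longrightarrow> dist (g y) (g (h z)) < e"
    using e(1) unfolding continuous_at_eps_delta by metis
  obtain \<rho> where \<rho>: "\<rho> > 0" "\<And>C p q c. \<lbrakk>plane.cut C; C \<subseteq> ball c \<rho>; p \<in> inside (K \<union> C); q \<in> inside (K \<union> C);
      dist (h z) p \<ge> \<epsilon>; dist (h z) q \<ge> \<epsilon>\<rbrakk> \<Longrightarrow> connected_component (- (K \<union> C \<union> cball (h z) \<rho>)) p q"
    using plane.joined_off_small_cball[OF lc \<epsilon>(1)] by blast
  obtain n0 where n0: "\<And>n. n \<ge> n0 \<Longrightarrow> \<exists>c. h ` R n \<subseteq> ball c \<rho>"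
    using chain \<rho>(1) unfolding plane.chain_def eventually_sequentially by blast
  \<comment> \<open>A depth \<open>n\<close> at which \<open>w j\<close> and
    \<open>w (Suc j)\<close> can be joined off the disc. The bound \<open>n \<le> j\<close> makes
    the usable depths finite in number, so that there is a largest one, and still lets them grow
    with \<open>j\<close>.\<close>
  define good where "good j n \<longleftrightarrow> n0 \<le> n \<and> n \<le> j \<and> N \<le> j \<and> w j \<in> g ` In n \<and> w (Suc j) \<in> g ` In n" for j n
  have "\<exists>\<gamma>. path \<gamma> \<and> path_image \<gamma> \<subseteq> U \<and> pathstart \<gamma> = w j \<and> pathfinish \<gamma> = w (Suc j) \<and>
      (\<forall>n. good j n \<longrightarrow> path_image \<gamma> \<subseteq> g ` (In n - cball (h z) \<rho>))" for j
  proof (cases "\<exists>n. good j n")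
    case False
    have "w j \<in> U" "w (Suc j) \<in> U" using wU by auto
    then show ?thesis using simply_connected_imp_path_connected[OF simply_connected_U] False unfolding path_connected_def by blast
  next
    case True
    \<comment> \<open>The sides shrink as the depth grows, so a path made at the largest usable
      depth serves all smaller ones.\<close>
    define n where "n = Max {n. good j n}"
    have fin: "finite {n. good j n}" by (rule finite_subset[of _ "{..j}"]) (auto simp: good_def)
    have gn: "good j n" using Max_in[OF fin] True unfolding n_def by auto
    have mx: "m \<le> n" if "good j m" for m using Max_ge[OF fin] that unfolding n_def by auto
    obtain u v where u: "u \<in> In n" "w j = g u" and v: "v \<in> In n" "w (Suc j) = g v"
      using gn unfolding good_def by blast
    obtain c where c: "h ` R n \<subseteq> ball c \<rho>" using n0 gn unfolding good_def by blast
    have far: "dist (h z) y \<ge> \<epsilon>" if "dist (g y) z \<ge> e" for y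
      using \<epsilon>(2)[of y] that unfolding gz by (force simp: dist_commute)
    have "dist (h z) u \<ge> \<epsilon>" "dist (h z) v \<ge> \<epsilon>"
      using far[of u] far[of v] e(2)[of j] e(2)[of "Suc j"] gn u(2) v(2) by (auto simp: good_def)
    then have cc: "connected_component (- (K \<union> h ` R n \<union> cball (h z) \<rho>)) u v"
      using \<rho>(2)[OF cut c] u(1) v(1) unfolding In_def by blast
    have "open (- (K \<union> h ` R n \<union> cball (h z) \<rho>))"
      using plane.compact_Un_cut[OF cut[of n]] by (intro open_Compl closed_Un compact_imp_closed) auto
    then have "path_component (- (K \<union> h ` R n \<union> cball (h z) \<rho>)) u v"
      using cc by (simp add: open_path_connected_component)
    then obtain \<gamma> where \<gamma>: "path \<gamma>" "path_image \<gamma> \<subseteq> - (K \<union> h ` R n \<union> cball (h z) \<rho>)" "pathstart \<gamma> = u" "pathfinish \<gamma> = v"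
      by (auto simp: path_component_def)
    have \<gamma>In: "path_image \<gamma> \<subseteq> In n - cball (h z) \<rho>"
    proof
      fix y assume y: "y \<in> path_image \<gamma>"
      have "connected_component (- (K \<union> h ` R n)) u y"
        unfolding connected_component_def using y \<gamma> pathstart_in_path_image[of \<gamma>]
        by (intro exI[of _ "path_image \<gamma>"]) (auto simp: connected_path_image)
      then have "y \<in> In n" using u(1) inside_same_component unfolding In_def by blast
      then show "y \<in> In n - cball (h z) \<rho>" using y \<gamma>(2) by blast
    qed
    have "path (g \<circ> \<gamma>)" using \<gamma>(1) cont_g by (intro path_continuous_image) (auto intro: continuous_on_subset)
    moreover have img: "path_image (g \<circ> \<gamma>) \<subseteq> g ` (In m - cball (h z) \<rho>)" if "m \<le> n" for m
    proof -
      have "path_image \<gamma> \<subseteq> In m - cball (h z) \<rho>" using \<gamma>In In_mono[OF that] by blast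
      then show ?thesis unfolding path_image_compose by (rule image_mono)
    qed
    moreover have "path_image (g \<circ> \<gamma>) \<subseteq> U" using img[of n] gIn[of n] by blast
    moreover have "pathstart (g \<circ> \<gamma>) = w j" "pathfinish (g \<circ> \<gamma>) = w (Suc j)"
      using \<gamma>(3,4) u v by (auto simp: pathstart_compose pathfinish_compose)
    ultimately show ?thesis using mx by (intro exI[of _ "g \<circ> \<gamma>"]) blast
  qed
  then obtain \<gamma> where \<gamma>: "\<And>j. path (\<gamma> j) \<and> path_image (\<gamma> j) \<subseteq> U \<and> pathstart (\<gamma> j) = w j \<and> pathfinish (\<gamma> j) = w (Suc j) \<and>
      (\<forall>n. good j n \<longrightarrow> path_image (\<gamma> j) \<subseteq> g ` (In n - cball (h z) \<rho>))" by metis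
  \<comment> \<open>The path \<open>\<gamma> j\<close> is run on the interval from \<open>j\<close>
    to \<open>j + 1\<close>; it ends at \<open>w (Suc j)\<close>, where the next one starts.\<close>
  define \<Gamma> where "\<Gamma> t = \<gamma> (nat \<lfloor>t\<rfloor>) (t - real (nat \<lfloor>t\<rfloor>))" for t
  have \<Gamma>eq: "\<Gamma> t = \<gamma> j (t - real j)" if t: "t \<in> {real j..real j + 1}" for t j
  proof (cases "t = real j + 1")
    case True
    then have "\<lfloor>t\<rfloor> = int (Suc j)" by (intro floor_unique) auto
    then have "\<Gamma> t = \<gamma> (Suc j) 0" unfolding \<Gamma>_def True by (simp add: nat_add_distrib)
    then show ?thesis using \<gamma>[of j] \<gamma>[of "Suc j"] True by (simp add: pathstart_def pathfinish_def)
  next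
    case False
    then have "\<lfloor>t\<rfloor> = int j" using t by (intro floor_unique) auto
    then show ?thesis by (simp add: \<Gamma>_def)
  qed
  have \<Gamma>img: "\<Gamma> t \<in> path_image (\<gamma> (nat \<lfloor>t\<rfloor>))" if "t \<ge> 0" for t
  proof -
    have "t - real (nat \<lfloor>t\<rfloor>) \<in> {0..1}" using that by (simp add: of_nat_floor le_of_int_ceiling) linarith
    then show ?thesis unfolding \<Gamma>_def path_image_def by blast
  qed
  have "continuous_on {0..real M} \<Gamma>" for M
  proof (induction M)
    case 0
    then show ?case by (simp add: continuous_on_sing)
  next
    case (Suc M)
    have "continuous_on {0..1} (\<gamma> M)" using \<gamma>[of M] by (simp add: path_def)
    then have "continuous_on {real M..real M + 1} (\<lambda>t. \<gamma> M (t - real M))"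
      by (rule continuous_on_compose2) (auto intro!: continuous_intros)
    then have "continuous_on {real M..real M + 1} \<Gamma>"
      by (rule continuous_on_eq) (simp add: \<Gamma>eq)
    then have "continuous_on ({0..real M} \<union> {real M..real M + 1}) \<Gamma>"
      using Suc by (intro continuous_on_closed_Un) auto
    moreover have "{0..real M} \<union> {real M..real M + 1} = {0..real (Suc M)}" by auto
    ultimately show ?case by simp
  qed
  then have c1: "continuous_on {0..} \<Gamma>" by (rule continuous_on_atLeast_real)
  have c2: "\<Gamma> ` {0..} \<subseteq> U" using \<Gamma>img \<gamma> by fastforce
  have c3: "range w \<subseteq> \<Gamma> ` {0..}"
  proof
    fix x assume "x \<in> range w"
    then obtain j where j: "x = w j" by blast
    have "\<Gamma> (real j) = w j" using \<Gamma>eq[of "real j" j] \<gamma>[of j] by (simp add: pathstart_def)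
    then show "x \<in> \<Gamma> ` {0..}" using j by (metis atLeast_iff image_eqI of_nat_0_le_iff)
  qed
  \<comment> \<open>From some time on, \<open>n\<close> is a usable depth for every path, so the
    curve is at depth \<open>n\<close> and off the disc at once; the former gives convergence to
    \<open>p\<close>, the latter excludes accumulation at \<open>z\<close>.\<close>
  have evgood: "\<forall>\<^sub>F t in at_top. \<Gamma> t \<in> g ` (In n - cball (h z) \<rho>)" if n: "n \<ge> n0" for n
  proof -
    have "\<forall>\<^sub>F j in sequentially. w j \<in> g ` In n"
      using conv unfolding seq_converges_to_prime_end_def R_def[symmetric] side by blast
    then obtain J where J: "\<And>j. j \<ge> J \<Longrightarrow> w j \<in> g ` In n" by (auto simp: eventually_sequentially)
    define J' where "J' = max J (max n N)"
    have "\<Gamma> t \<in> g ` (In n - cball (h z) \<rho>)" if t: "t \<ge> real J'" for t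
    proof -
      have "J' \<le> nat \<lfloor>t\<rfloor>" using t by (simp add: le_nat_floor)
      then have "good (nat \<lfloor>t\<rfloor>) n" using J n unfolding good_def J'_def by auto
      moreover have "t \<ge> 0" using t of_nat_0_le_iff[of J'] by linarith
      ultimately show ?thesis using \<Gamma>img[of t] \<gamma>[of "nat \<lfloor>t\<rfloor>"] by blast
    qed
    then show ?thesis by (auto simp: eventually_at_top_linorder)
  qed
  have c4: "curve_converges_to_prime_end U b \<Gamma> p"
    unfolding curve_converges_to_prime_end_def R_def[symmetric] side
  proof
    fix n
    have "In (max n n0) \<subseteq> In n" by (rule In_mono) simp
    then have sub: "g ` (In (max n n0) - cball (h z) \<rho>) \<subseteq> g ` In n" by blast
    show "\<forall>\<^sub>F t in at_top. \<Gamma> t \<in> g ` In n"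
      by (rule eventually_mono[OF evgood[of "max n n0"]]) (use sub in auto)
  qed
  have c5: "\<not> curve_accumulates_on \<Gamma> z"
  proof
    assume "curve_accumulates_on \<Gamma> z"
    then obtain t :: "nat \<Rightarrow> real" where t: "filterlim t at_top sequentially" "(\<lambda>k. \<Gamma> (t k)) \<longlonglongrightarrow> z"
      unfolding curve_accumulates_on_def by blast
    have "\<forall>\<^sub>F k in sequentially. \<Gamma> (t k) \<in> g ` (In n0 - cball (h z) \<rho>)"
      using t(1) evgood[OF order_refl] by (auto simp: filterlim_iff)
    then have ev: "\<forall>\<^sub>F k in sequentially. \<Gamma> (t k) \<in> S - {b} \<and> \<rho> < dist (h z) (h (\<Gamma> (t k)))"
      by (rule eventually_mono) (use g_range hg' in force)
    then have "(\<lambda>k. h (\<Gamma> (t k))) \<longlonglongrightarrow> h z"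
      using t(2) zSb by (intro continuous_on_tendsto_compose[OF cont_h]) (auto elim: eventually_mono)
    then have "\<forall>\<^sub>F k in sequentially. dist (h (\<Gamma> (t k))) (h z) < \<rho>" using \<rho>(1) by (rule tendstoD)
    then have "\<forall>\<^sub>F k in sequentially. False" using ev by eventually_elim (simp add: dist_commute)
    then show False by simp
  qed
  show "\<exists>\<Gamma>. continuous_on {0..} \<Gamma> \<and> \<Gamma> ` {0..} \<subseteq> U \<and> curve_converges_to_prime_end U b \<Gamma> p \<and>
      range w \<subseteq> \<Gamma> ` {0..} \<and> \<not> curve_accumulates_on \<Gamma> z"
    using c1 c2 c3 c4 c5 by blast
qed

end

text \<open>\<open>weakly_locally_connected_at\<close> asks for small connected neighbourhoods that
  need not be open. The base point \<open>b\<close> also serves as the pole of the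
  projection.\<close>

theorem theorem1p3:
  fixes U :: "(complex \<times> real) set" and b z\<^sub>0 :: "complex \<times> real"
  assumes "openin (top_of_set riemann_sphere) U"
    and "connected U"
    and "simply_connected U"
    and "b \<in> U"
    and "\<exists>x \<in> riemann_sphere - U. \<exists>y \<in> riemann_sphere - U. x \<noteq> y"
    and "z\<^sub>0 \<in> (top_of_set riemann_sphere) frontier_of U"
  shows "weakly_locally_connected_at z\<^sub>0 (top_of_set (riemann_sphere - U)) \<longleftrightarrow>
         (\<forall>p \<in> prime_ends U b. z\<^sub>0 \<in> impression U b p \<longrightarrow> strongly_minimal U b p z\<^sub>0)"
proof -
  have "b \<in> riemann_sphere" using assms(1,4) openin_imp_subset by blast
  then obtain h g where "homeomorphism (riemann_sphere - {b}) (UNIV :: complex set) h g"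
    using punctured_sphere_homeomorphism by blast
  then interpret sphere_domain U b h g using assms by unfold_locales
  have z: "z\<^sub>0 \<in> riemann_sphere - U"
    using assms(6) openin_U by (auto simp: frontier_of_def interior_of_openin in_closure_of)
  show ?thesis
    using weakly_locally_connected_iff[OF z] loc_conn_imp_strongly_minimal[OF z]
      strongly_minimal_imp_loc_conn[OF z] by blast
qed

end
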